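(* Let $\mathcal M$ be a self-adjoint O*-vector space on a dense subspace $\mathcal D$ of a Hilbert space $\mathcal H$. Assume the graph topology $t_{\mathcal M}$ is defined by a sequence $\{T_n\}\subset\mathcal M$ of essentially self-adjoint operators which is norm-increasing ($\|T_n\xi\|\le\|T_{n+1}\xi\|$ for all $\xi\in\mathcal D$, $n\in\mathbb N$) and whose spectral projections (those of $\overline{T_n}$) leave $\mathcal D$ invariant. Let $E'$ be a projection in $\mathcal M'_{\rm w}$. Then $(\mathcal M''_{{\rm w}\sigma})_{E'}=(\mathcal M_{E'})''_{{\rm w}\sigma}$. In particular, if $\mathcal M$ is a partial GW*-algebra, then $\mathcal M_{E'}$ is a partial GW*-algebra on $E'\mathcal D$.
   Context: $\mathcal L^\dagger(\mathcal D,\mathcal H)$: linear operators $X$ with $D(X)=\mathcal D$, $D(X^* )\supseteq\mathcal D$, involution $X^\dagger=X^*\restriction_{\mathcal D}$, weak partial multiplication $X_1\square X_2={X_1^\dagger}^*X_2$ defined iff $X_2\mathcal D\subset D({X_1^\dagger}^* )$ and $X_1^*\mathcal D\subset D(X_2^* )$. O*-vector space: $\dagger$-invariant subspace; partial O*-algebra: O*-vector space closed under $\square$ when defined. $\mathcal M$ is self-adjoint if $\bigcap_{X\in\mathcal M}D(X^* )=\mathcal D$; fully closed if $\bigcap_{X\in\mathcal M}D(\overline X)=\mathcal D$. Graph topology $t_{\mathcal M}$: locally convex topology on $\mathcal D$ given by seminorms $\|\cdot\|$ and $\xi\mapsto\|X\xi\|$, $X\in\mathcal M$; "defined by $\{T_n\}$"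 means it coincides with the topology given by seminorms $\xi\mapsto\|T_n\xi\|$. Weak commutant $\mathcal M'_{\rm w}=\{C\in\mathcal B(\mathcal H):\langle CX\xi,\eta\rangle=\langle C\xi,X^\dagger\eta\rangle\ \forall X\in\mathcal M,\ \xi,\eta\in\mathcal D\}$. Unbounded bicommutant $\mathcal M''_{{\rm w}\sigma}=\{X\in\mathcal L^\dagger(\mathcal D,\mathcal H):\langle CX\xi,\eta\rangle=\langle C\xi,X^\dagger\eta\rangle\ \forall C\in\mathcal M'_{\rm w},\ \xi,\eta\in\mathcal D\}$. A fully closed partial O*-algebra $\mathcal M$ on $\mathcal D$ is a partial GW*-algebra if $\mathcal M'_{\rm w}\mathcal D\subset\mathcal D$ and $\mathcal M=\mathcal M''_{{\rm w}\sigma}$. Reduction: $\mathcal M_{E'}=\{X\restriction_{E'\mathcal D}:X\in\mathcal M\}$ in $\mathcal L^\dagger(E'\mathcal D,E'\mathcal H)$, $(\mathcal M''_{{\rm w}\sigma})_{E'}=\{X\restriction_{E'\mathcal D}:X\in\mathcal M''_{{\rm w}\sigma}\}$; commutants of $\mathcal M_{E'}$ are taken in $E'\mathcal H$ relative to the domain $E'\mathcal D$. *)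

theory Defs
  imports "HOL-Analysis.Analysis"
begin

class chilbert = ab_group_add +
  fixes cscale :: "complex \<Rightarrow> 'a \<Rightarrow> 'a"
    and cinner :: "'a \<Rightarrow> 'a \<Rightarrow> complex"
  assumes cscale_add_right: "cscale a (x + y) = cscale a x + cscale a y"
    and cscale_add_left: "cscale (a + b) x = cscale a x + cscale b x"
    and cscale_cscale: "cscale a (cscale b x) = cscale (a * b) x"
    and cscale_one: "cscale 1 x = x"
    and cinner_cnj_commute: "cinner x y = cnj (cinner y x)"
    and cinner_add_left: "cinner (x + y) z = cinner x z + cinner y z"
    and cinner_scale_left: "cinner (cscale r x) y = cnj r * cinner x y"
    and cinner_self_real_nonneg: "Im (cinner x x) = 0 \<and> 0 \<le> Re (cinner x x)"
    and cinner_self_eq_0: "cinner x x = 0 \<longleftrightarrow> x = 0"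
    and complete: "(\<forall>e>0. \<exists>N. \<forall>m\<ge>N. \<forall>n\<ge>N. sqrt (Re (cinner (X m - X n) (X m - X n))) < e)
                    \<Longrightarrow> \<exists>l. (\<lambda>n. sqrt (Re (cinner (X n - l) (X n - l)))) \<longlonglongrightarrow> 0"

definition cnorm :: "'a::chilbert \<Rightarrow> real" where
  "cnorm x = sqrt (Re (cinner x x))"

definition cconv :: "(nat \<Rightarrow> 'a::chilbert) \<Rightarrow> 'a \<Rightarrow> bool" where
  "cconv X l \<longleftrightarrow> (\<lambda>n. cnorm (X n - l)) \<longlonglongrightarrow> 0"

definition csubspace :: "'a::chilbert set \<Rightarrow> bool" where
  "csubspace S \<longleftrightarrow> 0 \<in> S \<and> (\<forall>x\<in>S. \<forall>y\<in>S. x + y \<in> S) \<and> (\<forall>c. \<forall>x\<in>S. cscale c x \<in> S)"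

definition dense_in :: "'a::chilbert set \<Rightarrow> 'a set \<Rightarrow> bool" where
  "dense_in D K \<longleftrightarrow> D \<subseteq> K \<and> (\<forall>x\<in>K. \<exists>X. (\<forall>n. X n \<in> D) \<and> cconv X x)"

definition linear_on :: "'a::chilbert set \<Rightarrow> ('a \<Rightarrow> 'a) \<Rightarrow> bool" where
  "linear_on S f \<longleftrightarrow> (\<forall>x\<in>S. \<forall>y\<in>S. f (x + y) = f x + f y) \<and> (\<forall>c. \<forall>x\<in>S. f (cscale c x) = cscale c (f x))"

section \<open>Operators: an operator is a function together with a domain S inside a Hilbert space K\<close>

definition adj_dom :: "'a::chilbert set \<Rightarrow> 'a set \<Rightarrow> ('a \<Rightarrow> 'a) \<Rightarrow> 'a set" where
  "adj_dom K S f = {\<eta>\<in>K. \<exists>\<zeta>\<in>K. \<forall>\<xi>\<in>S. cinner (f \<xi>) \<eta> = cinner \<xi> \<zeta>}"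

definition adj :: "'a::chilbert set \<Rightarrow> 'a set \<Rightarrow> ('a \<Rightarrow> 'a) \<Rightarrow> 'a \<Rightarrow> 'a" where
  "adj K S f \<eta> = (if \<eta> \<in> adj_dom K S f
      then (THE \<zeta>. \<zeta> \<in> K \<and> (\<forall>\<xi>\<in>S. cinner (f \<xi>) \<eta> = cinner \<xi> \<zeta>)) else 0)"

definition cl_dom :: "'a::chilbert set \<Rightarrow> 'a set \<Rightarrow> ('a \<Rightarrow> 'a) \<Rightarrow> 'a set" where
  "cl_dom K S f = {\<xi>\<in>K. \<exists>X. (\<forall>n. X n \<in> S) \<and> cconv X \<xi> \<and> (\<exists>\<eta>. cconv (\<lambda>n. f (X n)) \<eta>)}"

definition cl :: "'a::chilbert set \<Rightarrow> 'a set \<Rightarrow> ('a \<Rightarrow> 'a) \<Rightarrow> 'a \<Rightarrow> 'a" where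
  "cl K S f \<xi> = (if \<xi> \<in> cl_dom K S f
      then (THE \<eta>. \<exists>X. (\<forall>n. X n \<in> S) \<and> cconv X \<xi> \<and> cconv (\<lambda>n. f (X n)) \<eta>) else 0)"

text \<open>Elements of L^dagger(D,K) are represented by functions vanishing outside D.\<close>
definition LDag :: "'a::chilbert set \<Rightarrow> 'a set \<Rightarrow> ('a \<Rightarrow> 'a) set" where
  "LDag D K = {X. (\<forall>x. x \<notin> D \<longrightarrow> X x = 0) \<and> (\<forall>x\<in>D. X x \<in> K) \<and> linear_on D X
                  \<and> D \<subseteq> adj_dom K D X}"

definition restr :: "'a::chilbert set \<Rightarrow> ('a \<Rightarrow> 'a) \<Rightarrow> 'a \<Rightarrow> 'a" where
  "restr S X = (\<lambda>x. if x \<in> S then X x else 0)"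

definition dagger :: "'a::chilbert set \<Rightarrow> 'a set \<Rightarrow> ('a \<Rightarrow> 'a) \<Rightarrow> 'a \<Rightarrow> 'a" where
  "dagger D K X = restr D (adj K D X)"

definition wmult_defined :: "'a::chilbert set \<Rightarrow> 'a set \<Rightarrow> ('a \<Rightarrow> 'a) \<Rightarrow> ('a \<Rightarrow> 'a) \<Rightarrow> bool" where
  "wmult_defined D K X1 X2 \<longleftrightarrow>
     X2 ` D \<subseteq> adj_dom K D (dagger D K X1) \<and> adj K D X1 ` D \<subseteq> adj_dom K D X2"

definition wmult :: "'a::chilbert set \<Rightarrow> 'a set \<Rightarrow> ('a \<Rightarrow> 'a) \<Rightarrow> ('a \<Rightarrow> 'a) \<Rightarrow> 'a \<Rightarrow> 'a" where
  "wmult D K X1 X2 = restr D (\<lambda>x. adj K D (dagger D K X1) (X2 x))"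

definition O_star_vs :: "'a::chilbert set \<Rightarrow> 'a set \<Rightarrow> ('a \<Rightarrow> 'a) set \<Rightarrow> bool" where
  "O_star_vs D K M \<longleftrightarrow> M \<subseteq> LDag D K \<and> (\<lambda>_. 0) \<in> M
     \<and> (\<forall>X\<in>M. \<forall>Y\<in>M. (\<lambda>x. X x + Y x) \<in> M) \<and> (\<forall>c. \<forall>X\<in>M. (\<lambda>x. cscale c (X x)) \<in> M)
     \<and> (\<forall>X\<in>M. dagger D K X \<in> M)"

definition partial_O_star_alg :: "'a::chilbert set \<Rightarrow> 'a set \<Rightarrow> ('a \<Rightarrow> 'a) set \<Rightarrow> bool" where
  "partial_O_star_alg D K M \<longleftrightarrow> O_star_vs D K M
     \<and> (\<forall>X1\<in>M. \<forall>X2\<in>M. wmult_defined D K X1 X2 \<longrightarrow> wmult D K X1 X2 \<in> M)"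

definition self_adjoint_ovs :: "'a::chilbert set \<Rightarrow> 'a set \<Rightarrow> ('a \<Rightarrow> 'a) set \<Rightarrow> bool" where
  "self_adjoint_ovs D K M \<longleftrightarrow> (\<Inter>X\<in>M. adj_dom K D X) = D"

definition fully_closed :: "'a::chilbert set \<Rightarrow> 'a set \<Rightarrow> ('a \<Rightarrow> 'a) set \<Rightarrow> bool" where
  "fully_closed D K M \<longleftrightarrow> (\<Inter>X\<in>M. cl_dom K D X) = D"

text \<open>Bounded operators on K (represented by functions vanishing outside K).\<close>
definition BK :: "'a::chilbert set \<Rightarrow> ('a \<Rightarrow> 'a) set" where
  "BK K = {C. (\<forall>x. x \<notin> K \<longrightarrow> C x = 0) \<and> C ` K \<subseteq> K \<and> linear_on K C
              \<and> (\<exists>c. \<forall>x\<in>K. cnorm (C x) \<le> c * cnorm x)}"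

definition is_proj :: "'a::chilbert set \<Rightarrow> ('a \<Rightarrow> 'a) \<Rightarrow> bool" where
  "is_proj K E \<longleftrightarrow> E \<in> BK K \<and> (\<forall>x\<in>K. E (E x) = E x)
     \<and> (\<forall>x\<in>K. \<forall>y\<in>K. cinner (E x) y = cinner x (E y))"

definition weak_comm :: "'a::chilbert set \<Rightarrow> 'a set \<Rightarrow> ('a \<Rightarrow> 'a) set \<Rightarrow> ('a \<Rightarrow> 'a) set" where
  "weak_comm D K M = {C \<in> BK K. \<forall>X\<in>M. \<forall>\<xi>\<in>D. \<forall>\<eta>\<in>D.
       cinner (C (X \<xi>)) \<eta> = cinner (C \<xi>) (dagger D K X \<eta>)}"

definition bicomm :: "'a::chilbert set \<Rightarrow> 'a set \<Rightarrow> ('a \<Rightarrow> 'a) set \<Rightarrow> ('a \<Rightarrow> 'a) set" where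
  "bicomm D K M = {X \<in> LDag D K. \<forall>C\<in>weak_comm D K M. \<forall>\<xi>\<in>D. \<forall>\<eta>\<in>D.
       cinner (C (X \<xi>)) \<eta> = cinner (C \<xi>) (dagger D K X \<eta>)}"

definition partial_GW :: "'a::chilbert set \<Rightarrow> 'a set \<Rightarrow> ('a \<Rightarrow> 'a) set \<Rightarrow> bool" where
  "partial_GW D K M \<longleftrightarrow> partial_O_star_alg D K M \<and> fully_closed D K M
     \<and> (\<forall>C\<in>weak_comm D K M. C ` D \<subseteq> D) \<and> M = bicomm D K M"

text \<open>Reduction by a projection: M_{E'} acting on E'D.\<close>
definition reduce :: "'a::chilbert set \<Rightarrow> ('a \<Rightarrow> 'a) set \<Rightarrow> ('a \<Rightarrow> 'a) set" where
  "reduce S M = restr S ` M"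

definition seminorm_open :: "'a::chilbert set \<Rightarrow> ('a \<Rightarrow> real) set \<Rightarrow> 'a set \<Rightarrow> bool" where
  "seminorm_open D P U \<longleftrightarrow> U \<subseteq> D \<and> (\<forall>x\<in>U. \<exists>F e. finite F \<and> F \<subseteq> P \<and> e > 0
       \<and> {y\<in>D. \<forall>p\<in>F. p (y - x) < e} \<subseteq> U)"

definition graph_seminorms :: "('a::chilbert \<Rightarrow> 'a) set \<Rightarrow> ('a \<Rightarrow> real) set" where
  "graph_seminorms M = insert cnorm {(\<lambda>\<xi>. cnorm (X \<xi>)) | X. X \<in> M}"

definition graph_top_defined_by :: "'a::chilbert set \<Rightarrow> ('a \<Rightarrow> 'a) set \<Rightarrow> (nat \<Rightarrow> 'a \<Rightarrow> 'a) \<Rightarrow> bool" where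
  "graph_top_defined_by D M T \<longleftrightarrow>
     (\<forall>U. seminorm_open D (graph_seminorms M) U
          \<longleftrightarrow> seminorm_open D (range (\<lambda>n \<xi>. cnorm (T n \<xi>))) U)"

definition ess_self_adjoint :: "'a::chilbert set \<Rightarrow> 'a set \<Rightarrow> ('a \<Rightarrow> 'a) \<Rightarrow> bool" where
  "ess_self_adjoint D K T \<longleftrightarrow>
     (let S = cl_dom K D T; A = cl K D T in adj_dom K S A = S \<and> (\<forall>x\<in>S. adj K S A x = A x))"

definition pvm :: "'a::chilbert set \<Rightarrow> (real set \<Rightarrow> 'a \<Rightarrow> 'a) \<Rightarrow> bool" where
  "pvm K P \<longleftrightarrow> (\<forall>B\<in>sets borel. is_proj K (P B)) \<and> (\<forall>x\<in>K. P UNIV x = x)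
     \<and> (\<forall>A\<in>sets borel. \<forall>B\<in>sets borel. \<forall>x\<in>K. P (A \<inter> B) x = P A (P B x))
     \<and> (\<forall>A. range A \<subseteq> sets borel \<longrightarrow> disjoint_family A \<longrightarrow>
          (\<forall>x\<in>K. cconv (\<lambda>n. \<Sum>i<n. P (A i) x) (P (\<Union>i. A i) x)))"

definition spec_meas :: "(real set \<Rightarrow> 'a::chilbert \<Rightarrow> 'a) \<Rightarrow> 'a \<Rightarrow> real measure" where
  "spec_meas P x = measure_of UNIV (sets borel) (\<lambda>B. ennreal ((cnorm (P B x))\<^sup>2))"

text \<open>P is the spectral measure of the self-adjoint operator (S, A), i.e. A = \<integral> t dP(t).\<close>
definition spectral_measure_of :: "'a::chilbert set \<Rightarrow> (real set \<Rightarrow> 'a \<Rightarrow> 'a) \<Rightarrow> 'a set \<Rightarrow> ('a \<Rightarrow> 'a) \<Rightarrow> bool" where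
  "spectral_measure_of K P S A \<longleftrightarrow> pvm K P
     \<and> (\<forall>x\<in>K. x \<in> S \<longleftrightarrow> (\<integral>\<^sup>+ t. ennreal (t\<^sup>2) \<partial>spec_meas P x) < \<infinity>)
     \<and> (\<forall>x\<in>S. cinner (A x) x = complex_of_real (\<integral> t. t \<partial>spec_meas P x))"

definition spec_proj_invariant :: "'a::chilbert set \<Rightarrow> 'a set \<Rightarrow> ('a \<Rightarrow> 'a) \<Rightarrow> bool" where
  "spec_proj_invariant D K T \<longleftrightarrow>
     (\<forall>P. spectral_measure_of K P (cl_dom K D T) (cl K D T) \<longrightarrow> (\<forall>B\<in>sets borel. P B ` D \<subseteq> D))"

end

theory Submission
  imports Defs
begin

text \<open>
  Write \<open>N\<close> for the weak commutant of \<open>M\<close>; self-adjointness of \<open>M\<close> makes it a *-algebra of bounded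
  operators leaving \<open>D\<close> invariant. The only hard inclusion extends an operator \<open>Y\<close> of the
  bicommutant of the reduced space from \<open>E D\<close> to \<open>D\<close>. As \<open>D\<close> is a Frechet space in the graph
  topology, the uniform boundedness principle gives \<open>\<parallel>Y \<xi>\<parallel> \<le> c \<parallel>T \<xi>\<parallel>\<close> on \<open>E D\<close> for some \<open>T = T n\<close>, and
  the same for \<open>Y\<close>'s adjoint. Since \<open>T\<close> is essentially self-adjoint, \<open>A = T + i\<close> has dense range, so
  \<open>A \<xi> \<mapsto> Y \<xi>\<close> is a bounded operator \<open>B\<close> on \<open>E H\<close> commuting with \<open>E N E\<close>. As for von Neumann
  algebras, \<open>B\<close> extends to a bounded \<open>G\<close> commuting with \<open>N\<close> by \<open>\<Sum>C\<^sub>i h\<^sub>i \<mapsto> \<Sum>C\<^sub>i (B h\<^sub>i)\<close>, and \<open>G A\<close> is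
  the required extension of \<open>Y\<close>. That its adjoint is defined on \<open>D\<close> amounts to an identity between
  bounded operators commuting with \<open>N\<close>, which need only be verified on \<open>E H\<close>.
\<close>

subsection \<open>Complex inner product spaces\<close>

text \<open>Self-adjointness enters twice: besides making \<open>D\<close> invariant under
  \<open>N\<close>, which turns weak commutation into genuine commutation, it makes \<open>D\<close>
  complete in the graph topology. The obstacle in the extension step is the adjoint: it must be
  exhibited on all of \<open>D\<close>, while \<open>Y\<close> gives information on
  \<open>E D\<close> only. Hence the dagger of \<open>Y\<close> is extended as well, by an operator
  \<open>H\<close>, and the two extensions have to match. With \<open>R\<close> the bounded inverse
  of \<open>A\<close>, the requirement \<open><G A \<xi>, \<eta>> = <\<xi>, H A \<eta>>\<close>
  becomes an equation between products of \<open>G\<close>, \<open>H\<close>, \<open>R\<close> and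
  their adjoints. Commutation carries it from \<open>E H\<close> to the span of all
  \<open>C E H\<close> with \<open>C \<in> N\<close>. On the orthogonal complement of that span
  \<open>Y\<close> says nothing, and the equation holds because the extensions were chosen to vanish
  there and to have their range in the closed span. This is why every extension below is set to zero
  off its domain. Operators are handled together with their adjoints, so projections onto closures
  never have to be built.\<close>

lemma cscale_zero_right [simp]: "cscale c (0::'a::chilbert) = 0"
  using cscale_add_right[of c 0 "0::'a"] by simp

lemma cscale_zero_left [simp]: "cscale 0 (x::'a::chilbert) = 0"
  using cscale_add_left[of 0 0 x] by simp

lemma cscale_minus_right: "cscale c (- x) = - cscale c (x::'a::chilbert)"
  using cscale_add_right[of c "-x" x] by (simp add: eq_neg_iff_add_eq_0)

lemma cscale_minus_left: "cscale (- c) x = - cscale c (x::'a::chilbert)"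
  using cscale_add_left[of "-c" c x] by (simp add: eq_neg_iff_add_eq_0)

lemma cscale_minus_one: "cscale (- 1) x = - (x::'a::chilbert)"
  by (simp add: cscale_minus_left cscale_one)

lemma cscale_diff_right: "cscale c (x - y) = cscale c x - cscale c (y::'a::chilbert)"
  using cscale_add_right[of c x "-y"] by (simp add: cscale_minus_right)

lemma cinner_add_right: "cinner x (y + z) = cinner x y + cinner (x::'a::chilbert) z"
  by (metis cinner_cnj_commute cinner_add_left complex_cnj_add)

lemma cinner_scale_right: "cinner x (cscale r y) = r * cinner (x::'a::chilbert) y"
  by (metis cinner_cnj_commute cinner_scale_left complex_cnj_mult complex_cnj_cnj)

lemma cinner_zero_left [simp]: "cinner 0 (x::'a::chilbert) = 0"
  using cinner_add_left[of 0 0 x] by simp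

lemma cinner_zero_right [simp]: "cinner (x::'a::chilbert) 0 = 0"
  using cinner_add_right[of x 0 0] by simp

lemma cinner_minus_left: "cinner (- x) y = - cinner (x::'a::chilbert) y"
  using cinner_add_left[of "-x" x y] by (simp add: eq_neg_iff_add_eq_0)

lemma cinner_minus_right: "cinner x (- y) = - cinner (x::'a::chilbert) y"
  using cinner_add_right[of x "-y" y] by (simp add: eq_neg_iff_add_eq_0)

lemma cinner_diff_left: "cinner (x - y) z = cinner x z - cinner (y::'a::chilbert) z"
  using cinner_add_left[of x "-y" z] by (simp add: cinner_minus_left)

lemma cinner_diff_right: "cinner x (y - z) = cinner x y - cinner (x::'a::chilbert) z"
  using cinner_add_right[of x y "-z"] by (simp add: cinner_minus_right)

lemmas cinner_simps = cinner_add_left cinner_add_right cinner_diff_left cinner_diff_right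
  cinner_minus_left cinner_minus_right cinner_scale_left cinner_scale_right

lemma cnorm_ge_0 [simp]: "0 \<le> cnorm (x::'a::chilbert)"
  using cinner_self_real_nonneg[of x] by (simp add: cnorm_def)

lemma cinner_self: "cinner x x = complex_of_real ((cnorm (x::'a::chilbert))\<^sup>2)"
  using cinner_self_real_nonneg[of x] by (simp add: cnorm_def complex_eq_iff)

lemma cmod_cinner_self: "cmod (cinner x x) = (cnorm (x::'a::chilbert))\<^sup>2"
  by (simp only: cinner_self norm_of_real abs_power2)

lemma cnorm_eq_0 [simp]: "cnorm (x::'a::chilbert) = 0 \<longleftrightarrow> x = 0"
  using cinner_self[of x] cinner_self_eq_0[of x] by simp

lemma cnorm_zero [simp]: "cnorm (0::'a::chilbert) = 0"
  by simp

lemma cnorm_cscale: "cnorm (cscale c x) = cmod c * cnorm (x::'a::chilbert)"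
proof -
  have "c * cnj c = (complex_of_real (cmod c))\<^sup>2"
    by (metis complex_norm_square of_real_power)
  then have "cinner (cscale c x) (cscale c x) = complex_of_real ((cmod c * cnorm x)\<^sup>2)"
    by (simp add: cinner_simps cinner_self[of x] power_mult_distrib)
  then show ?thesis
    by (simp add: cnorm_def[of "cscale c x"] del: of_real_power)
qed

lemma cnorm_minus [simp]: "cnorm (- x) = cnorm (x::'a::chilbert)"
  by (simp add: cnorm_def cinner_simps)

lemma cnorm_minus_commute: "cnorm (x - y) = cnorm (y - (x::'a::chilbert))"
  by (metis cnorm_minus minus_diff_eq)

lemma cauchy_schwarz: "cmod (cinner x y) \<le> cnorm x * cnorm (y::'a::chilbert)"
proof (cases "y = 0")
  case False
  define n where "n = complex_of_real ((cnorm y)\<^sup>2)"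
  define t where "t = cinner y x / n"
  have n: "n \<noteq> 0" "cnj n = n" "cinner y y = n"
    using False by (auto simp: n_def cinner_self)
  have "cinner (x - cscale t y) (x - cscale t y)
      = cinner x x - t * cinner x y - cnj t * cinner y x + cnj t * t * n"
    by (simp add: cinner_simps n(3) algebra_simps)
  also have "\<dots> = cinner x x - cinner y x * cinner x y / n"
    using n by (simp add: t_def cinner_cnj_commute[of y x, symmetric] cinner_cnj_commute[of x y])
  also have "cinner y x * cinner x y = complex_of_real ((cmod (cinner x y))\<^sup>2)"
    by (metis cinner_cnj_commute complex_norm_square mult.commute)
  also have "cinner x x - complex_of_real ((cmod (cinner x y))\<^sup>2) / n
      = complex_of_real ((cnorm x)\<^sup>2 - (cmod (cinner x y))\<^sup>2 / (cnorm y)\<^sup>2)"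
    by (simp add: cinner_self n_def)
  finally have "(cnorm x)\<^sup>2 - (cmod (cinner x y))\<^sup>2 / (cnorm y)\<^sup>2 \<ge> 0"
    using cinner_self_real_nonneg[of "x - cscale t y"] by (metis Re_complex_of_real)
  then have "(cmod (cinner x y))\<^sup>2 \<le> (cnorm x * cnorm y)\<^sup>2"
    using False by (simp add: field_simps power_mult_distrib)
  then show ?thesis
    by (rule power2_le_imp_le) simp
qed simp

lemma cnorm_add_sq: "(cnorm (x + y))\<^sup>2 = (cnorm x)\<^sup>2 + (cnorm (y::'a::chilbert))\<^sup>2 + 2 * Re (cinner x y)"
proof -
  have "Re (cinner y x) = Re (cinner x y)"
    by (subst cinner_cnj_commute) simp
  moreover have "Re (cinner (x + y) (x + y)) = Re (cinner x x) + Re (cinner y y) + Re (cinner y x) + Re (cinner x y)"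
    by (simp add: cinner_simps)
  ultimately show ?thesis
    by (simp add: cinner_self del: of_real_power)
qed

lemma cnorm_triangle: "cnorm (x + y) \<le> cnorm x + cnorm (y::'a::chilbert)"
proof (rule power2_le_imp_le)
  have "(cnorm (x + y))\<^sup>2 = (cnorm x)\<^sup>2 + (cnorm y)\<^sup>2 + 2 * Re (cinner x y)"
    by (rule cnorm_add_sq)
  also have "Re (cinner x y) \<le> cnorm x * cnorm y"
    using cauchy_schwarz[of x y] complex_Re_le_cmod order_trans by blast
  finally show "(cnorm (x + y))\<^sup>2 \<le> (cnorm x + cnorm y)\<^sup>2"
    by (simp add: power2_sum)
qed simp

lemma abs_cnorm_diff_le: "\<bar>cnorm x - cnorm y\<bar> \<le> cnorm (x - (y::'a::chilbert))"
  using cnorm_triangle[of "x - y" y] cnorm_triangle[of "y - x" x] cnorm_minus_commute[of x y] by simp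

lemma cnorm_diff_sq: "(cnorm (x - y))\<^sup>2 = (cnorm x)\<^sup>2 + (cnorm (y::'a::chilbert))\<^sup>2 - 2 * Re (cinner x y)"
  using cnorm_add_sq[of x "-y"] by (simp add: cinner_simps)

lemma cinner_eqI:
  assumes "\<And>w. cinner w x = cinner w (y::'a::chilbert)"
  shows "x = y"
proof -
  have "cinner (x - y) (x - y) = 0"
    by (subst cinner_diff_right) (simp add: assms)
  then show ?thesis
    by (simp add: cinner_self_eq_0)
qed

lemma cinner_eqI_left:
  assumes "\<And>w. cinner x w = cinner (y::'a::chilbert) w"
  shows "x = y"
  by (rule cinner_eqI) (metis assms cinner_cnj_commute)

lemma cinner_eq_0_commute: "cinner x y = 0 \<longleftrightarrow> cinner y (x::'a::chilbert) = 0"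
  by (metis cinner_cnj_commute complex_cnj_zero)

subsection \<open>Convergence\<close>

lemma cconv_const [simp]: "cconv (\<lambda>_. x) (x::'a::chilbert)"
  by (simp add: cconv_def)

lemma cconv_bound:
  assumes "cconv X (x::'a::chilbert)" and "\<And>n. cnorm (Y n - y) \<le> c * cnorm (X n - x)"
  shows "cconv Y (y::'a::chilbert)"
  unfolding cconv_def
proof (rule tendsto_sandwich[of "\<lambda>_. 0"])
  show "(\<lambda>n. c * cnorm (X n - x)) \<longlonglongrightarrow> 0"
    using assms(1) unfolding cconv_def by (rule tendsto_mult_right_zero)
qed (use assms(2) in auto)

lemma cconv_add:
  assumes "cconv X (x::'a::chilbert)" "cconv Y y"
  shows "cconv (\<lambda>n. X n + Y n) (x + y)"
  unfolding cconv_def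
proof (rule tendsto_sandwich[of "\<lambda>_. 0"])
  show "(\<lambda>n. cnorm (X n - x) + cnorm (Y n - y)) \<longlonglongrightarrow> 0"
    using assms unfolding cconv_def by (rule tendsto_add_zero)
  show "\<forall>\<^sub>F n in sequentially. cnorm (X n + Y n - (x + y)) \<le> cnorm (X n - x) + cnorm (Y n - y)"
    by (metis (no_types, lifting) add_diff_add cnorm_triangle eventuallyI)
qed auto

lemma cconv_cscale:
  assumes "cconv X (x::'a::chilbert)"
  shows "cconv (\<lambda>n. cscale c (X n)) (cscale c x)"
  by (rule cconv_bound[OF assms, of _ _ "cmod c"])
     (simp add: cscale_diff_right[symmetric] cnorm_cscale)

lemma cconv_cinner_left:
  assumes "cconv X (x::'a::chilbert)"
  shows "(\<lambda>n. cinner (X n) z) \<longlonglongrightarrow> cinner x z"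
proof (rule Lim_null_comparison[THEN LIM_zero_cancel])
  show "\<forall>\<^sub>F n in sequentially. cmod (cinner (X n) z - cinner x z) \<le> cnorm (X n - x) * cnorm z"
    by (simp add: cinner_diff_left[symmetric] cauchy_schwarz)
  show "(\<lambda>n. cnorm (X n - x) * cnorm z) \<longlonglongrightarrow> 0"
    using assms unfolding cconv_def by (rule tendsto_mult_left_zero)
qed

lemma cconv_cinner_right:
  assumes "cconv X (x::'a::chilbert)"
  shows "(\<lambda>n. cinner z (X n)) \<longlonglongrightarrow> cinner z x"
  using tendsto_cnj[OF cconv_cinner_left[OF assms, of z]] by (simp add: cinner_cnj_commute[symmetric])

lemma cconv_cnorm:
  assumes "cconv X (x::'a::chilbert)"
  shows "(\<lambda>n. cnorm (X n)) \<longlonglongrightarrow> cnorm x"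
proof (rule Lim_null_comparison[THEN LIM_zero_cancel])
  show "\<forall>\<^sub>F n in sequentially. norm (cnorm (X n) - cnorm x) \<le> cnorm (X n - x)"
    by (simp add: abs_cnorm_diff_le)
  show "(\<lambda>n. cnorm (X n - x)) \<longlonglongrightarrow> 0"
    using assms unfolding cconv_def .
qed

lemma cconv_unique:
  assumes "cconv X (x::'a::chilbert)" "cconv X y"
  shows "x = y"
  by (rule cinner_eqI) (meson LIMSEQ_unique assms cconv_cinner_right)

lemma cauchy_cconv:
  fixes X :: "nat \<Rightarrow> 'a::chilbert"
  assumes "\<And>e. e > 0 \<Longrightarrow> \<exists>N. \<forall>m\<ge>N. \<forall>n\<ge>N. cnorm (X m - X n) < e"
  obtains x where "cconv X x"
  using complete[of X] assms unfolding cconv_def cnorm_def by blast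

subsection \<open>Riesz representation\<close>

text \<open>\<open>L\<close> need not be closed, so the representing vector is only a limit of
  vectors of \<open>L\<close>; the second conclusion records this through orthogonality. The
  alternative \<open>z = 0\<close> covers a negative \<open>b\<close>, for which \<open>L\<close> is
  trivial.\<close>

lemma riesz:
  fixes \<phi> :: "'a::chilbert \<Rightarrow> complex"
  assumes L: "csubspace L"
    and add: "\<And>x y. x \<in> L \<Longrightarrow> y \<in> L \<Longrightarrow> \<phi> (x + y) = \<phi> x + \<phi> y"
    and scale: "\<And>c x. x \<in> L \<Longrightarrow> \<phi> (cscale c x) = c * \<phi> x"
    and bdd: "\<And>x. x \<in> L \<Longrightarrow> cmod (\<phi> x) \<le> b * cnorm x"
  obtains z where "\<And>x. x \<in> L \<Longrightarrow> cinner z x = \<phi> x"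
    and "\<And>w. (\<And>x. x \<in> L \<Longrightarrow> cinner w x = 0) \<Longrightarrow> cinner w z = 0"
    and "cnorm z \<le> b \<or> z = 0"
proof -
  have L0: "0 \<in> L" and Ladd: "\<And>x y. x \<in> L \<Longrightarrow> y \<in> L \<Longrightarrow> x + y \<in> L"
    and Lsc: "\<And>c x. x \<in> L \<Longrightarrow> cscale c x \<in> L"
    using L unfolding csubspace_def by auto
  \<comment> \<open>For a representing vector \<open>z\<close> in the closure of \<open>L\<close>
    this is \<open>\<parallel>x - z\<parallel>^2 - \<parallel>z\<parallel>^2\<close>, so a
    minimizing sequence of \<open>F\<close> must approach \<open>z\<close>.\<close>
  define F where "F x = (cnorm x)\<^sup>2 - 2 * Re (\<phi> x)" for x
  have F_ge: "F x \<ge> - b\<^sup>2" if "x \<in> L" for x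
  proof -
    have "Re (\<phi> x) \<le> b * cnorm x"
      using bdd[OF that] complex_Re_le_cmod order_trans by blast
    moreover have "0 \<le> (cnorm x - b)\<^sup>2" by simp
    ultimately show ?thesis
      by (simp add: F_def power2_diff mult.commute)
  qed
  define m where "m = Inf (F ` L)"
  have bddF: "bdd_below (F ` L)"
    using F_ge by (auto intro!: bdd_belowI2)
  have m_le: "m \<le> F x" if "x \<in> L" for x
    unfolding m_def using that bddF by (intro cInf_lower) auto
  have "\<exists>x\<in>L. F x < m + 1 / Suc n" for n
  proof -
    have "Inf (F ` L) < m + 1 / Suc n" by (simp add: m_def)
    then show ?thesis
      using cInf_lessD[of "F ` L"] L0 by blast
  qed
  then obtain X where XL: "\<And>n. X n \<in> L" and XF: "\<And>n. F (X n) < m + 1 / Suc n"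
    by metis
  \<comment> \<open>Parallelogram law, with \<open>m \<le> F\<close> applied at the midpoint:
    near-minimizers are close to each other.\<close>
  have par: "(cnorm (x - y))\<^sup>2 \<le> 2 * (F x - m) + 2 * (F y - m)" if "x \<in> L" "y \<in> L" for x y
  proof -
    define u where "u = cscale (1/2) (x + y)"
    have u: "u \<in> L" using that Ladd Lsc by (simp add: u_def)
    have "\<phi> u = (\<phi> x + \<phi> y) / 2"
      using that by (simp add: u_def scale add Ladd)
    then have "Re (\<phi> u) = (Re (\<phi> x) + Re (\<phi> y)) / 2"
      by (simp only: Re_divide_numeral plus_complex.sel)
    moreover have "4 * (cnorm u)\<^sup>2 = (cnorm (x + y))\<^sup>2"
      by (simp add: u_def cnorm_cscale power_mult_distrib power2_eq_square norm_divide)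
    ultimately have "4 * F u = (cnorm (x + y))\<^sup>2 - 4 * Re (\<phi> x) - 4 * Re (\<phi> y)"
      by (simp add: F_def)
    moreover have "(cnorm (x - y))\<^sup>2 + (cnorm (x + y))\<^sup>2 = 2 * (cnorm x)\<^sup>2 + 2 * (cnorm y)\<^sup>2"
      by (simp add: cnorm_add_sq cnorm_diff_sq)
    ultimately show ?thesis
      using m_le[OF u] by (simp add: F_def)
  qed
  have "\<exists>N. \<forall>k\<ge>N. \<forall>n\<ge>N. cnorm (X k - X n) < e" if "e > 0" for e
  proof -
    obtain N where N: "4 / Suc N < e\<^sup>2"
    proof -
      obtain N where "4 / e\<^sup>2 < real N"
        using reals_Archimedean2 by blast
      then have "4 / Suc N < e\<^sup>2"
        using \<open>e > 0\<close> by (simp add: pos_divide_less_eq algebra_simps) (smt (verit) zero_less_power)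
      then show ?thesis using that by blast
    qed
    have "cnorm (X k - X n) < e" if "k \<ge> N" "n \<ge> N" for k n
    proof -
      have "1 / Suc k \<le> 1 / Suc N" "1 / Suc n \<le> 1 / Suc N"
        using that by (auto simp: field_simps)
      then have "(cnorm (X k - X n))\<^sup>2 < e\<^sup>2"
        using par[OF XL XL, of k n] XF[of k] XF[of n] N by simp
      then show ?thesis
        using \<open>e > 0\<close> by (simp add: power2_less_imp_less)
    qed
    then show ?thesis by blast
  qed
  then obtain z where z: "cconv X z"
    using cauchy_cconv by blast
  have near: "(\<lambda>n. cinner (X n) x - \<phi> x) \<longlonglongrightarrow> 0" if x: "x \<in> L" for x
  proof -
    have main: "(Re (cinner (X n) x - \<phi> x))\<^sup>2 \<le> (cnorm x)\<^sup>2 / Suc n" if x: "x \<in> L" for x n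
    proof (cases "x = 0")
      case True
      then show ?thesis using bdd[OF L0] by simp
    next
      case False
      define r where "r = Re (cinner (X n) x - \<phi> x)"
      \<comment> \<open>The minimizer of \<open>t^2 \<parallel>x\<parallel>^2 - 2 t r\<close>:
        moving from \<open>X n\<close> by \<open>- t x\<close> lowers \<open>F\<close> by
        \<open>r^2 / \<parallel>x\<parallel>^2\<close>, which cannot exceed the remaining gap
        \<open>1 / Suc n\<close>.\<close>
      define t where "t = r / (cnorm x)\<^sup>2"
      define y where "y = cscale (complex_of_real (- t)) x"
      have y: "y \<in> L" using x Lsc by (simp add: y_def)
      have "F (X n + y) = F (X n) + (cnorm y)\<^sup>2 + 2 * Re (cinner (X n) y) - 2 * Re (\<phi> y)"
        using XL y by (simp add: F_def cnorm_add_sq add)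
      also have "\<dots> = F (X n) + t\<^sup>2 * (cnorm x)\<^sup>2 - 2 * t * r"
        using scale[OF x, of "complex_of_real (- t)"]
        by (simp add: y_def cnorm_cscale r_def cinner_scale_right power_mult_distrib algebra_simps)
      also have "\<dots> = F (X n) - r\<^sup>2 / (cnorm x)\<^sup>2"
        using False by (simp add: t_def power2_eq_square)
      finally have "r\<^sup>2 / (cnorm x)\<^sup>2 \<le> 1 / Suc n"
        using m_le[OF Ladd[OF XL y], of n] XF[of n] by simp
      then show ?thesis
        unfolding r_def[symmetric] using False by (simp add: divide_simps mult.commute)
    qed
    have re: "(\<lambda>n. Re (cinner (X n) x - \<phi> x)) \<longlonglongrightarrow> 0" if x: "x \<in> L" for x
    proof -
      have "(\<lambda>n. (cnorm x)\<^sup>2 / Suc n) \<longlonglongrightarrow> 0"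
        using LIMSEQ_Suc[OF lim_const_over_n[of "(cnorm x)\<^sup>2"]] .
      then have "(\<lambda>n. (Re (cinner (X n) x - \<phi> x))\<^sup>2) \<longlonglongrightarrow> 0"
        by (rule Lim_null_comparison[rotated]) (use main[OF x] in auto)
      then have "(\<lambda>n. sqrt ((Re (cinner (X n) x - \<phi> x))\<^sup>2)) \<longlonglongrightarrow> sqrt 0"
        by (rule tendsto_real_sqrt)
      then show ?thesis
        using tendsto_rabs_zero_cancel by simp
    qed
    \<comment> \<open>The imaginary part at \<open>x\<close> is minus the real part at
      \<open>\<i> x\<close>.\<close>
    have "(\<lambda>n. Im (cinner (X n) x - \<phi> x)) \<longlonglongrightarrow> 0"
      using tendsto_minus[OF re[OF Lsc[OF x, of \<i>]]] scale[OF x, of \<i>]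
      by (simp add: cinner_scale_right)
    with re[OF x] have "(\<lambda>n. Complex (Re (cinner (X n) x - \<phi> x)) (Im (cinner (X n) x - \<phi> x))) \<longlonglongrightarrow> Complex 0 0"
      by (rule tendsto_Complex)
    then show ?thesis
      by (simp only: complex_surj zero_complex.code)
  qed
  have rep: "cinner z x = \<phi> x" if "x \<in> L" for x
  proof -
    have "(\<lambda>n. cinner (X n) x) \<longlonglongrightarrow> \<phi> x"
      using near[OF that] by (simp add: LIM_zero_iff)
    then show ?thesis
      using LIMSEQ_unique cconv_cinner_left[OF z] by blast
  qed
  moreover have "cinner w z = 0" if "\<And>x. x \<in> L \<Longrightarrow> cinner w x = 0" for w
    using cconv_cinner_right[OF z, of w] that XL by (simp add: LIMSEQ_const_iff)
  moreover have "cnorm z \<le> b \<or> z = 0"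
  proof -
    have "(\<lambda>n. cmod (cinner z (X n))) \<longlonglongrightarrow> cmod (cinner z z)"
      by (intro tendsto_norm cconv_cinner_right z)
    moreover have "(\<lambda>n. b * cnorm (X n)) \<longlonglongrightarrow> b * cnorm z"
      by (intro tendsto_mult_left cconv_cnorm z)
    ultimately have "cmod (cinner z z) \<le> b * cnorm z"
      by (rule LIMSEQ_le) (use rep XL bdd in auto)
    then have "cnorm z * cnorm z \<le> b * cnorm z"
      by (simp add: cinner_self norm_mult power2_eq_square)
    then show ?thesis
      using mult_right_le_imp_le[of "cnorm z" "cnorm z" b] cnorm_ge_0[of z]
      by (metis cnorm_eq_0 less_eq_real_def)
  qed
  ultimately show ?thesis
    using that by blast
qed

subsection \<open>Bounded operators and their adjoints\<close>

text \<open>Total maps with an adjoint are automatically linear, as the lemmas below derive by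
  testing against all vectors; norm bounds are carried separately.\<close>

definition adjoint_pair :: "('a::chilbert \<Rightarrow> 'a) \<Rightarrow> ('a \<Rightarrow> 'a) \<Rightarrow> bool" where
  "adjoint_pair A A' \<longleftrightarrow> (\<forall>x y. cinner (A x) y = cinner x (A' y))"

lemma adjoint_pairD: "adjoint_pair A A' \<Longrightarrow> cinner (A x) y = cinner x (A' y)"
  by (simp add: adjoint_pair_def)

lemma adjoint_pairD': "adjoint_pair A A' \<Longrightarrow> cinner (A' x) y = cinner x (A y)"
  by (metis adjoint_pair_def cinner_cnj_commute)

lemma adjoint_pair_sym: "adjoint_pair A A' \<Longrightarrow> adjoint_pair A' A"
  unfolding adjoint_pair_def by (metis cinner_cnj_commute)

lemma adjoint_pair_add: "adjoint_pair A A' \<Longrightarrow> A (x + y) = A x + A y"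
  by (rule cinner_eqI) (simp add: adjoint_pairD'[symmetric] cinner_simps)

lemma adjoint_pair_cscale: "adjoint_pair A A' \<Longrightarrow> A (cscale c x) = cscale c (A x)"
  by (rule cinner_eqI) (simp add: adjoint_pairD'[symmetric] cinner_simps)

lemma adjoint_pair_zero: "adjoint_pair A A' \<Longrightarrow> A 0 = 0"
  using adjoint_pair_cscale[of A A' 0 0] by simp

lemma adjoint_pair_diff: "adjoint_pair A A' \<Longrightarrow> A (x - y) = A x - A y"
  by (rule cinner_eqI) (simp add: adjoint_pairD'[symmetric] cinner_simps)

lemma adjoint_pair_bound:
  assumes ap: "adjoint_pair A A'" and b: "\<And>x. cnorm (A x) \<le> c * cnorm x"
  shows "cnorm (A' x) \<le> c * cnorm (x::'a::chilbert)"
proof (cases "A' x = 0")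
  case True
  have "0 \<le> c * cnorm x" using b[of x] cnorm_ge_0 order_trans by blast
  with True show ?thesis by simp
next
  case False
  have "cinner (A' x) (A' x) = cinner (A (A' x)) x"
    by (simp add: adjoint_pairD[OF ap])
  then have "(cnorm (A' x))\<^sup>2 = cmod (cinner (A (A' x)) x)"
    using cmod_cinner_self[of "A' x"] by simp
  also have "\<dots> \<le> cnorm (A (A' x)) * cnorm x"
    by (rule cauchy_schwarz)
  also have "\<dots> \<le> c * cnorm (A' x) * cnorm x"
    by (intro mult_right_mono b) simp
  finally have "cnorm (A' x) * cnorm (A' x) \<le> cnorm (A' x) * (c * cnorm x)"
    by (simp add: power2_eq_square mult_ac)
  moreover have "cnorm (A' x) > 0"
    using False by (metis cnorm_eq_0 cnorm_ge_0 less_eq_real_def)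
  ultimately show ?thesis
    by (rule mult_left_le_imp_le)
qed

lemma BK_UNIV_iff:
  "C \<in> BK UNIV \<longleftrightarrow> (\<forall>x y. C (x + y) = C x + C y) \<and> (\<forall>c x. C (cscale c x) = cscale c (C x))
    \<and> (\<exists>c. \<forall>x. cnorm (C x) \<le> c * cnorm x)"
  by (simp add: BK_def linear_on_def)

lemma adjoint_pair_BK:
  assumes "adjoint_pair A A'" and "\<And>x. cnorm (A x) \<le> c * cnorm (x::'a::chilbert)"
  shows "A \<in> BK UNIV"
  unfolding BK_UNIV_iff using assms adjoint_pair_add adjoint_pair_cscale by blast

lemma bounded_adjoint_exists:
  assumes "(C::'a::chilbert \<Rightarrow> 'a) \<in> BK UNIV"
  obtains C' where "adjoint_pair C C'" "C' \<in> BK UNIV"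
proof -
  obtain c where lin: "\<And>x y. C (x + y) = C x + C y" "\<And>a x. C (cscale a x) = cscale a (C x)"
    and c: "\<And>x. cnorm (C x) \<le> c * cnorm x"
    using assms unfolding BK_UNIV_iff by blast
  have "\<exists>z. \<forall>x. cinner (C x) y = cinner x z" for y
  proof -
    have "cmod (cinner y (C x)) \<le> (cnorm y * c) * cnorm x" for x
    proof -
      have "cmod (cinner y (C x)) \<le> cnorm y * cnorm (C x)" by (rule cauchy_schwarz)
      also have "\<dots> \<le> cnorm y * (c * cnorm x)" by (intro mult_left_mono c) simp
      finally show ?thesis by (simp add: mult_ac)
    qed
    note bd = this
    obtain z where "\<And>x. cinner z x = cinner y (C x)"
      by (rule riesz[of UNIV "\<lambda>x. cinner y (C x)" "cnorm y * c"])
         (auto simp: lin cinner_simps csubspace_def bd)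
    then show ?thesis
      by (metis cinner_cnj_commute)
  qed
  then obtain C' where "adjoint_pair C C'"
    unfolding adjoint_pair_def by metis
  moreover from this have "C' \<in> BK UNIV"
    using adjoint_pair_BK[OF adjoint_pair_sym] adjoint_pair_bound c by blast
  ultimately show ?thesis using that by blast
qed

text \<open>The range of \<open>Q'\<close> is orthogonal to \<open>S\<close>, so \<open>Q\<close> vanishes on it, that is \<open>Q Q' = 0\<close>.\<close>

lemma zero_on_set_and_complement:
  assumes ap: "adjoint_pair Q Q'"
    and S: "\<And>x. x \<in> S \<Longrightarrow> Q x = 0"
    and perp: "\<And>x. (\<And>s. s \<in> S \<Longrightarrow> cinner s x = 0) \<Longrightarrow> Q x = 0"
  shows "Q x = (0::'a::chilbert)"
proof -
  have "Q' w = 0" for w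
  proof -
    have "Q (Q' w) = 0"
      by (rule perp) (simp add: adjoint_pairD[OF ap, symmetric] S)
    then have "cinner (Q' w) (Q' w) = 0"
      by (simp add: adjoint_pairD'[OF ap])
    then show ?thesis by (simp add: cinner_self_eq_0)
  qed
  then show ?thesis
    by (intro cinner_eqI_left) (simp add: adjoint_pairD[OF ap])
qed

subsection \<open>Extension of bounded linear relations\<close>

text \<open>Intended for the graph of a bounded linear map on a subspace: \<open>G\<close> is its
  continuous extension, set to zero on the orthogonal complement of the domain. The third clause
  makes \<open>G\<close> unique, the fourth keeps its range in the closed span of
  \<open>Range \<Gamma>\<close>; orthogonality expresses both without closures.\<close>

definition canonical_ext :: "('a::chilbert \<times> 'a) set \<Rightarrow> ('a \<Rightarrow> 'a) \<Rightarrow> bool" where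
  "canonical_ext \<Gamma> G \<longleftrightarrow> (\<exists>G'. adjoint_pair G G') \<and> (\<forall>x y. (x, y) \<in> \<Gamma> \<longrightarrow> G x = y)
     \<and> (\<forall>x. (\<forall>s\<in>Domain \<Gamma>. cinner s x = 0) \<longrightarrow> G x = 0)
     \<and> (\<forall>x z. (\<forall>y\<in>Range \<Gamma>. cinner y z = 0) \<longrightarrow> cinner (G x) z = 0)"

text \<open>The adjoint comes first: \<open>G' w\<close> is the Riesz vector of the functional
  \<open>x \<mapsto> <w, g x>\<close> on the domain, and \<open>G\<close> is the adjoint of
  \<open>G'\<close>. Since \<open>G'\<close> takes values in the closed domain, \<open>G\<close>
  vanishes on the complement.\<close>

lemma bounded_relation_extension:
  fixes \<Gamma> :: "('a::chilbert \<times> 'a) set"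
  assumes zero: "(0, 0) \<in> \<Gamma>"
    and add: "\<And>x y x' y'. (x, y) \<in> \<Gamma> \<Longrightarrow> (x', y') \<in> \<Gamma> \<Longrightarrow> (x + x', y + y') \<in> \<Gamma>"
    and scale: "\<And>c x y. (x, y) \<in> \<Gamma> \<Longrightarrow> (cscale c x, cscale c y) \<in> \<Gamma>"
    and bound: "\<And>x y. (x, y) \<in> \<Gamma> \<Longrightarrow> cnorm y \<le> b * cnorm x"
    and b: "b \<ge> 0"
  obtains G where "canonical_ext \<Gamma> G" "\<And>x. cnorm (G x) \<le> b * cnorm x"
proof -
  \<comment> \<open>Single-valuedness: the bound kills a pair whose first component is zero.\<close>
  have fun': "y = y'" if "(x, y) \<in> \<Gamma>" "(x, y') \<in> \<Gamma>" for x y y'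
  proof -
    have "(x + cscale (-1) x, y + cscale (-1) y') \<in> \<Gamma>"
      using that add scale by blast
    then have "cnorm (y - y') \<le> b * cnorm (x - x)"
      using bound by (fastforce simp: cscale_minus_one)
    then show ?thesis using cnorm_ge_0[of "y - y'"] by simp
  qed
  define L where "L = Domain \<Gamma>"
  define g where "g x = (THE y. (x, y) \<in> \<Gamma>)" for x
  have g: "g x = y" if "(x, y) \<in> \<Gamma>" for x y
    unfolding g_def using fun' that by blast
  have L: "csubspace L"
    unfolding csubspace_def L_def using zero add scale by blast
  have gG: "(x, g x) \<in> \<Gamma>" if "x \<in> L" for x
    using that g unfolding L_def by blast
  have g_add: "g (x + y) = g x + g y" if "x \<in> L" "y \<in> L" for x y
    using that gG add g by blast
  have g_scale: "g (cscale c x) = cscale c (g x)" if "x \<in> L" for c x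
    using that gG scale g by blast
  \<comment> \<open>The second clause puts \<open>z\<close> in the closure of \<open>L\<close>. It
    singles out one representer, and linearity of \<open>G'\<close> then follows from
    uniqueness.\<close>
  define rep where "rep w z \<longleftrightarrow> (\<forall>x\<in>L. cinner z x = cinner w (g x))
      \<and> (\<forall>v. (\<forall>x\<in>L. cinner v x = 0) \<longrightarrow> cinner v z = 0)" for w z
  have rep_ex: "\<exists>z. rep w z \<and> cnorm z \<le> b * cnorm w" for w
  proof -
    have "cmod (cinner w (g x)) \<le> (b * cnorm w) * cnorm x" if "x \<in> L" for x
    proof -
      have "cmod (cinner w (g x)) \<le> cnorm w * cnorm (g x)" by (rule cauchy_schwarz)
      also have "\<dots> \<le> cnorm w * (b * cnorm x)"
        using bound[OF gG[OF that]] by (intro mult_left_mono) auto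
      finally show ?thesis by (simp add: mult_ac)
    qed
    note bd = this
    obtain z where "\<And>x. x \<in> L \<Longrightarrow> cinner z x = cinner w (g x)"
      "\<And>v. (\<And>x. x \<in> L \<Longrightarrow> cinner v x = 0) \<Longrightarrow> cinner v z = 0"
      "cnorm z \<le> b * cnorm w \<or> z = 0"
      by (rule riesz[of L "\<lambda>x. cinner w (g x)" "b * cnorm w", OF L])
         (auto simp: g_add g_scale cinner_simps bd)
    moreover from this(3) have "cnorm z \<le> b * cnorm w"
      using b by auto
    ultimately show ?thesis
      unfolding rep_def by blast
  qed
  have rep_unique: "z = z'" if "rep w z" "rep w z'" for w z z'
  proof -
    have "\<forall>x\<in>L. cinner (z - z') x = 0"
      using that by (simp add: rep_def cinner_simps)
    then have "cinner (z - z') z = 0" "cinner (z - z') z' = 0"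
      using that unfolding rep_def by blast+
    then have "cinner (z - z') (z - z') = 0"
      by (subst cinner_diff_right) simp
    then show ?thesis by (simp add: cinner_self_eq_0)
  qed
  obtain G' where G': "\<And>w. rep w (G' w)" and G'_b: "\<And>w. cnorm (G' w) \<le> b * cnorm w"
    using rep_ex by metis
  have "G' (w + w') = G' w + G' w'" for w w'
    by (rule rep_unique[OF G']) (use G'[of w] G'[of w'] in \<open>auto simp: rep_def cinner_simps\<close>)
  moreover have "G' (cscale c w) = cscale c (G' w)" for c w
    by (rule rep_unique[OF G']) (use G'[of w] in \<open>auto simp: rep_def cinner_simps\<close>)
  ultimately have "G' \<in> BK UNIV"
    unfolding BK_UNIV_iff using G'_b by blast
  then obtain G where "adjoint_pair G' G"
    using bounded_adjoint_exists by blast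
  then have ap: "adjoint_pair G G'" by (rule adjoint_pair_sym)
  have Gg: "G x = g x" if "x \<in> L" for x
    by (rule cinner_eqI) (use G' that in \<open>simp add: adjoint_pairD'[OF ap, symmetric] rep_def\<close>)
  have "canonical_ext \<Gamma> G"
    unfolding canonical_ext_def
  proof (intro conjI allI impI)
    show "\<exists>G'. adjoint_pair G G'" using ap by blast
    show "G x = y" if "(x, y) \<in> \<Gamma>" for x y
      using that Gg g unfolding L_def by blast
    show "G x = 0" if "\<forall>s\<in>Domain \<Gamma>. cinner s x = 0" for x
    proof (rule cinner_eqI_left)
      fix w
      have "cinner x (G' w) = 0"
        using G'[of w] that unfolding rep_def L_def by (meson cinner_eq_0_commute)
      then show "cinner (G x) w = cinner 0 w" by (simp add: adjoint_pairD[OF ap])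
    qed
    show "cinner (G x) z = 0" if "\<forall>y\<in>Range \<Gamma>. cinner y z = 0" for x z
    proof -
      have "rep z 0"
        unfolding rep_def using that gG by (metis RangeI cinner_eq_0_commute cinner_zero_left cinner_zero_right)
      then have "G' z = 0" using rep_unique G' by blast
      then show ?thesis by (simp add: adjoint_pairD[OF ap])
    qed
  qed
  moreover have "cnorm (G x) \<le> b * cnorm x" for x
    using adjoint_pair_bound[OF adjoint_pair_sym[OF ap]] G'_b by blast
  ultimately show ?thesis using that by blast
qed

text \<open>\<open>G C - C G\<close> vanishes on the domain since \<open>C\<close> maps the graph
  into itself, and on the orthogonal complement since \<open>C\<close> preserves it (the adjoint
  \<open>C'\<close> preserves the domain) and \<open>G\<close> is zero there.\<close>

lemma canonical_ext_commute:
  assumes G: "canonical_ext \<Gamma> G" and ap: "adjoint_pair C C'"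
    and inv: "\<And>x y. (x, y) \<in> \<Gamma> \<Longrightarrow> (C x, C y) \<in> \<Gamma>"
    and inv': "\<And>x. x \<in> Domain \<Gamma> \<Longrightarrow> C' x \<in> Domain \<Gamma>"
  shows "G (C x) = C (G x)"
proof -
  obtain G' where G': "adjoint_pair G G'" using G unfolding canonical_ext_def by blast
  have Gy: "G x = y" if "(x, y) \<in> \<Gamma>" for x y
    using G that unfolding canonical_ext_def by blast
  have Gperp: "G x = 0" if "\<forall>s\<in>Domain \<Gamma>. cinner s x = 0" for x
    using G that unfolding canonical_ext_def by blast
  have "G (C x) - C (G x) = 0"
  proof (rule zero_on_set_and_complement[where Q = "\<lambda>x. G (C x) - C (G x)"
        and Q' = "\<lambda>x. C' (G' x) - G' (C' x)" and S = "Domain \<Gamma>"])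
    show "adjoint_pair (\<lambda>x. G (C x) - C (G x)) (\<lambda>x. C' (G' x) - G' (C' x))"
      by (simp add: adjoint_pair_def cinner_diff_left cinner_diff_right
          adjoint_pairD[OF ap] adjoint_pairD[OF G'])
    show "G (C x) - C (G x) = 0" if "x \<in> Domain \<Gamma>" for x
      using that inv Gy by fastforce
    show "G (C x) - C (G x) = 0" if "\<And>s. s \<in> Domain \<Gamma> \<Longrightarrow> cinner s x = 0" for x
    proof -
      have "G (C x) = 0"
        by (rule Gperp) (simp add: adjoint_pairD'[OF ap, symmetric] that inv')
      moreover have "G x = 0" using Gperp that by blast
      ultimately show ?thesis using adjoint_pair_zero[OF ap] by simp
    qed
  qed
  then show ?thesis by simp
qed

subsection \<open>Extending elements of the commutant of a reduced algebra\<close>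

text \<open>
  With \<open>\<Phi> m = \<parallel>V (S\<^sup>m h)\<parallel>\<close> for a positive operator \<open>S\<close> commuting with \<open>V\<^sup>* V\<close>, iterating Cauchy-Schwarz
  yields \<open>\<parallel>V (S h)\<parallel> \<le> \<parallel>S\<parallel> \<parallel>V h\<parallel>\<close> without square roots of positive operators.
\<close>

lemma power_trick:
  fixes \<Phi> :: "nat \<Rightarrow> real"
  assumes nonneg: "\<And>m. 0 \<le> \<Phi> m"
    and sq: "\<And>m. (\<Phi> m)\<^sup>2 \<le> \<Phi> (2 * m) * \<Phi> 0"
    and growth: "\<And>m. \<Phi> m \<le> K * s ^ m"
    and s: "0 \<le> s"
  shows "\<Phi> 1 \<le> s * \<Phi> 0"
proof (rule ccontr)
  assume neg: "\<not> \<Phi> 1 \<le> s * \<Phi> 0"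
  have pos1: "\<Phi> 1 > 0" using neg nonneg[of 0] s
    by (meson mult_nonneg_nonneg not_le order_le_less_trans)
  then have pos0: "\<Phi> 0 > 0"
    using sq[of 1] nonneg[of 0] by (metis less_eq_real_def mult_zero_right not_le zero_less_power)
  have spos: "s > 0" using growth[of 1] pos1 s by (cases "s = 0") auto
  \<comment> \<open>Each use of \<open>sq\<close> doubles the exponent. Cleared of denominators,
    this is \<open>(\<Phi> 1 / \<Phi> 0)^(2^j) \<le> \<Phi> (2^j) / \<Phi> 0\<close>.\<close>
  have iter: "\<Phi> 1 ^ 2 ^ j * \<Phi> 0 \<le> \<Phi> (2 ^ j) * \<Phi> 0 ^ 2 ^ j" for j
  proof (induction j)
    case (Suc j)
    have "(\<Phi> 1 ^ 2 ^ j * \<Phi> 0)\<^sup>2 \<le> (\<Phi> (2 ^ j) * \<Phi> 0 ^ 2 ^ j)\<^sup>2"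
      by (rule power_mono[OF Suc]) (use nonneg in auto)
    also have "\<dots> = (\<Phi> (2 ^ j))\<^sup>2 * \<Phi> 0 ^ 2 ^ Suc j"
      by (simp add: power_mult_distrib power_mult[symmetric] mult.commute)
    also have "\<dots> \<le> (\<Phi> (2 * 2 ^ j) * \<Phi> 0) * \<Phi> 0 ^ 2 ^ Suc j"
      by (intro mult_right_mono sq) (use nonneg in auto)
    finally have "\<Phi> 0 * (\<Phi> 1 ^ 2 ^ Suc j * \<Phi> 0) \<le> \<Phi> 0 * (\<Phi> (2 ^ Suc j) * \<Phi> 0 ^ 2 ^ Suc j)"
      by (simp add: power_mult_distrib power_mult[symmetric] mult_ac power2_eq_square
          power_add[symmetric] mult_2)
    then show ?case using pos0 by (simp only: mult_le_cancel_left_pos)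
  qed simp
  \<comment> \<open>Were the claim false, \<open>q\<close> would exceed 1 and its powers at
    exponents \<open>2 ^ n\<close> would be unbounded, while \<open>growth\<close> caps them at
    \<open>K / \<Phi> 0\<close>.\<close>
  define q where "q = \<Phi> 1 / (s * \<Phi> 0)"
  have q: "q > 1" using neg spos pos0 by (simp add: q_def)
  obtain n where n: "K / \<Phi> 0 < q ^ n" using real_arch_pow[OF q] by blast
  have "q ^ n \<le> q ^ 2 ^ n" using q by (intro power_increasing) (auto intro: less_imp_le)
  also have "q ^ 2 ^ n = \<Phi> 1 ^ 2 ^ n / (s * \<Phi> 0) ^ 2 ^ n" by (simp add: q_def power_divide)
  also have "\<dots> \<le> K / \<Phi> 0"
  proof -
    have "\<Phi> 1 ^ 2 ^ n * \<Phi> 0 \<le> (K * s ^ 2 ^ n) * \<Phi> 0 ^ 2 ^ n"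
      using iter[of n] mult_right_mono[OF growth[of "2 ^ n"], of "\<Phi> 0 ^ 2 ^ n"] nonneg[of 0] by simp
    then show ?thesis
      using pos0 spos by (simp add: divide_simps power_mult_distrib mult_ac)
  qed
  finally show False using n by simp
qed

section \<open>Formal sums over a *-algebra and amplified operators\<close>

locale star_algebra =
  fixes N :: "('a::chilbert \<Rightarrow> 'a) set" and E :: "'a \<Rightarrow> 'a"
  assumes N_adj: "\<And>C. C \<in> N \<Longrightarrow> \<exists>C'\<in>N. adjoint_pair C C'"
    and N_mult: "\<And>C C'. C \<in> N \<Longrightarrow> C' \<in> N \<Longrightarrow> (\<lambda>x. C (C' x)) \<in> N"
    and N_bounded: "\<And>C. C \<in> N \<Longrightarrow> \<exists>c. \<forall>x. cnorm (C x) \<le> c * cnorm x"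
    and E_in_N: "E \<in> N" and E_idem: "\<And>x. E (E x) = E x" and E_adj: "adjoint_pair E E"
begin

text \<open>A list encodes a formal sum of terms \<open>C\<^sub>i E h\<^sub>i\<close>:
  \<open>ampl l (\<lambda>x. x)\<close> is its value, and \<open>ampl l P\<close> is the value that
  the desired extension of \<open>P\<close> should take on it. Formal sums are kept because one
  vector may have many representations.\<close>

definition ampl :: "(('a \<Rightarrow> 'a) \<times> 'a) list \<Rightarrow> ('a \<Rightarrow> 'a) \<Rightarrow> 'a" where
  "ampl l P = sum_list (map (\<lambda>(C, h). C (E (P h))) l)"

definition reduced_comm :: "('a \<Rightarrow> 'a) \<Rightarrow> bool" where
  "reduced_comm P \<longleftrightarrow> (\<forall>C\<in>N. \<forall>x. P (E (C (E x))) = E (C (E (P x))))"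

lemma N_E_left: "C \<in> N \<Longrightarrow> (\<lambda>x. C (E x)) \<in> N"
  using N_mult E_in_N by blast

lemma ampl_Nil [simp]: "ampl [] P = 0"
  by (simp add: ampl_def)

lemma ampl_Cons [simp]: "ampl ((C, h) # l) P = C (E (P h)) + ampl l P"
  by (simp add: ampl_def)

lemma ampl_append: "ampl (l @ l') P = ampl l P + ampl l' P"
  by (simp add: ampl_def)

lemma reduced_comm_adj:
  assumes "reduced_comm P" "adjoint_pair P P'"
  shows "reduced_comm P'"
  unfolding reduced_comm_def
proof (intro ballI allI)
  fix C x assume "C \<in> N"
  then obtain C' where C': "C' \<in> N" "adjoint_pair C C'" using N_adj by blast
  show "P' (E (C (E x))) = E (C (E (P' x)))"
  proof (rule cinner_eqI_left)
    fix w
    have "cinner (P' (E (C (E x)))) w = cinner x (E (C' (E (P w))))"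
      using assms(2) C'(2) E_adj by (simp add: adjoint_pairD adjoint_pairD')
    also have "\<dots> = cinner x (P (E (C' (E w))))"
      using assms(1) C'(1) by (simp add: reduced_comm_def)
    also have "\<dots> = cinner (E (C (E (P' x)))) w"
      using assms(2) C'(2) E_adj by (simp add: adjoint_pairD adjoint_pairD')
    finally show "cinner (P' (E (C (E x)))) w = cinner (E (C (E (P' x)))) w" .
  qed
qed

text \<open>With \<open>F'\<close> the adjoint of \<open>F\<close>, the product \<open>F' C\<close>
  lies in \<open>N\<close>, so \<open>Q'\<close> passes through its compression by \<open>E\<close>.
  Here both the involution and the products of \<open>N\<close> are used.\<close>

lemma cinner_ampl_term:
  assumes "C \<in> N" "F \<in> N" "reduced_comm Q" "adjoint_pair Q Q'"
  shows "cinner (C (E (P h))) (F (E (Q g))) = cinner (C (E (Q' (P h)))) (F (E g))"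
proof -
  obtain F' where F': "F' \<in> N" "adjoint_pair F F'" using N_adj assms by blast
  have FC: "(\<lambda>x. F' (C x)) \<in> N" using F' N_mult assms by blast
  have Q': "reduced_comm Q'" using reduced_comm_adj assms by blast
  have "cinner (C (E (P h))) (F (E (Q g))) = cinner (Q' (E (F' (C (E (P h)))))) g"
    using F'(2) E_adj assms(4) by (simp add: adjoint_pairD adjoint_pairD')
  also have "Q' (E (F' (C (E (P h))))) = E (F' (C (E (Q' (P h)))))"
    using Q'[unfolded reduced_comm_def, rule_format, OF FC] .
  also have "cinner (E (F' (C (E (Q' (P h)))))) g = cinner (C (E (Q' (P h)))) (F (E g))"
    using F'(2) E_adj by (simp add: adjoint_pairD adjoint_pairD')
  finally show ?thesis .
qed

text \<open>With \<open>V\<close> the row of the \<open>C\<^sub>i E\<close> and equal lists, this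
  says that the Gram matrix \<open>V\<^sup>* V\<close> commutes with an amplified operator, which is
  what the power argument requires.\<close>

lemma cinner_ampl:
  assumes l: "set l \<subseteq> N \<times> UNIV" "set l' \<subseteq> N \<times> UNIV" and Q: "reduced_comm Q" "adjoint_pair Q Q'"
  shows "cinner (ampl l P) (ampl l' Q) = cinner (ampl l (\<lambda>x. Q' (P x))) (ampl l' (\<lambda>x. x))"
  using l(1)
proof (induction l)
  case (Cons a l)
  obtain C h where a: "a = (C, h)" by fastforce
  have "cinner (C (E (P h))) (ampl l' Q) = cinner (C (E (Q' (P h)))) (ampl l' (\<lambda>x. x))"
    using l(2)
  proof (induction l')
    case (Cons a' l')
    obtain F g where "a' = (F, g)" by fastforce
    with Cons show ?case
      using \<open>set (a # l) \<subseteq> _\<close> a Q by (simp add: cinner_add_right cinner_ampl_term)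
  qed simp
  with Cons a show ?case by (simp add: cinner_add_left)
qed simp

text \<open>\<open>K\<close> depends on \<open>l\<close> alone, not on \<open>P\<close>. It supplies
  the growth constant for the powers of one operator and leaves no trace in the final bound.\<close>

lemma ampl_bound:
  assumes l: "set l \<subseteq> N \<times> UNIV"
  shows "\<exists>K\<ge>0. \<forall>P b. b \<ge> 0 \<longrightarrow> (\<forall>x. cnorm (P x) \<le> b * cnorm x) \<longrightarrow> cnorm (ampl l P) \<le> K * b"
  using l
proof (induction l)
  case Nil
  then show ?case by (intro exI[of _ 0]) auto
next
  case (Cons a l)
  obtain C h where a: "a = (C, h)" by fastforce
  obtain K where K: "K \<ge> 0" "\<And>P b. b \<ge> 0 \<Longrightarrow> \<forall>x. cnorm (P x) \<le> b * cnorm x \<Longrightarrow> cnorm (ampl l P) \<le> K * b"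
    using Cons by auto
  have "(\<lambda>x. C (E x)) \<in> N" using Cons(2) a N_E_left by auto
  then obtain c where c: "\<And>x. cnorm (C (E x)) \<le> c * cnorm x" using N_bounded by blast
  have c': "cnorm (C (E x)) \<le> \<bar>c\<bar> * cnorm x" for x
    using c[of x] mult_right_mono[OF abs_ge_self[of c] cnorm_ge_0[of x]] by simp
  have "cnorm (ampl (a # l) P) \<le> (\<bar>c\<bar> * cnorm h + K) * b" if b: "b \<ge> 0" "\<forall>x. cnorm (P x) \<le> b * cnorm x" for P b
  proof -
    have "cnorm (C (E (P h))) \<le> \<bar>c\<bar> * (b * cnorm h)"
      using c'[of "P h"] b(2) mult_left_mono[of "cnorm (P h)" "b * cnorm h" "\<bar>c\<bar>"] by (metis abs_ge_zero order_trans)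
    then show ?thesis
      using K(2)[OF b] cnorm_triangle[of "C (E (P h))" "ampl l P"] by (simp add: a algebra_simps)
  qed
  then show ?case
    using K(1) by (intro exI[of _ "\<bar>c\<bar> * cnorm h + K"]) auto
qed

text \<open>The constant \<open>b\<close> survives unchanged, whatever the length of
  \<open>l\<close>; hence equal sums have equal images and the extension is well defined and
  bounded.\<close>

lemma ampl_contraction:
  assumes l: "set l \<subseteq> N \<times> UNIV" and B: "reduced_comm B" and ap: "adjoint_pair B B'"
    and b: "\<And>x. cnorm (B x) \<le> b * cnorm x" "b \<ge> 0"
  shows "cnorm (ampl l B) \<le> b * cnorm (ampl l (\<lambda>x. x))"
proof -
  define S where "S x = B' (B x)" for x
  have B': "reduced_comm B'" using reduced_comm_adj[OF B ap] .
  have S_comm: "reduced_comm (S ^^ m)" for m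
    using B B' by (induction m) (simp_all add: reduced_comm_def S_def)
  have S_adj: "adjoint_pair (S ^^ m) (S ^^ m)" for m
  proof (induction m)
    case (Suc m)
    have "adjoint_pair S S" by (simp add: adjoint_pair_def S_def adjoint_pairD[OF ap] adjoint_pairD'[OF ap])
    then show ?case
      using Suc by (simp add: adjoint_pair_def) (metis funpow_swap1)
  qed (simp add: adjoint_pair_def)
  have S_b: "cnorm (S x) \<le> b\<^sup>2 * cnorm x" for x
  proof -
    have "cnorm (S x) \<le> b * cnorm (B x)" unfolding S_def using adjoint_pair_bound[OF ap] b by blast
    also have "\<dots> \<le> b * (b * cnorm x)" using b by (intro mult_left_mono) auto
    finally show ?thesis by (simp add: power2_eq_square)
  qed
  have Sm_b: "cnorm ((S ^^ m) x) \<le> (b\<^sup>2) ^ m * cnorm x" for m x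
  proof (induction m)
    case (Suc m)
    have "cnorm ((S ^^ Suc m) x) \<le> b\<^sup>2 * cnorm ((S ^^ m) x)" using S_b by simp
    also have "\<dots> \<le> b\<^sup>2 * ((b\<^sup>2) ^ m * cnorm x)" using Suc by (intro mult_left_mono) auto
    finally show ?case by (simp add: mult_ac)
  qed simp
  define \<Phi> where "\<Phi> m = cnorm (ampl l (S ^^ m))" for m
  have S0: "S ^^ 0 = (\<lambda>x. x)" by auto
  have "\<Phi> 1 \<le> b\<^sup>2 * \<Phi> 0"
  proof -
    obtain K where K: "\<And>P b. b \<ge> 0 \<Longrightarrow> \<forall>x. cnorm (P x) \<le> b * cnorm x \<Longrightarrow> cnorm (ampl l P) \<le> K * b"
      using ampl_bound[OF l] by auto
    show ?thesis
    proof (rule power_trick[where K = K])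
      show "(\<Phi> m)\<^sup>2 \<le> \<Phi> (2 * m) * \<Phi> 0" for m
      proof -
        have "(\<Phi> m)\<^sup>2 = cmod (cinner (ampl l (\<lambda>x. (S ^^ m) ((S ^^ m) x))) (ampl l (\<lambda>x. x)))"
          unfolding \<Phi>_def cmod_cinner_self[symmetric] by (subst cinner_ampl[OF l l S_comm S_adj]) simp
        also have "(\<lambda>x. (S ^^ m) ((S ^^ m) x)) = S ^^ (2 * m)"
          by (simp add: mult_2 funpow_add fun_eq_iff)
        finally show ?thesis
          unfolding \<Phi>_def S0
          using cauchy_schwarz[of "ampl l (S ^^ (2 * m))" "ampl l (\<lambda>x. x)"] by simp
      qed
      show "\<Phi> m \<le> K * (b\<^sup>2) ^ m" for m
        unfolding \<Phi>_def by (rule K) (use Sm_b in auto)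
    qed (auto simp: \<Phi>_def)
  qed
  \<comment> \<open>\<open>\<parallel>V B h\<parallel>^2 = <V S h, V h>\<close>, so the bound on
    \<open>\<Phi> 1\<close>, which concerns \<open>S\<close>, turns into one for
    \<open>B\<close>.\<close>
  moreover have "(cnorm (ampl l B))\<^sup>2 \<le> \<Phi> 1 * \<Phi> 0"
  proof -
    have "(cnorm (ampl l B))\<^sup>2 = cmod (cinner (ampl l S) (ampl l (\<lambda>x. x)))"
      unfolding cmod_cinner_self[symmetric] S_def by (subst cinner_ampl[OF l l B ap]) simp
    then show ?thesis
      unfolding \<Phi>_def S0 using cauchy_schwarz[of "ampl l S" "ampl l (\<lambda>x. x)"] by simp
  qed
  ultimately have "(cnorm (ampl l B))\<^sup>2 \<le> b\<^sup>2 * \<Phi> 0 * \<Phi> 0"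
    using mult_right_mono[of "\<Phi> 1" "b\<^sup>2 * \<Phi> 0" "\<Phi> 0"] by (simp add: \<Phi>_def)
  then have "(cnorm (ampl l B))\<^sup>2 \<le> (b * \<Phi> 0)\<^sup>2"
    by (simp add: power2_eq_square mult_ac)
  then have "cnorm (ampl l B) \<le> b * \<Phi> 0"
    by (rule power2_le_imp_le) (use b in \<open>auto simp: \<Phi>_def\<close>)
  then show ?thesis unfolding \<Phi>_def S0 .
qed

text \<open>The last two properties say that \<open>G\<close> lives on the closed span of all
  \<open>C (E h)\<close>: it is zero on the complement and maps into the span. When \<open>N\<close>
  is a von Neumann algebra, that span is the range of the central support of
  \<open>E\<close>.\<close>

lemma reduced_commutant_extension:
  assumes B: "reduced_comm B" and ap: "adjoint_pair B B'"
    and b: "\<And>x. cnorm (B x) \<le> b * cnorm x" "b \<ge> 0"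
    and EB: "\<And>x. E (B x) = B x"
  obtains G where "\<exists>G'. adjoint_pair G G'"
    and "\<And>x. G (E x) = B x"
    and "\<And>C x. C \<in> N \<Longrightarrow> G (C x) = C (G x)"
    and "\<And>x. \<forall>C\<in>N. \<forall>h. cinner (C (E h)) x = 0 \<Longrightarrow> G x = 0"
    and "\<And>x z. \<forall>C\<in>N. \<forall>h. cinner (C (E h)) z = 0 \<Longrightarrow> cinner (G x) z = 0"
proof -
  define \<Gamma> where "\<Gamma> = {(ampl l (\<lambda>x. x), ampl l B) | l. set l \<subseteq> N \<times> UNIV}"
  have N_lin: "C (x + y) = C x + C y" "C (cscale a x) = cscale a (C x)" "C 0 = 0" if "C \<in> N" for C x y a
    using N_adj[OF that] adjoint_pair_add adjoint_pair_cscale adjoint_pair_zero by blast+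
  have E_lin: "E (cscale a x) = cscale a (E x)" for a x
    using N_lin E_in_N by blast
  have ampl_scale: "ampl (map (\<lambda>(C, h). (C, cscale a h)) l) P = cscale a (ampl l P)"
    if "set l \<subseteq> N \<times> UNIV" "\<And>x. P (cscale a x) = cscale a (P x)" for a l P
    using that(1) by (induction l) (auto simp: that(2) E_lin N_lin cscale_add_right)
  have ampl_op: "ampl (map (\<lambda>(F, h). (\<lambda>x. C (F x), h)) l) P = C (ampl l P)"
    if "C \<in> N" for C l P
    using that by (induction l) (auto simp: N_lin)
  have op: "(C x, C y) \<in> \<Gamma>" if CN: "C \<in> N" and xy: "(x, y) \<in> \<Gamma>" for C x y
  proof -
    obtain l where l: "set l \<subseteq> N \<times> UNIV" "x = ampl l (\<lambda>x. x)" "y = ampl l B"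
      using xy unfolding \<Gamma>_def by auto
    have "set (map (\<lambda>(F, h). (\<lambda>x. C (F x), h)) l) \<subseteq> N \<times> UNIV"
      using l(1) N_mult[OF CN] by auto
    then show ?thesis
      unfolding \<Gamma>_def using ampl_op[OF CN] l by (metis (mono_tags, lifting) mem_Collect_eq)
  qed
  obtain G where G: "canonical_ext \<Gamma> G"
  proof (rule bounded_relation_extension[of \<Gamma> b])
    show "(0, 0) \<in> \<Gamma>"
      unfolding \<Gamma>_def by (auto intro!: exI[of _ "[]"])
    show "(x + x', y + y') \<in> \<Gamma>" if xy: "(x, y) \<in> \<Gamma>" "(x', y') \<in> \<Gamma>" for x y x' y'
    proof -
      obtain l l' where "set l \<subseteq> N \<times> UNIV" "x = ampl l (\<lambda>x. x)" "y = ampl l B"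
        "set l' \<subseteq> N \<times> UNIV" "x' = ampl l' (\<lambda>x. x)" "y' = ampl l' B"
        using xy unfolding \<Gamma>_def by auto
      then show ?thesis
        unfolding \<Gamma>_def by (auto intro!: exI[of _ "l @ l'"] simp: ampl_append)
    qed
    show "(cscale c x, cscale c y) \<in> \<Gamma>" if xy: "(x, y) \<in> \<Gamma>" for c x y
    proof -
      obtain l where l: "set l \<subseteq> N \<times> UNIV" "x = ampl l (\<lambda>x. x)" "y = ampl l B"
        using xy unfolding \<Gamma>_def by auto
      have "set (map (\<lambda>(C, h). (C, cscale c h)) l) \<subseteq> N \<times> UNIV"
        using l(1) by auto
      moreover have "cscale c x = ampl (map (\<lambda>(C, h). (C, cscale c h)) l) (\<lambda>x. x)"
        "cscale c y = ampl (map (\<lambda>(C, h). (C, cscale c h)) l) B"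
        using l ampl_scale adjoint_pair_cscale[OF ap] by simp_all
      ultimately show ?thesis
        unfolding \<Gamma>_def by blast
    qed
    show "cnorm y \<le> b * cnorm x" if xy: "(x, y) \<in> \<Gamma>" for x y
      using xy ampl_contraction[OF _ B ap b] unfolding \<Gamma>_def by blast
  qed (use b in auto)
  \<comment> \<open>One-element lists; with \<open>C = E\<close> they yield
    \<open>G (E x) = B x\<close>, where \<open>EB\<close> absorbs the extra
    \<open>E\<close>.\<close>
  have gen: "(C (E h), C (B h)) \<in> \<Gamma>" if "C \<in> N" for C h
    unfolding \<Gamma>_def using that EB by (auto intro!: exI[of _ "[(C, h)]"])
  have perp: "cinner (ampl l P) z = 0"
    if "\<forall>C\<in>N. \<forall>h. cinner (C (E h)) z = 0" "set l \<subseteq> N \<times> UNIV" for l P z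
    using that(2) by (induction l) (auto simp: that(1) cinner_add_left)
  show ?thesis
  proof (rule that[of G])
    show "\<exists>G'. adjoint_pair G G'" using G unfolding canonical_ext_def by blast
    show "G (E x) = B x" for x
      using gen[OF E_in_N, of x] G E_idem EB unfolding canonical_ext_def by simp
    show "G (C x) = C (G x)" if C: "C \<in> N" for C x
    proof -
      obtain C' where "C' \<in> N" "adjoint_pair C C'" using N_adj C by blast
      then show ?thesis
        using canonical_ext_commute[OF G] op C by blast
    qed
    show "G x = 0" if "\<forall>C\<in>N. \<forall>h. cinner (C (E h)) x = 0" for x
    proof -
      have "\<forall>s\<in>Domain \<Gamma>. cinner s x = 0"
        using perp that unfolding \<Gamma>_def by blast
      then show ?thesis using G unfolding canonical_ext_def by blast
    qed
    show "cinner (G x) z = 0" if "\<forall>C\<in>N. \<forall>h. cinner (C (E h)) z = 0" for x z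
    proof -
      have "\<forall>s\<in>Range \<Gamma>. cinner s z = 0"
        using perp that unfolding \<Gamma>_def by blast
      then show ?thesis using G unfolding canonical_ext_def by blast
    qed
  qed
qed

end

subsection \<open>A uniform boundedness principle\<close>

text \<open>Barrelledness of a Frechet space: a lower semicontinuous seminorm is continuous. If no
  \<open>p n\<close> dominated \<open>q\<close>, every ball would contain points with
  \<open>q\<close> as large as desired; lower semicontinuity keeps \<open>q\<close> large on a
  smaller ball, and at the common point of nested balls \<open>q\<close> would exceed every
  integer.\<close>

lemma lsc_seminorm_bounded:
  fixes p :: "nat \<Rightarrow> 'a::chilbert \<Rightarrow> real" and q :: "'a \<Rightarrow> real"
  assumes V: "csubspace V"
    and p_add: "\<And>n x y. x \<in> V \<Longrightarrow> y \<in> V \<Longrightarrow> p n (x + y) \<le> p n x + p n y"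
    and p_scale: "\<And>n c x. x \<in> V \<Longrightarrow> p n (cscale c x) = cmod c * p n x"
    and p_mono: "\<And>n x. x \<in> V \<Longrightarrow> p n x \<le> p (Suc n) x"
    and q_add: "\<And>x y. x \<in> V \<Longrightarrow> y \<in> V \<Longrightarrow> q (x + y) \<le> q x + q y"
    and q_scale: "\<And>c x. x \<in> V \<Longrightarrow> q (cscale c x) = cmod c * q x"
    and p_nonneg: "\<And>n x. 0 \<le> p n x" and q_nonneg: "\<And>x. 0 \<le> q x"
    and lsc: "\<And>x a. x \<in> V \<Longrightarrow> a < q x \<Longrightarrow> \<exists>n \<delta>. \<delta> > 0 \<and> (\<forall>y\<in>V. p n (y - x) \<le> \<delta> \<longrightarrow> a < q y)"
    and complete: "\<And>X. (\<And>k. X k \<in> V) \<Longrightarrow>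
        (\<And>n e. e > 0 \<Longrightarrow> \<exists>N. \<forall>i\<ge>N. \<forall>j\<ge>N. p n (X i - X j) < e) \<Longrightarrow>
        \<exists>x\<in>V. \<forall>n. (\<lambda>k. p n (X k - x)) \<longlonglongrightarrow> 0"
  shows "\<exists>n c. \<forall>x\<in>V. q x \<le> c * p n x"
proof (rule ccontr)
  assume "\<not> ?thesis"
  then have unb: "\<exists>x\<in>V. c * p n x < q x" for n c
    by (meson not_le)
  have Vadd: "x + y \<in> V" and Vsc: "cscale c x \<in> V" if "x \<in> V" "y \<in> V" for x y c
    using V that unfolding csubspace_def by auto
  have Vdiff: "x - y \<in> V" if "x \<in> V" "y \<in> V" for x y
    using Vadd[OF that(1) Vsc[OF that(2) that(2), of "-1"]] by (simp add: cscale_minus_one)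
  have p_minus: "p n (x - y) = p n (y - x)" if "x \<in> V" "y \<in> V" for n x y
    using p_scale[OF Vdiff[OF that], of n "-1"] by (simp add: cscale_minus_one)
  have p_tri: "p n (x - z) \<le> p n (x - y) + p n (y - z)" if "x \<in> V" "y \<in> V" "z \<in> V" for n x y z
    using p_add[OF Vdiff[OF that(1,2)] Vdiff[OF that(2,3)]] by simp
  have p_le: "p n x \<le> p m x" if "x \<in> V" "n \<le> m" for n m x
    using that(2) by (induction rule: dec_induct) (use p_mono[OF that(1)] order_trans in blast)+
  \<comment> \<open>A state \<open>(x, r, n)\<close> stands for the ball \<open>{y. p n (y - x) \<le> r}\<close>; the balls are nested and
      \<open>q > k\<close> on the ball chosen at step \<open>k\<close>.\<close>
  define P where "P k s = (case s of (x, r, n) \<Rightarrow> x \<in> V \<and> 0 < r \<and> r \<le> (1/2) ^ k \<and> k \<le> n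
      \<and> (k > 0 \<longrightarrow> (\<forall>y\<in>V. p n (y - x) \<le> r \<longrightarrow> real k < q y)))" for k and s :: "'a \<times> real \<times> nat"
  define Q where "Q s s' = (case s of (x, r, n) \<Rightarrow> case s' of (x', r', n') \<Rightarrow>
      n \<le> n' \<and> p n (x' - x) \<le> r / 2 \<and> r' \<le> r / 2)" for s s' :: "'a \<times> real \<times> nat"
  have "\<exists>f. \<forall>k. P k (f k) \<and> Q (f k) (f (Suc k))"
  proof (rule dependent_nat_choice)
    show "\<exists>s. P 0 s"
      using V by (auto simp: P_def csubspace_def intro!: exI[of _ 0] exI[of _ 1])
    fix s k assume s: "P k s"
    obtain x r n where s_eq: "s = (x, r, n)" by (cases s)
    have x: "x \<in> V" and r: "0 < r" "r \<le> (1/2) ^ k" and n: "k \<le> n"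
      using s by (auto simp: P_def s_eq)
    \<comment> \<open>One more than the target \<open>Suc k\<close>, so that
      \<open>q \<ge> a\<close> leaves a strict inequality.\<close>
    define a where "a = real (Suc k) + 1"
    have a: "a > 0" by (simp add: a_def)
    obtain u where u: "u \<in> V" "2 * a / r * p n u < q u" using unb by blast
    have qu: "q u > 0"
      using u(2) a r p_nonneg[of n u] by (meson divide_nonneg_pos le_less_trans less_imp_le mult_nonneg_nonneg zero_le_numeral)
    \<comment> \<open>Rescaled so that \<open>q v = a\<close>; the choice of \<open>u\<close> then
      makes \<open>p n v \<le> r / 2\<close>.\<close>
    define v where "v = cscale (complex_of_real (a / q u)) u"
    have v: "v \<in> V" using u Vsc by (simp add: v_def)
    have qv: "q v = a" using a qu q_scale[OF u(1)] by (simp add: v_def norm_divide)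
    have pv: "p n v \<le> r / 2"
    proof -
      have "p n v = a / q u * p n u"
        using a qu p_scale[OF u(1)] by (simp add: v_def norm_divide)
      also have "\<dots> \<le> r / 2" using u(2) r a qu by (simp add: field_simps)
      finally show ?thesis .
    qed
    have "\<exists>x'\<in>V. p n (x' - x) \<le> r / 2 \<and> real (Suc k) < q x'"
    proof -
      \<comment> \<open>As \<open>2 v = (x + v) - (x - v)\<close>, at least one of
        \<open>x + v\<close> and \<open>x - v\<close> has \<open>q\<close> not below
        \<open>q v\<close>.\<close>
      have "cscale 2 v = (x + v) + cscale (-1) (x - v)"
        using cscale_add_left[of 1 1 v] by (simp add: cscale_minus_one cscale_one)
      then have "2 * q v \<le> q (x + v) + q (x - v)"
        using q_add[OF Vadd[OF x v] Vsc[OF Vdiff[OF x v] x, of "-1"]]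
          q_scale[OF Vdiff[OF x v], of "-1"] q_scale[OF v, of 2] by simp
      then consider "a \<le> q (x + v)" | "a \<le> q (x - v)" using qv by linarith
      then show ?thesis
      proof cases
        case 1
        then show ?thesis using pv Vadd[OF x v] by (intro bexI[of _ "x + v"]) (auto simp: a_def)
      next
        case 2
        have "p n (x - v - x) = p n v" using p_scale[OF v, of n "-1"] by (simp add: cscale_minus_one)
        with 2 show ?thesis using pv Vdiff[OF x v] by (intro bexI[of _ "x - v"]) (auto simp: a_def)
      qed
    qed
    then obtain x' where x': "x' \<in> V" "p n (x' - x) \<le> r / 2" "real (Suc k) < q x'" by blast
    obtain m \<delta> where m: "\<delta> > 0" "\<And>y. y \<in> V \<Longrightarrow> p m (y - x') \<le> \<delta> \<Longrightarrow> real (Suc k) < q y"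
      using lsc[OF x'(1,3)] by blast
    \<comment> \<open>\<open>Suc n\<close> pushes the indices beyond every bound, so that the balls
      become small in each seminorm; the radius \<open>r / 2\<close> keeps them nested.\<close>
    define n' where "n' = max m (Suc n)"
    define r' where "r' = min \<delta> (r / 2)"
    have "P (Suc k) (x', r', n')"
      unfolding P_def prod.case
    proof (intro conjI impI ballI)
      show "real (Suc k) < q y" if "y \<in> V" "p n' (y - x') \<le> r'" for y
        using m(2)[OF that(1)] p_le[OF Vdiff[OF that(1) x'(1)], of m n'] that(2)
        by (simp add: n'_def r'_def)
      show "r' \<le> (1 / 2) ^ Suc k" using r by (simp add: r'_def min_le_iff_disj)
    qed (use x' m r n in \<open>auto simp: n'_def r'_def\<close>)
    moreover have "Q s (x', r', n')"
      using x' by (auto simp: Q_def s_eq n'_def r'_def)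
    ultimately show "\<exists>s'. P (Suc k) s' \<and> Q s s'" by blast
  qed
  then obtain f where f: "\<And>k. P k (f k)" "\<And>k. Q (f k) (f (Suc k))" by blast
  define x where "x k = fst (f k)" for k
  define r where "r k = fst (snd (f k))" for k
  define n where "n k = snd (snd (f k))" for k
  have fk: "f k = (x k, r k, n k)" for k by (simp add: x_def r_def n_def)
  have xV: "x k \<in> V" and rpos: "0 < r k" and rle: "r k \<le> (1/2) ^ k" and kn: "k \<le> n k"
    and big: "k > 0 \<Longrightarrow> y \<in> V \<Longrightarrow> p (n k) (y - x k) \<le> r k \<Longrightarrow> real k < q y" for k y
    using f(1)[of k] by (auto simp: P_def fk)
  have nn: "n k \<le> n (Suc k)" and step: "p (n k) (x (Suc k) - x k) \<le> r k / 2"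
    and rstep: "r (Suc k) \<le> r k / 2" for k
    using f(2)[of k] by (auto simp: Q_def fk)
  have nest: "p (n k) (y - x k) \<le> r k" if "y \<in> V" "p (n (Suc k)) (y - x (Suc k)) \<le> r (Suc k)" for y k
    using p_tri[OF that(1) xV[of "Suc k"] xV[of k], of "n k"] step[of k] rstep[of k] that(2)
      p_le[OF Vdiff[OF that(1) xV[of "Suc k"]] nn[of k]] by linarith
  have p00: "p m (y - y) = 0" if "y \<in> V" for m y
    using p_scale[OF that, of m 0] by simp
  have ball: "p (n k) (x j - x k) \<le> r k" if "k \<le> j" for k j
    using that
  proof (induction "j - k" arbitrary: k)
    case 0
    then show ?case using p00[OF xV] rpos[of k] by simp
  next
    case (Suc d)
    show ?case by (rule nest[OF xV]) (use Suc in \<open>auto intro!: Suc(1)\<close>)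
  qed
  have "\<exists>z\<in>V. \<forall>m. (\<lambda>k. p m (x k - z)) \<longlonglongrightarrow> 0"
  proof (rule complete[OF xV])
    fix m and e :: real assume e: "e > 0"
    obtain k0 where k0: "(1/2) ^ k0 < e / 2" using real_arch_pow_inv[of "e / 2" "1/2"] e by auto
    define k where "k = max m k0"
    have rk: "r k < e / 2"
    proof -
      have "(1/2 :: real) ^ k \<le> (1/2) ^ k0"
        by (rule power_decreasing) (auto simp: k_def)
      then show ?thesis using rle[of k] k0 by linarith
    qed
    have "p m (x i - x j) < e" if "i \<ge> k" "j \<ge> k" for i j
    proof -
      have "p m (x i - x j) \<le> p (n k) (x i - x j)"
        using kn[of k] by (intro p_le Vdiff xV) (simp add: k_def)
      also have "\<dots> \<le> p (n k) (x i - x k) + p (n k) (x j - x k)"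
        using p_tri[OF xV[of i] xV[of k] xV[of j], of "n k"] p_minus[OF xV[of k] xV[of j], of "n k"] by simp
      also have "\<dots> < e" using ball[OF that(1)] ball[OF that(2)] rk by simp
      finally show ?thesis .
    qed
    then show "\<exists>N. \<forall>i\<ge>N. \<forall>j\<ge>N. p m (x i - x j) < e" by blast
  qed
  then obtain z where z: "z \<in> V" "\<And>m. (\<lambda>k. p m (x k - z)) \<longlonglongrightarrow> 0" by blast
  have "p (n k) (z - x k) \<le> r k" for k
  proof (rule LIMSEQ_le_const)
    show "(\<lambda>j. p (n k) (x j - z) + r k) \<longlonglongrightarrow> r k"
      using tendsto_add[OF z(2)[of "n k"] tendsto_const[of "r k"]] by simp
    have "p (n k) (z - x k) \<le> p (n k) (x j - z) + r k" if "j \<ge> k" for j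
      using p_tri[OF z(1) xV[of j] xV[of k], of "n k"] p_minus[OF z(1) xV[of j], of "n k"] ball[OF that] by linarith
    then show "\<exists>N. \<forall>j\<ge>N. p (n k) (z - x k) \<le> p (n k) (x j - z) + r k" by blast
  qed
  then have "real k < q z" if "k > 0" for k
    using big[OF that z(1)] by blast
  then show False
    using reals_Archimedean2[of "q z"] q_nonneg[of z]
    by (metis less_asym' of_nat_0_less_iff order_le_less_trans)
qed

subsection \<open>Operators on a dense domain of a closed subspace\<close>

lemma csubspace_add: "csubspace S \<Longrightarrow> x \<in> S \<Longrightarrow> y \<in> S \<Longrightarrow> x + y \<in> S"
  and csubspace_cscale: "csubspace S \<Longrightarrow> x \<in> S \<Longrightarrow> cscale c x \<in> S"
  and csubspace_zero: "csubspace S \<Longrightarrow> 0 \<in> S"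
  by (auto simp: csubspace_def)

lemma csubspace_diff:
  assumes "csubspace S" "x \<in> S" "y \<in> S" shows "x - y \<in> S"
  using csubspace_add[OF assms(1,2) csubspace_cscale[OF assms(1,3), of "-1"]]
  by (simp add: cscale_minus_one)

text \<open>The ambient \<open>K\<close> is a parameter because the locale serves \<open>D\<close>
  in the whole space, \<open>E D\<close> in \<open>E H\<close>, and the domain of a closure in the
  whole space.\<close>

locale dense_domain =
  fixes D K :: "'a::chilbert set"
  assumes D_sub: "csubspace D" and K_sub: "csubspace K" and dense: "dense_in D K"
begin

lemma D_le_K: "x \<in> D \<Longrightarrow> x \<in> K"
  using dense by (auto simp: dense_in_def)

lemma dense_orthogonal:
  assumes "z \<in> K" "\<And>\<xi>. \<xi> \<in> D \<Longrightarrow> cinner \<xi> z = 0"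
  shows "z = 0"
proof -
  obtain X where X: "\<And>n. X n \<in> D" "cconv X z"
    using dense assms(1) unfolding dense_in_def by blast
  have "(\<lambda>n. cinner (X n) z) \<longlonglongrightarrow> cinner z z" by (rule cconv_cinner_left[OF X(2)])
  then have "cinner z z = 0" using X(1) assms(2) by (simp add: LIMSEQ_const_iff)
  then show ?thesis by (simp add: cinner_self_eq_0)
qed

lemma dense_eqI:
  assumes "y \<in> K" "z \<in> K" "\<And>\<xi>. \<xi> \<in> D \<Longrightarrow> cinner \<xi> y = cinner \<xi> z"
  shows "y = z"
  using dense_orthogonal[of "y - z"] assms csubspace_diff[OF K_sub] by (simp add: cinner_diff_right)

lemma dense_eqI_left:
  assumes "y \<in> K" "z \<in> K" "\<And>\<xi>. \<xi> \<in> D \<Longrightarrow> cinner y \<xi> = cinner z \<xi>"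
  shows "y = z"
  using assms by (intro dense_eqI) (metis cinner_cnj_commute)+

lemma adj_eq:
  assumes "\<eta> \<in> K" "\<zeta> \<in> K" "\<And>\<xi>. \<xi> \<in> D \<Longrightarrow> cinner (X \<xi>) \<eta> = cinner \<xi> \<zeta>"
  shows "\<eta> \<in> adj_dom K D X" "adj K D X \<eta> = \<zeta>"
proof -
  show dom: "\<eta> \<in> adj_dom K D X" using assms unfolding adj_dom_def by blast
  have "(THE \<zeta>. \<zeta> \<in> K \<and> (\<forall>\<xi>\<in>D. cinner (X \<xi>) \<eta> = cinner \<xi> \<zeta>)) = \<zeta>"
    by (rule the_equality) (use assms in \<open>auto intro!: dense_eqI\<close>)
  then show "adj K D X \<eta> = \<zeta>" using dom by (simp add: adj_def)
qed

lemma adj_works: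
  assumes "\<eta> \<in> adj_dom K D X"
  shows "adj K D X \<eta> \<in> K" "\<xi> \<in> D \<Longrightarrow> cinner (X \<xi>) \<eta> = cinner \<xi> (adj K D X \<eta>)"
proof -
  obtain \<zeta> where "\<eta> \<in> K" "\<zeta> \<in> K" "\<And>\<xi>. \<xi> \<in> D \<Longrightarrow> cinner (X \<xi>) \<eta> = cinner \<xi> \<zeta>"
    using assms unfolding adj_dom_def by blast
  then show "adj K D X \<eta> \<in> K" "\<xi> \<in> D \<Longrightarrow> cinner (X \<xi>) \<eta> = cinner \<xi> (adj K D X \<eta>)"
    using adj_eq by auto
qed

lemma LDag_outside: "X \<in> LDag D K \<Longrightarrow> x \<notin> D \<Longrightarrow> X x = 0"
  and LDag_in_K: "X \<in> LDag D K \<Longrightarrow> x \<in> D \<Longrightarrow> X x \<in> K"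
  and LDag_add: "X \<in> LDag D K \<Longrightarrow> x \<in> D \<Longrightarrow> y \<in> D \<Longrightarrow> X (x + y) = X x + X y"
  and LDag_cscale: "X \<in> LDag D K \<Longrightarrow> x \<in> D \<Longrightarrow> X (cscale c x) = cscale c (X x)"
  and LDag_adj_dom: "X \<in> LDag D K \<Longrightarrow> x \<in> D \<Longrightarrow> x \<in> adj_dom K D X"
  by (auto simp: LDag_def linear_on_def)

lemma LDag_diff:
  assumes "X \<in> LDag D K" "x \<in> D" "y \<in> D" shows "X (x - y) = X x - X y"
  using LDag_add[OF assms(1,2) csubspace_cscale[OF D_sub assms(3), of "-1"]] LDag_cscale[OF assms(1,3), of "-1"]
  by (simp add: cscale_minus_one)

lemma dagger_in_K: "X \<in> LDag D K \<Longrightarrow> \<eta> \<in> D \<Longrightarrow> dagger D K X \<eta> \<in> K"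
  by (simp add: dagger_def restr_def adj_works(1) LDag_adj_dom)

lemma cinner_dagger:
  "X \<in> LDag D K \<Longrightarrow> \<xi> \<in> D \<Longrightarrow> \<eta> \<in> D \<Longrightarrow> cinner (X \<xi>) \<eta> = cinner \<xi> (dagger D K X \<eta>)"
  by (simp add: dagger_def restr_def adj_works(2)[OF LDag_adj_dom])

lemma cinner_dagger':
  "X \<in> LDag D K \<Longrightarrow> \<xi> \<in> D \<Longrightarrow> \<eta> \<in> D \<Longrightarrow> cinner (dagger D K X \<xi>) \<eta> = cinner \<xi> (X \<eta>)"
  by (metis cinner_cnj_commute cinner_dagger)

lemma dagger_outside: "x \<notin> D \<Longrightarrow> dagger D K X x = 0"
  by (simp add: dagger_def restr_def)

text \<open>A formal adjoint \<open>W\<close> on the dense domain already forces linearity of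
  \<open>X\<close> and puts \<open>D\<close> into the adjoint domain, so a new operator need only be
  given together with its adjoint.\<close>

lemma LDagI:
  assumes out: "\<And>x. x \<notin> D \<Longrightarrow> X x = 0" and K: "\<And>x. x \<in> D \<Longrightarrow> X x \<in> K"
    and W: "\<And>x. x \<in> D \<Longrightarrow> W x \<in> K"
    and adj: "\<And>\<xi> \<eta>. \<xi> \<in> D \<Longrightarrow> \<eta> \<in> D \<Longrightarrow> cinner (X \<xi>) \<eta> = cinner \<xi> (W \<eta>)"
  shows "X \<in> LDag D K" "\<eta> \<in> D \<Longrightarrow> dagger D K X \<eta> = W \<eta>"
proof -
  have "X (x + y) = X x + X y" if "x \<in> D" "y \<in> D" for x y
    by (rule dense_eqI_left)
       (use that in \<open>auto simp: K adj cinner_add_left csubspace_add D_sub K_sub\<close>)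
  moreover have "X (cscale c x) = cscale c (X x)" if "x \<in> D" for x c
    by (rule dense_eqI_left)
       (use that in \<open>auto simp: K adj cinner_scale_left csubspace_cscale D_sub K_sub\<close>)
  ultimately have "linear_on D X" by (simp add: linear_on_def)
  moreover have "\<eta> \<in> adj_dom K D X" if "\<eta> \<in> D" for \<eta>
    using adj_eq(1)[of \<eta> "W \<eta>"] that W adj D_le_K by blast
  ultimately show "X \<in> LDag D K" using out K by (auto simp: LDag_def)
  show "dagger D K X \<eta> = W \<eta>" if "\<eta> \<in> D"
    using adj_eq(2)[of \<eta> "W \<eta>"] that W adj D_le_K by (simp add: dagger_def restr_def)
qed

lemma dagger_LDag:
  assumes "X \<in> LDag D K"
  shows "dagger D K X \<in> LDag D K" "dagger D K (dagger D K X) = X"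
proof -
  note * = LDagI[of "dagger D K X" X, OF dagger_outside dagger_in_K[OF assms] LDag_in_K[OF assms]
      cinner_dagger'[OF assms]]
  show "dagger D K X \<in> LDag D K" by (rule *)
  show "dagger D K (dagger D K X) = X"
  proof
    fix x
    show "dagger D K (dagger D K X) x = X x"
      by (cases "x \<in> D") (auto simp: *(2) dagger_outside LDag_outside[OF assms])
  qed
qed

end

subsection \<open>The weak commutant of a self-adjoint O*-vector space\<close>

locale self_adjoint_space =
  fixes D :: "'a::chilbert set" and M :: "('a \<Rightarrow> 'a) set"
  assumes D_subspace: "csubspace D" and D_dense: "dense_in D UNIV"
    and M_ovs: "O_star_vs D UNIV M" and M_sa: "self_adjoint_ovs D UNIV M"
begin

sublocale dense_domain D UNIV
  by unfold_locales (auto simp: D_subspace D_dense csubspace_def[of UNIV])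

abbreviation N :: "('a \<Rightarrow> 'a) set" where "N \<equiv> weak_comm D UNIV M"

abbreviation dag :: "('a \<Rightarrow> 'a) \<Rightarrow> 'a \<Rightarrow> 'a" where "dag \<equiv> dagger D UNIV"

lemma M_LDag: "X \<in> M \<Longrightarrow> X \<in> LDag D UNIV"
  and M_dagger: "X \<in> M \<Longrightarrow> dag X \<in> M"
  using M_ovs by (auto simp: O_star_vs_def)

lemma N_BK: "C \<in> N \<Longrightarrow> C \<in> BK UNIV"
  by (simp add: weak_comm_def)

text \<open>The weak relation exhibits \<open>C (dag X \<xi>)\<close> as the value of the adjoint of
  \<open>X\<close> at \<open>C \<xi>\<close>. This works for every \<open>X \<in> M\<close>, so
  self-adjointness places \<open>C \<xi>\<close> in \<open>D\<close>.\<close>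

lemma N_invariant:
  assumes C: "C \<in> N" and \<xi>: "\<xi> \<in> D"
  shows "C \<xi> \<in> D"
proof -
  have "C \<xi> \<in> adj_dom UNIV D X" if X: "X \<in> M" for X
  proof (rule adj_eq(1))
    fix \<theta> assume \<theta>: "\<theta> \<in> D"
    have "cinner (C (dag X \<xi>)) \<theta> = cinner (C \<xi>) (dag (dag X) \<theta>)"
      using C M_dagger[OF X] \<xi> \<theta> by (simp add: weak_comm_def)
    then have "cinner (C (dag X \<xi>)) \<theta> = cinner (C \<xi>) (X \<theta>)"
      by (simp add: dagger_LDag(2) M_LDag X)
    then show "cinner (X \<theta>) (C \<xi>) = cinner \<theta> (C (dag X \<xi>))"
      by (metis cinner_cnj_commute)
  qed auto
  then show ?thesis
    using M_sa unfolding self_adjoint_ovs_def by blast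
qed

text \<open>Once \<open>C\<close> preserves \<open>D\<close>, the dagger on the right can be moved
  back onto \<open>C \<xi>\<close>, and density removes \<open>\<eta>\<close>.\<close>

lemma weak_commute_iff:
  assumes X: "X \<in> LDag D UNIV" and inv: "\<And>\<xi>. \<xi> \<in> D \<Longrightarrow> C \<xi> \<in> D"
  shows "(\<forall>\<xi>\<in>D. \<forall>\<eta>\<in>D. cinner (C (X \<xi>)) \<eta> = cinner (C \<xi>) (dag X \<eta>))
      \<longleftrightarrow> (\<forall>\<xi>\<in>D. C (X \<xi>) = X (C \<xi>))"
proof -
  have "cinner (C \<xi>) (dag X \<eta>) = cinner (X (C \<xi>)) \<eta>" if "\<xi> \<in> D" "\<eta> \<in> D" for \<xi> \<eta>
    using cinner_dagger[OF X inv] that by simp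
  then show ?thesis
    using dense_eqI_left[of "C (X _)" "X (C _)"] by auto
qed

lemma N_commute: "C \<in> N \<Longrightarrow> X \<in> M \<Longrightarrow> \<xi> \<in> D \<Longrightarrow> C (X \<xi>) = X (C \<xi>)"
  using weak_commute_iff[of X C] M_LDag[of X] N_invariant[of C] by (simp add: weak_comm_def)

lemma N_I:
  assumes "C \<in> BK UNIV" "\<And>\<xi>. \<xi> \<in> D \<Longrightarrow> C \<xi> \<in> D"
    and "\<And>X \<xi>. X \<in> M \<Longrightarrow> \<xi> \<in> D \<Longrightarrow> C (X \<xi>) = X (C \<xi>)"
  shows "C \<in> N"
  using weak_commute_iff[of _ C, OF M_LDag assms(2)] assms by (simp add: weak_comm_def)

lemma bicomm_iff:
  "X \<in> bicomm D UNIV M \<longleftrightarrow> X \<in> LDag D UNIV \<and> (\<forall>C\<in>N. \<forall>\<xi>\<in>D. C (X \<xi>) = X (C \<xi>))"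
proof (cases "X \<in> LDag D UNIV")
  case True
  then have "(\<forall>\<xi>\<in>D. \<forall>\<eta>\<in>D. cinner (C (X \<xi>)) \<eta> = cinner (C \<xi>) (dag X \<eta>))
      \<longleftrightarrow> (\<forall>\<xi>\<in>D. C (X \<xi>) = X (C \<xi>))" if "C \<in> N" for C
    by (rule weak_commute_iff) (rule N_invariant[OF that])
  then show ?thesis using True by (simp add: bicomm_def)
qed (simp add: bicomm_def)

lemma N_adjoint:
  assumes C: "C \<in> N"
  shows "\<exists>C'\<in>N. adjoint_pair C C'"
proof -
  obtain C' where ap: "adjoint_pair C C'" and C': "C' \<in> BK UNIV"
    using bounded_adjoint_exists[OF N_BK[OF C]] by blast
  have "cinner (C' (X \<xi>)) \<eta> = cinner (C' \<xi>) (dag X \<eta>)" if "X \<in> M" "\<xi> \<in> D" "\<eta> \<in> D" for X \<xi> \<eta>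
  proof -
    have "cinner (C' (X \<xi>)) \<eta> = cinner (X \<xi>) (C \<eta>)" by (rule adjoint_pairD'[OF ap])
    also have "\<dots> = cinner \<xi> (dag X (C \<eta>))"
      using that N_invariant[OF C] by (intro cinner_dagger M_LDag) auto
    also have "\<dots> = cinner \<xi> (C (dag X \<eta>))"
      using that N_commute[OF C M_dagger] by simp
    also have "\<dots> = cinner (C' \<xi>) (dag X \<eta>)" by (rule adjoint_pairD'[OF ap, symmetric])
    finally show ?thesis .
  qed
  then show ?thesis using ap C' unfolding weak_comm_def by blast
qed

text \<open>Weak commutants are not closed under products in general; here invariance of
  \<open>D\<close> provides honest commutation, which composes.\<close>

lemma N_comp:
  assumes "C \<in> N" "C' \<in> N"
  shows "(\<lambda>x. C (C' x)) \<in> N"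
proof (rule N_I)
  obtain c c' where c: "\<And>x. cnorm (C x) \<le> c * cnorm x" and c': "\<And>x. cnorm (C' x) \<le> c' * cnorm x"
    using assms N_BK unfolding BK_UNIV_iff by metis
  have "cnorm (C (C' x)) \<le> (\<bar>c\<bar> * c') * cnorm x" for x
  proof -
    have "cnorm (C (C' x)) \<le> \<bar>c\<bar> * cnorm (C' x)"
      using c[of "C' x"] mult_right_mono[OF abs_ge_self[of c] cnorm_ge_0[of "C' x"]] by simp
    also have "\<dots> \<le> \<bar>c\<bar> * (c' * cnorm x)" by (intro mult_left_mono c') simp
    finally show ?thesis by (simp add: mult.assoc)
  qed
  then show "(\<lambda>x. C (C' x)) \<in> BK UNIV"
    using N_BK[OF assms(1)] N_BK[OF assms(2)] unfolding BK_UNIV_iff by auto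
qed (use assms in \<open>auto simp: N_invariant N_commute\<close>)

end

subsection \<open>Reduction by a projection in the weak commutant\<close>

locale reduction = self_adjoint_space D M for D :: "'a::chilbert set" and M +
  fixes E :: "'a \<Rightarrow> 'a"
  assumes E_proj: "is_proj UNIV E" and E_comm: "E \<in> weak_comm D UNIV M"
begin

abbreviation D0 :: "'a set" where "D0 \<equiv> E ` D"
abbreviation K0 :: "'a set" where "K0 \<equiv> E ` UNIV"
abbreviation M0 :: "('a \<Rightarrow> 'a) set" where "M0 \<equiv> reduce (E ` D) M"

lemma E_adjoint: "adjoint_pair E E" and E_idempotent: "E (E x) = E x"
  using E_proj by (auto simp: is_proj_def adjoint_pair_def)

sublocale SA: star_algebra N E
  by unfold_locales
     (use N_adjoint N_comp N_BK E_comm E_adjoint in \<open>auto simp: E_idempotent BK_UNIV_iff\<close>)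

lemmas E_add = adjoint_pair_add[OF E_adjoint]
  and E_cscale = adjoint_pair_cscale[OF E_adjoint]
  and E_diff = adjoint_pair_diff[OF E_adjoint]
  and E_cinner = adjoint_pairD[OF E_adjoint]

lemma K0_iff: "x \<in> K0 \<longleftrightarrow> E x = x"
  by (metis E_idempotent rangeE rangeI)

lemma D0_iff: "x \<in> D0 \<longleftrightarrow> x \<in> D \<and> E x = x"
  using N_invariant[OF E_comm] by (metis E_idempotent imageE imageI)

lemma E_cnorm: "cnorm (E x) \<le> cnorm x"
proof (cases "E x = 0")
  case False
  have "cinner (E x) (E x) = cinner (E x) x" by (simp add: E_cinner E_idempotent)
  then have "cnorm (E x) * cnorm (E x) \<le> cnorm (E x) * cnorm x"
    using cauchy_schwarz[of "E x" x] cmod_cinner_self[of "E x"] by (simp add: power2_eq_square)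
  moreover have "0 < cnorm (E x)"
    using False cnorm_ge_0[of "E x"] cnorm_eq_0[of "E x"] by linarith
  ultimately show ?thesis by (rule mult_left_le_imp_le)
qed simp

lemma E_cconv: "cconv X x \<Longrightarrow> cconv (\<lambda>n. E (X n)) (E x)"
  by (erule cconv_bound[where c = 1]) (simp add: E_diff[symmetric] E_cnorm)

sublocale R: dense_domain D0 K0
proof
  show "csubspace D0"
    unfolding csubspace_def Ball_def D0_iff
    using csubspace_add[OF D_subspace] csubspace_cscale[OF D_subspace] csubspace_zero[OF D_subspace]
    by (simp add: E_add E_cscale adjoint_pair_zero[OF E_adjoint])
  show "csubspace K0"
    unfolding csubspace_def Ball_def K0_iff
    by (simp add: E_add E_cscale adjoint_pair_zero[OF E_adjoint])
  show "dense_in D0 K0"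
    unfolding dense_in_def
  proof (intro conjI ballI)
    fix x assume x: "x \<in> K0"
    obtain X where "\<And>n. X n \<in> D" "cconv X x" using D_dense unfolding dense_in_def by blast
    then show "\<exists>X. (\<forall>n. X n \<in> D0) \<and> cconv X x"
      using x E_cconv[of X x] by (intro exI[of _ "\<lambda>n. E (X n)"]) (auto simp: K0_iff)
  qed auto
qed

text \<open>Commutation with \<open>E\<close> passes to the adjoint, so \<open>dag X\<close> maps
  \<open>E D\<close> into \<open>E H\<close> and serves as the adjoint of the restriction.\<close>

lemma restr_LDag:
  assumes X: "X \<in> LDag D UNIV" and comm: "\<And>\<xi>. \<xi> \<in> D \<Longrightarrow> E (X \<xi>) = X (E \<xi>)"
  shows "restr D0 X \<in> LDag D0 K0"
    and "\<eta> \<in> D0 \<Longrightarrow> dagger D0 K0 (restr D0 X) \<eta> = dag X \<eta>"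
proof -
  have K: "dag X \<eta> \<in> K0" if "\<eta> \<in> D0" for \<eta>
    unfolding K0_iff
  proof (rule dense_eqI)
    fix \<xi> assume \<xi>: "\<xi> \<in> D"
    have \<eta>: "\<eta> \<in> D" "E \<eta> = \<eta>" using that by (auto simp: D0_iff)
    have "cinner \<xi> (E (dag X \<eta>)) = cinner (E \<xi>) (dag X \<eta>)" by (simp add: E_cinner)
    also have "\<dots> = cinner (X (E \<xi>)) \<eta>"
      using \<xi> \<eta> X N_invariant[OF E_comm] by (simp add: cinner_dagger)
    also have "\<dots> = cinner (X \<xi>) \<eta>" using comm[OF \<xi>] E_cinner[of "X \<xi>" \<eta>] \<eta> by simp
    also have "\<dots> = cinner \<xi> (dag X \<eta>)" using \<xi> \<eta> X by (simp add: cinner_dagger)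
    finally show "cinner \<xi> (E (dag X \<eta>)) = cinner \<xi> (dag X \<eta>)" .
  qed auto
  have XK: "restr D0 X x \<in> K0" if "x \<in> D0" for x
    using that comm[of x] by (simp add: restr_def K0_iff D0_iff)
  have adj: "cinner (restr D0 X \<xi>) \<eta> = cinner \<xi> (dag X \<eta>)" if "\<xi> \<in> D0" "\<eta> \<in> D0" for \<xi> \<eta>
    using that X by (simp add: restr_def D0_iff cinner_dagger)
  note * = R.LDagI[of "restr D0 X" "dag X", OF _ XK K adj]
  show "restr D0 X \<in> LDag D0 K0" by (rule *) (simp_all add: restr_def)
  show "\<eta> \<in> D0 \<Longrightarrow> dagger D0 K0 (restr D0 X) \<eta> = dag X \<eta>"
    by (rule *(2)) (simp_all add: restr_def)
qed

lemma restr_M: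
  assumes "X \<in> M"
  shows "restr D0 X \<in> LDag D0 K0" "\<eta> \<in> D0 \<Longrightarrow> dagger D0 K0 (restr D0 X) \<eta> = dag X \<eta>"
  using restr_LDag[OF M_LDag[OF assms]] N_commute[OF E_comm assms] by auto

text \<open>Together with the compression of elements of \<open>N\<close> proved next, this
  identifies the weak commutant of the reduced space with \<open>E N E\<close>, so that later
  arguments can run over \<open>N\<close>.\<close>

lemma commutant_lift:
  assumes C: "C \<in> weak_comm D0 K0 M0"
  shows "(\<lambda>x. C (E x)) \<in> N"
proof -
  have CB: "C \<in> BK K0" using C by (simp add: weak_comm_def)
  then have CK: "C x \<in> K0" if "x \<in> K0" for x
    using that unfolding BK_def by blast
  have lin: "C (E x + E y) = C (E x) + C (E y)" "C (cscale a (E x)) = cscale a (C (E x))" for x y a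
    using CB by (simp_all add: BK_def linear_on_def)
  obtain c where c: "\<And>x. x \<in> K0 \<Longrightarrow> cnorm (C x) \<le> c * cnorm x"
    using CB unfolding BK_def by blast
  have "cnorm (C (E x)) \<le> \<bar>c\<bar> * cnorm x" for x
  proof -
    have "cnorm (C (E x)) \<le> \<bar>c\<bar> * cnorm (E x)"
      using c[of "E x"] mult_right_mono[OF abs_ge_self[of c] cnorm_ge_0[of "E x"]] by simp
    also have "\<dots> \<le> \<bar>c\<bar> * cnorm x" by (intro mult_left_mono E_cnorm) simp
    finally show ?thesis .
  qed
  then have BK: "(\<lambda>x. C (E x)) \<in> BK UNIV"
    unfolding BK_UNIV_iff by (auto simp: E_add E_cscale lin)
  have "cinner (C (E (X \<xi>))) \<eta> = cinner (C (E \<xi>)) (dag X \<eta>)"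
    if X: "X \<in> M" and \<xi>: "\<xi> \<in> D" and \<eta>: "\<eta> \<in> D" for X \<xi> \<eta>
  proof -
    have EC: "E (C (E x)) = C (E x)" for x using CK[of "E x"] by (simp add: K0_iff E_idempotent)
    have "cinner (C (E (X \<xi>))) \<eta> = cinner (C (restr D0 X (E \<xi>))) (E \<eta>)"
    proof -
      have "cinner (C (E (X \<xi>))) \<eta> = cinner (E (C (E (X \<xi>)))) \<eta>" by (simp only: EC)
      also have "\<dots> = cinner (C (E (X \<xi>))) (E \<eta>)" by (rule E_cinner)
      also have "\<dots> = cinner (C (restr D0 X (E \<xi>))) (E \<eta>)"
        using N_commute[OF E_comm X \<xi>] \<xi> by (simp add: restr_def)
      finally show ?thesis .
    qed
    also have "\<dots> = cinner (C (E \<xi>)) (dagger D0 K0 (restr D0 X) (E \<eta>))"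
    proof -
      have "restr D0 X \<in> M0" using X by (simp add: reduce_def)
      then show ?thesis using C \<xi> \<eta> by (simp add: weak_comm_def)
    qed
    also have "\<dots> = cinner (C (E \<xi>)) (dag X (E \<eta>))"
      using \<eta> by (simp add: restr_M(2)[OF X])
    also have "\<dots> = cinner (C (E \<xi>)) (E (dag X \<eta>))"
      by (simp add: N_commute[OF E_comm M_dagger[OF X] \<eta>])
    also have "\<dots> = cinner (C (E \<xi>)) (dag X \<eta>)"
      using E_cinner[of "C (E \<xi>)" "dag X \<eta>"] by (simp only: EC)
    finally show ?thesis .
  qed
  with BK show ?thesis by (simp add: weak_comm_def)
qed

lemma commutant_reduce:
  assumes C: "C \<in> N"
  shows "restr K0 (\<lambda>x. E (C x)) \<in> weak_comm D0 K0 M0"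
proof -
  obtain c where lin: "\<And>x y. C (x + y) = C x + C y" "\<And>a x. C (cscale a x) = cscale a (C x)"
    and c: "\<And>x. cnorm (C x) \<le> c * cnorm x"
    using N_BK[OF C] unfolding BK_UNIV_iff by blast
  have "cnorm (E (C x)) \<le> c * cnorm x" for x
    using E_cnorm[of "C x"] c[of x] by linarith
  then have BK: "restr K0 (\<lambda>x. E (C x)) \<in> BK K0"
    unfolding BK_def linear_on_def
    by (auto simp: restr_def lin E_add E_cscale csubspace_add[OF R.K_sub] csubspace_cscale[OF R.K_sub])
  have "cinner (restr K0 (\<lambda>x. E (C x)) (restr D0 X \<xi>)) \<eta>
      = cinner (restr K0 (\<lambda>x. E (C x)) \<xi>) (dagger D0 K0 (restr D0 X) \<eta>)"
    if X: "X \<in> M" and \<xi>: "\<xi> \<in> D0" and \<eta>: "\<eta> \<in> D0" for X \<xi> \<eta>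
  proof -
    have D: "\<xi> \<in> D" "\<eta> \<in> D" "E \<eta> = \<eta>" using \<xi> \<eta> by (auto simp: D0_iff)
    have dK: "E (dag X \<eta>) = dag X \<eta>"
      using R.dagger_in_K[OF restr_M(1)[OF X] \<eta>] restr_M(2)[OF X \<eta>] by (simp add: K0_iff)
    have XK: "X \<xi> \<in> K0"
      using R.LDag_in_K[OF restr_M(1)[OF X] \<xi>] \<xi> by (simp add: restr_def)
    have "cinner (restr K0 (\<lambda>x. E (C x)) (restr D0 X \<xi>)) \<eta> = cinner (C (X \<xi>)) \<eta>"
      using \<xi> D XK by (simp add: restr_def E_cinner)
    also have "\<dots> = cinner (C \<xi>) (dag X \<eta>)"
      using C X D by (simp add: weak_comm_def)
    also have "\<dots> = cinner (restr K0 (\<lambda>x. E (C x)) \<xi>) (dagger D0 K0 (restr D0 X) \<eta>)"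
      using R.D_le_K[OF \<xi>] dK unfolding restr_M(2)[OF X \<eta>] by (simp add: restr_def E_cinner)
    finally show ?thesis .
  qed
  with BK show ?thesis by (auto simp: weak_comm_def reduce_def)
qed

text \<open>The easy inclusion: an element of the reduced weak commutant, composed with
  \<open>E\<close>, lies in \<open>N\<close>, so the defining relation of the bicommutant can be
  read off on \<open>E D\<close>.\<close>

lemma reduce_bicomm_subset: "reduce D0 (bicomm D UNIV M) \<subseteq> bicomm D0 K0 M0"
proof
  fix Y assume "Y \<in> reduce D0 (bicomm D UNIV M)"
  then obtain X where X: "X \<in> bicomm D UNIV M" and Y: "Y = restr D0 X" by (auto simp: reduce_def)
  have XL: "X \<in> LDag D UNIV" and Xc: "\<And>C \<xi>. C \<in> N \<Longrightarrow> \<xi> \<in> D \<Longrightarrow> C (X \<xi>) = X (C \<xi>)"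
    using X by (auto simp: bicomm_iff)
  have r: "restr D0 X \<in> LDag D0 K0" "\<And>\<eta>. \<eta> \<in> D0 \<Longrightarrow> dagger D0 K0 (restr D0 X) \<eta> = dag X \<eta>"
    using restr_LDag[OF XL] Xc[OF E_comm] by auto
  have "cinner (C (Y \<xi>)) \<eta> = cinner (C \<xi>) (dagger D0 K0 Y \<eta>)"
    if C: "C \<in> weak_comm D0 K0 M0" and \<xi>: "\<xi> \<in> D0" and \<eta>: "\<eta> \<in> D0" for C \<xi> \<eta>
  proof -
    have D: "\<xi> \<in> D" "\<eta> \<in> D" "E \<xi> = \<xi>" using \<xi> \<eta> by (auto simp: D0_iff)
    have "cinner (C (E (X \<xi>))) \<eta> = cinner (C (E \<xi>)) (dag X \<eta>)"
      using X[unfolded bicomm_def, THEN CollectD, THEN conjunct2, rule_format, OF commutant_lift[OF C] D(1,2)] .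
    moreover have "E (X \<xi>) = X \<xi>" using Xc[OF E_comm D(1)] D by simp
    ultimately show ?thesis using \<xi> D r(2)[OF \<eta>] by (simp add: Y restr_def)
  qed
  then show "Y \<in> bicomm D0 K0 M0" using r(1) by (simp add: bicomm_def Y)
qed

end

subsection \<open>Essentially self-adjoint operators\<close>

lemma cl_domI:
  "x \<in> K \<Longrightarrow> (\<And>n. u n \<in> D) \<Longrightarrow> cconv u x \<Longrightarrow> cconv (\<lambda>n. f (u n)) y \<Longrightarrow> x \<in> cl_dom K D f"
  unfolding cl_dom_def by blast

context dense_domain
begin

text \<open>Closability: the adjoint is densely defined, and testing against \<open>D\<close>
  determines the limit. This justifies the definite description in \<open>cl\<close>.\<close>

lemma cl_unique:
  assumes X: "X \<in> LDag D K" and "\<And>n. u n \<in> D" "cconv u \<xi>" "cconv (\<lambda>n. X (u n)) \<eta>"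
    and "\<And>n. v n \<in> D" "cconv v \<xi>" "cconv (\<lambda>n. X (v n)) \<zeta>" and "\<eta> \<in> K" "\<zeta> \<in> K"
  shows "\<eta> = \<zeta>"
proof (rule dense_eqI)
  have lim: "cinner \<theta> y = cinner (dagger D K X \<theta>) \<xi>"
    if "\<theta> \<in> D" "\<And>n. w n \<in> D" "cconv w \<xi>" "cconv (\<lambda>n. X (w n)) y" for \<theta> w y
  proof -
    have "(\<lambda>n. cinner \<theta> (X (w n))) \<longlonglongrightarrow> cinner \<theta> y" by (rule cconv_cinner_right[OF that(4)])
    moreover have "cinner \<theta> (X (w n)) = cinner (dagger D K X \<theta>) (w n)" for n
      using cinner_dagger'[OF X that(1,2)] by simp
    moreover have "(\<lambda>n. cinner (dagger D K X \<theta>) (w n)) \<longlonglongrightarrow> cinner (dagger D K X \<theta>) \<xi>"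
      by (rule cconv_cinner_right[OF that(3)])
    ultimately show ?thesis using LIMSEQ_unique by simp
  qed
  show "cinner \<theta> \<eta> = cinner \<theta> \<zeta>" if "\<theta> \<in> D" for \<theta>
    using lim[OF that assms(2-4)] lim[OF that assms(5-7)] by simp
qed fact+

end

locale ess_sa = dense_domain D UNIV for D :: "'a::chilbert set" +
  fixes T :: "'a \<Rightarrow> 'a"
  assumes T_LDag: "T \<in> LDag D UNIV" and T_esa: "ess_self_adjoint D UNIV T"
begin

abbreviation S :: "'a set" where "S \<equiv> cl_dom UNIV D T"
abbreviation Tc :: "'a \<Rightarrow> 'a" where "Tc \<equiv> cl UNIV D T"

lemma closure_sequence:
  assumes "x \<in> S"
  obtains u where "\<And>n. u n \<in> D" "cconv u x" "cconv (\<lambda>n. T (u n)) (Tc x)"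
proof -
  obtain u \<eta> where u: "\<forall>n. u n \<in> D" "cconv u x" "cconv (\<lambda>n. T (u n)) \<eta>"
    using assms unfolding cl_dom_def by blast
  have "(THE \<eta>. \<exists>X. (\<forall>n. X n \<in> D) \<and> cconv X x \<and> cconv (\<lambda>n. T (X n)) \<eta>) = \<eta>"
  proof (rule the_equality)
    show "\<exists>X. (\<forall>n. X n \<in> D) \<and> cconv X x \<and> cconv (\<lambda>n. T (X n)) \<eta>" using u by blast
    show "\<zeta> = \<eta>" if "\<exists>X. (\<forall>n. X n \<in> D) \<and> cconv X x \<and> cconv (\<lambda>n. T (X n)) \<zeta>" for \<zeta>
      using that u cl_unique[OF T_LDag] by (metis UNIV_I)
  qed
  then have "Tc x = \<eta>" using assms by (simp add: cl_def)
  then show ?thesis using u that by blast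
qed

lemma D_le_S: "x \<in> D \<Longrightarrow> x \<in> S"
  by (rule cl_domI[OF UNIV_I _ cconv_const cconv_const])

lemma Tc_eq: "x \<in> D \<Longrightarrow> Tc x = T x"
  using closure_sequence[OF D_le_S, of x] cl_unique[OF T_LDag, of _ x "Tc x" "\<lambda>_. x" "T x"]
  by (metis UNIV_I cconv_const)

lemma S_dense: "dense_domain S UNIV"
proof
  show "csubspace S"
    unfolding csubspace_def
  proof (intro conjI ballI allI)
    show "0 \<in> S" by (rule D_le_S) (rule csubspace_zero[OF D_sub])
    fix x assume x: "x \<in> S"
    obtain u where u: "\<And>n. u n \<in> D" "cconv u x" "cconv (\<lambda>n. T (u n)) (Tc x)"
      using closure_sequence[OF x] by blast
    show "cscale c x \<in> S" for c
    proof -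
      have "cconv (\<lambda>n. T (cscale c (u n))) (cscale c (Tc x))"
        using cconv_cscale[OF u(3)] u(1) by (simp add: LDag_cscale[OF T_LDag])
      then show ?thesis
        using cl_domI[OF UNIV_I csubspace_cscale[OF D_sub u(1)] cconv_cscale[OF u(2)]] by blast
    qed
    fix y assume y: "y \<in> S"
    obtain v where v: "\<And>n. v n \<in> D" "cconv v y" "cconv (\<lambda>n. T (v n)) (Tc y)"
      using closure_sequence[OF y] by blast
    have "cconv (\<lambda>n. T (u n + v n)) (Tc x + Tc y)"
      using cconv_add[OF u(3) v(3)] u(1) v(1) by (simp add: LDag_add[OF T_LDag])
    then show "x + y \<in> S"
      using cl_domI[OF UNIV_I csubspace_add[OF D_sub u(1) v(1)] cconv_add[OF u(2) v(2)]] by blast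
  qed
  show "dense_in S UNIV" using dense D_le_S unfolding dense_in_def by blast
qed (rule K_sub)

lemma Tc_sym:
  assumes "x \<in> S" "y \<in> S"
  shows "cinner (Tc x) y = cinner x (Tc y)"
proof -
  have "y \<in> adj_dom UNIV S Tc" "adj UNIV S Tc y = Tc y"
    using T_esa assms by (auto simp: ess_self_adjoint_def Let_def)
  then show ?thesis
    using dense_domain.adj_works(2)[OF S_dense, of y Tc x] assms by simp
qed

lemma T_sym: "x \<in> D \<Longrightarrow> y \<in> D \<Longrightarrow> cinner (T x) y = cinner x (T y)"
  using Tc_sym[of x y] D_le_S by (simp add: Tc_eq)

text \<open>The shift by \<open>\<i>\<close> makes the operator bounded below and, by essential
  self-adjointness, gives it dense range; \<open>T\<close> alone may have a kernel.\<close>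

definition A :: "'a \<Rightarrow> 'a" where "A x = T x + cscale \<i> x"

text \<open>A nonzero vector orthogonal to the range would be an eigenvector of the adjoint for the
  eigenvalue \<open>\<i>\<close>, which is impossible when the adjoint is symmetric: a deficiency
  index vanishes.\<close>

lemma A_range_total:
  assumes "\<And>\<xi>. \<xi> \<in> D \<Longrightarrow> cinner (A \<xi>) \<eta> = 0"
  shows "\<eta> = 0"
proof -
  have T: "cinner (T \<xi>) \<eta> = cinner \<xi> (cscale \<i> \<eta>)" if "\<xi> \<in> D" for \<xi>
    using assms[OF that] by (simp add: A_def cinner_simps)
  \<comment> \<open>\<open>ess_self_adjoint\<close> speaks of the adjoint of the closure, so the
    relation is carried from \<open>D\<close> to \<open>S\<close> by limits.\<close>
  have "cinner (Tc x) \<eta> = cinner x (cscale \<i> \<eta>)" if x: "x \<in> S" for x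
  proof -
    obtain u where u: "\<And>n. u n \<in> D" "cconv u x" "cconv (\<lambda>n. T (u n)) (Tc x)"
      using closure_sequence[OF x] by blast
    have "(\<lambda>n. cinner (T (u n)) \<eta>) \<longlonglongrightarrow> cinner (Tc x) \<eta>" by (rule cconv_cinner_left[OF u(3)])
    moreover have "(\<lambda>n. cinner (u n) (cscale \<i> \<eta>)) \<longlonglongrightarrow> cinner x (cscale \<i> \<eta>)"
      by (rule cconv_cinner_left[OF u(2)])
    ultimately show ?thesis using T[OF u(1)] LIMSEQ_unique by simp
  qed
  note * = dense_domain.adj_eq[OF S_dense UNIV_I UNIV_I this]
  have \<eta>: "\<eta> \<in> S" using *(1) T_esa by (simp add: ess_self_adjoint_def Let_def)
  then have "Tc \<eta> = cscale \<i> \<eta>" using *(2) T_esa by (simp add: ess_self_adjoint_def Let_def)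
  then have "cinner (cscale \<i> \<eta>) \<eta> = cinner \<eta> (cscale \<i> \<eta>)" using Tc_sym[OF \<eta> \<eta>] by simp
  then have "cinner \<eta> \<eta> = 0" by (simp add: cinner_simps)
  then show ?thesis by (simp add: cinner_self_eq_0)
qed

text \<open>\<open><T x, x>\<close> is real, so the cross term drops out and \<open>\<parallel>A
  x\<parallel>^2 = \<parallel>T x\<parallel>^2 + \<parallel>x\<parallel>^2\<close>. The first bound
  converts estimates by \<open>T\<close> into estimates by \<open>A\<close>, the second makes the
  inverse of \<open>A\<close> a contraction.\<close>

lemma A_norm:
  assumes "x \<in> D"
  shows "cnorm (T x) \<le> cnorm (A x)" "cnorm x \<le> cnorm (A x)"
proof -
  have "cinner (T x) x = cnj (cinner (T x) x)"
    using T_sym[OF assms assms] cinner_cnj_commute[of "T x" x] by simp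
  then have "Im (cinner (T x) x) = 0" by (metis complex_cnj_cancel_iff Reals_cnj_iff complex_is_Real_iff)
  then have "(cnorm (A x))\<^sup>2 = (cnorm (T x))\<^sup>2 + (cnorm x)\<^sup>2"
    by (simp add: A_def cnorm_add_sq cnorm_cscale cinner_scale_right)
  then have "(cnorm (T x))\<^sup>2 \<le> (cnorm (A x))\<^sup>2" "(cnorm x)\<^sup>2 \<le> (cnorm (A x))\<^sup>2" by simp_all
  then show "cnorm (T x) \<le> cnorm (A x)" "cnorm x \<le> cnorm (A x)"
    using power2_le_imp_le cnorm_ge_0 by blast+
qed

lemma A_add: "x \<in> D \<Longrightarrow> y \<in> D \<Longrightarrow> A (x + y) = A x + A y"
  by (simp add: A_def LDag_add[OF T_LDag] cscale_add_right)

lemma A_cscale: "x \<in> D \<Longrightarrow> A (cscale c x) = cscale c (A x)"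
  by (simp add: A_def LDag_cscale[OF T_LDag] cscale_add_right cscale_cscale mult.commute)

lemma A_zero: "A 0 = 0"
  using A_cscale[OF csubspace_zero[OF D_sub], of 0] by simp

end

subsection \<open>The bicommutant of the reduced space\<close>

context reduction
begin

lemma reduced_adjoint:
  assumes "adjoint_pair C C'" "E x = x" "E y = y"
  shows "cinner (E (C x)) y = cinner x (E (C' y))"
proof -
  have "cinner (E (C x)) y = cinner (C x) (E y)" by (rule E_cinner)
  also have "\<dots> = cinner (E x) (C' y)" using adjoint_pairD[OF assms(1)] assms by simp
  also have "\<dots> = cinner x (E (C' y))" by (rule E_cinner)
  finally show ?thesis .
qed

lemma E_N_D0: "C \<in> N \<Longrightarrow> \<xi> \<in> D0 \<Longrightarrow> E (C \<xi>) \<in> D0"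
  using N_invariant D0_iff by blast

lemma LDag_range: "Y \<in> LDag D0 K0 \<Longrightarrow> \<xi> \<in> D0 \<Longrightarrow> E (Y \<xi>) = Y \<xi>"
  using R.LDag_in_K K0_iff by blast

text \<open>Lifting and compressing replace the weak commutant of the reduced space by compressions
  of elements of \<open>N\<close>, which have adjoints in \<open>N\<close> and preserve
  \<open>D\<close>.\<close>

lemma reduced_bicomm_iff:
  "Y \<in> bicomm D0 K0 M0 \<longleftrightarrow>
    Y \<in> LDag D0 K0 \<and> (\<forall>C\<in>N. \<forall>\<xi>\<in>D0. E (C (Y \<xi>)) = Y (E (C \<xi>)))"
proof (cases "Y \<in> LDag D0 K0")
  case Y: True
  show ?thesis
  proof
    assume B: "Y \<in> bicomm D0 K0 M0"
    have "E (C (Y \<xi>)) = Y (E (C \<xi>))" if C: "C \<in> N" and \<xi>: "\<xi> \<in> D0" for C \<xi>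
    proof (rule R.dense_eqI_left)
      show "Y (E (C \<xi>)) \<in> K0" using R.LDag_in_K[OF Y] E_N_D0[OF C \<xi>] .
      fix \<eta> assume \<eta>: "\<eta> \<in> D0"
      have "cinner (restr K0 (\<lambda>x. E (C x)) (Y \<xi>)) \<eta>
          = cinner (restr K0 (\<lambda>x. E (C x)) \<xi>) (dagger D0 K0 Y \<eta>)"
        using B[unfolded bicomm_def, THEN CollectD, THEN conjunct2, rule_format, OF commutant_reduce[OF C] \<xi> \<eta>] .
      then have "cinner (E (C (Y \<xi>))) \<eta> = cinner (E (C \<xi>)) (dagger D0 K0 Y \<eta>)"
        using R.D_le_K[OF \<xi>] R.LDag_in_K[OF Y \<xi>] by (simp add: restr_def)
      also have "\<dots> = cinner (Y (E (C \<xi>))) \<eta>"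
        using R.cinner_dagger[OF Y E_N_D0[OF C \<xi>] \<eta>] by simp
      finally show "cinner (E (C (Y \<xi>))) \<eta> = cinner (Y (E (C \<xi>))) \<eta>" .
    qed auto
    then show "Y \<in> LDag D0 K0 \<and> (\<forall>C\<in>N. \<forall>\<xi>\<in>D0. E (C (Y \<xi>)) = Y (E (C \<xi>)))" using Y by blast
  next
    assume B: "Y \<in> LDag D0 K0 \<and> (\<forall>C\<in>N. \<forall>\<xi>\<in>D0. E (C (Y \<xi>)) = Y (E (C \<xi>)))"
    have "cinner (C (Y \<xi>)) \<eta> = cinner (C \<xi>) (dagger D0 K0 Y \<eta>)"
      if C: "C \<in> weak_comm D0 K0 M0" and \<xi>: "\<xi> \<in> D0" and \<eta>: "\<eta> \<in> D0" for C \<xi> \<eta>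
    proof -
      note L = commutant_lift[OF C]
      have E\<xi>: "E \<xi> = \<xi>" "E \<eta> = \<eta>" using \<xi> \<eta> by (auto simp: D0_iff)
      have CB: "C \<in> BK K0" using C by (simp add: weak_comm_def)
      have CK: "E (C x) = C x" if "x \<in> K0" for x
        using CB that unfolding BK_def by (metis (no_types, lifting) K0_iff image_subset_iff mem_Collect_eq)
      have "cinner (C (Y \<xi>)) \<eta> = cinner (E (C (E (Y \<xi>)))) \<eta>"
        using CK[OF R.LDag_in_K[OF Y \<xi>]] LDag_range[OF Y \<xi>] by simp
      also have "E (C (E (Y \<xi>))) = Y (E (C (E \<xi>)))"
        using B L \<xi> by (metis (no_types, lifting))
      also have "E (C (E \<xi>)) = C \<xi>" using E\<xi> CK[OF R.D_le_K[OF \<xi>]] by simp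
      also have "cinner (Y (C \<xi>)) \<eta> = cinner (C \<xi>) (dagger D0 K0 Y \<eta>)"
      proof (rule R.cinner_dagger[OF Y _ \<eta>])
        show "C \<xi> \<in> D0"
          using E_N_D0[OF L \<xi>] E\<xi> CK[OF R.D_le_K[OF \<xi>]] by simp
      qed
      finally show ?thesis .
    qed
    then show "Y \<in> bicomm D0 K0 M0" using Y unfolding bicomm_def by blast
  qed
qed (simp add: bicomm_def)

lemma reduced_bicomm_dagger:
  assumes "Y \<in> bicomm D0 K0 M0"
  shows "dagger D0 K0 Y \<in> bicomm D0 K0 M0"
proof -
  have Y: "Y \<in> LDag D0 K0" and c: "\<And>C \<xi>. C \<in> N \<Longrightarrow> \<xi> \<in> D0 \<Longrightarrow> E (C (Y \<xi>)) = Y (E (C \<xi>))"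
    using assms by (auto simp: reduced_bicomm_iff)
  let ?Y = "dagger D0 K0 Y"
  note Y' = R.dagger_LDag(1)[OF Y]
  have "E (C (?Y \<xi>)) = ?Y (E (C \<xi>))" if C: "C \<in> N" and \<xi>: "\<xi> \<in> D0" for C \<xi>
  proof (rule R.dense_eqI_left)
    show "?Y (E (C \<xi>)) \<in> K0" using R.LDag_in_K[OF Y'] E_N_D0[OF C \<xi>] .
    fix \<eta> assume \<eta>: "\<eta> \<in> D0"
    obtain C' where C': "C' \<in> N" "adjoint_pair C C'" using N_adjoint[OF C] by blast
    have E\<xi>: "E \<xi> = \<xi>" "E \<eta> = \<eta>" using \<xi> \<eta> by (auto simp: D0_iff)
    have "cinner (E (C (?Y \<xi>))) \<eta> = cinner (?Y \<xi>) (E (C' \<eta>))"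
      by (rule reduced_adjoint[OF C'(2) LDag_range[OF Y' \<xi>] E\<xi>(2)])
    also have "\<dots> = cinner \<xi> (Y (E (C' \<eta>)))"
      by (rule R.cinner_dagger'[OF Y \<xi> E_N_D0[OF C'(1) \<eta>]])
    also have "\<dots> = cinner \<xi> (E (C' (Y \<eta>)))" by (simp only: c[OF C'(1) \<eta>])
    also have "\<dots> = cinner (E (C \<xi>)) (Y \<eta>)"
      by (rule reduced_adjoint[OF C'(2) E\<xi>(1) LDag_range[OF Y \<eta>], symmetric])
    also have "\<dots> = cinner (?Y (E (C \<xi>))) \<eta>"
      by (rule R.cinner_dagger'[OF Y E_N_D0[OF C \<xi>] \<eta>, symmetric])
    finally show "cinner (E (C (?Y \<xi>))) \<eta> = cinner (?Y (E (C \<xi>))) \<eta>" .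
  qed auto
  then show ?thesis using Y' unfolding reduced_bicomm_iff by blast
qed

text \<open>Everything rests on
  \<open><X \<xi>, \<eta>> = <X2 \<xi>, X1\<^sup>\<dagger> \<eta>>\<close> for the product
  \<open>X\<close>. The first half of \<open>wmult_defined\<close> makes the product meaningful, the
  second provides its adjoint on \<open>D0\<close>.\<close>

lemma reduced_bicomm_wmult:
  assumes X1: "X1 \<in> bicomm D0 K0 M0" and X2: "X2 \<in> bicomm D0 K0 M0"
    and def: "wmult_defined D0 K0 X1 X2"
  shows "wmult D0 K0 X1 X2 \<in> bicomm D0 K0 M0"
proof -
  have L1: "X1 \<in> LDag D0 K0" and L2: "X2 \<in> LDag D0 K0"
    and c2: "\<And>C \<xi>. C \<in> N \<Longrightarrow> \<xi> \<in> D0 \<Longrightarrow> E (C (X2 \<xi>)) = X2 (E (C \<xi>))"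
    using X1 X2 by (auto simp: reduced_bicomm_iff)
  let ?X1 = "dagger D0 K0 X1" and ?X = "wmult D0 K0 X1 X2"
  have L1': "?X1 \<in> LDag D0 K0" and c1: "\<And>C \<xi>. C \<in> N \<Longrightarrow> \<xi> \<in> D0 \<Longrightarrow> E (C (?X1 \<xi>)) = ?X1 (E (C \<xi>))"
    using reduced_bicomm_dagger[OF X1] by (auto simp: reduced_bicomm_iff)
  have dom1: "X2 \<xi> \<in> adj_dom K0 D0 ?X1" if "\<xi> \<in> D0" for \<xi>
    using def that by (auto simp: wmult_defined_def)
  have dom2: "?X1 \<eta> \<in> adj_dom K0 D0 X2" if "\<eta> \<in> D0" for \<eta>
    using def that by (auto simp: wmult_defined_def dagger_def restr_def)
  have X_K: "?X \<xi> \<in> K0" if "\<xi> \<in> D0" for \<xi>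
    using R.adj_works(1)[OF dom1[OF that]] that by (simp add: wmult_def restr_def)
  have key: "cinner (?X \<xi>) \<eta> = cinner (X2 \<xi>) (?X1 \<eta>)" if "\<xi> \<in> D0" "\<eta> \<in> D0" for \<xi> \<eta>
  proof -
    have "cinner (?X1 \<eta>) (X2 \<xi>) = cinner \<eta> (adj K0 D0 ?X1 (X2 \<xi>))"
      by (rule R.adj_works(2)[OF dom1[OF that(1)] that(2)])
    also have "\<dots> = cinner \<eta> (?X \<xi>)" using that by (simp add: wmult_def restr_def)
    finally show ?thesis by (metis cinner_cnj_commute)
  qed
  have XL: "?X \<in> LDag D0 K0"
  proof (rule R.LDagI(1)[where W = "\<lambda>\<eta>. adj K0 D0 X2 (?X1 \<eta>)"])
    show "?X x = 0" if "x \<notin> D0" for x using that by (simp add: wmult_def restr_def)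
    show "adj K0 D0 X2 (?X1 x) \<in> K0" if "x \<in> D0" for x by (rule R.adj_works(1)[OF dom2[OF that]])
    show "cinner (?X \<xi>) \<eta> = cinner \<xi> (adj K0 D0 X2 (?X1 \<eta>))" if "\<xi> \<in> D0" "\<eta> \<in> D0" for \<xi> \<eta>
      using key[OF that] R.adj_works(2)[OF dom2[OF that(2)] that(1)] by simp
  qed (rule X_K)
  have "E (C (?X \<xi>)) = ?X (E (C \<xi>))" if C: "C \<in> N" and \<xi>: "\<xi> \<in> D0" for C \<xi>
  proof (rule R.dense_eqI_left)
    show "?X (E (C \<xi>)) \<in> K0" by (rule X_K[OF E_N_D0[OF C \<xi>]])
    fix \<eta> assume \<eta>: "\<eta> \<in> D0"
    obtain C' where C': "C' \<in> N" "adjoint_pair C C'" using N_adjoint[OF C] by blast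
    have E\<eta>: "E \<eta> = \<eta>" using \<eta> by (auto simp: D0_iff)
    have "cinner (E (C (?X \<xi>))) \<eta> = cinner (?X \<xi>) (E (C' \<eta>))"
      by (rule reduced_adjoint[OF C'(2) LDag_range[OF XL \<xi>] E\<eta>])
    also have "\<dots> = cinner (X2 \<xi>) (?X1 (E (C' \<eta>)))" by (rule key[OF \<xi> E_N_D0[OF C'(1) \<eta>]])
    also have "\<dots> = cinner (X2 \<xi>) (E (C' (?X1 \<eta>)))" by (simp only: c1[OF C'(1) \<eta>])
    also have "\<dots> = cinner (E (C (X2 \<xi>))) (?X1 \<eta>)"
      by (rule reduced_adjoint[OF C'(2) LDag_range[OF L2 \<xi>] LDag_range[OF L1' \<eta>], symmetric])
    also have "\<dots> = cinner (X2 (E (C \<xi>))) (?X1 \<eta>)" by (simp only: c2[OF C \<xi>])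
    also have "\<dots> = cinner (?X (E (C \<xi>))) \<eta>" by (rule key[OF E_N_D0[OF C \<xi>] \<eta>, symmetric])
    finally show "cinner (E (C (?X \<xi>))) \<eta> = cinner (?X (E (C \<xi>))) \<eta>" .
  qed auto
  then show ?thesis using XL unfolding reduced_bicomm_iff by blast
qed

text \<open>Closure under weak products comes from \<open>M0\<close> being a bicommutant. Full
  closedness is inherited because sequences in \<open>E D\<close> are sequences in \<open>D\<close>,
  and \<open>E D\<close> is the intersection of \<open>D\<close> with \<open>E H\<close>.\<close>

lemma reduced_partial_GW:
  assumes GW: "partial_GW D UNIV M"
    and bic: "reduce D0 (bicomm D UNIV M) = bicomm D0 K0 M0"
  shows "partial_GW D0 K0 M0"
proof -
  have M_bic: "M0 = bicomm D0 K0 M0" using GW bic by (simp add: partial_GW_def)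
  have r_in: "restr D0 X \<in> M0" if "X \<in> M" for X using that by (simp add: reduce_def)
  have ovs: "O_star_vs D0 K0 M0"
    unfolding O_star_vs_def
  proof (intro conjI ballI allI)
    show "M0 \<subseteq> LDag D0 K0" using restr_M(1) by (auto simp: reduce_def)
    have "(\<lambda>_. 0) \<in> M" using M_ovs by (simp add: O_star_vs_def)
    moreover have "restr D0 (\<lambda>_. 0) = (\<lambda>_. 0)" by (auto simp: restr_def)
    ultimately show "(\<lambda>_. 0) \<in> M0" using r_in by fastforce
    fix Y assume "Y \<in> M0"
    then obtain X where X: "X \<in> M" "Y = restr D0 X" by (auto simp: reduce_def)
    show "dagger D0 K0 Y \<in> M0"
    proof -
      have "dagger D0 K0 Y = restr D0 (dag X)"
        using restr_M(2)[OF X(1)] R.dagger_outside X(2) by (auto simp: restr_def[of _ "dag X"])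
      then show ?thesis using r_in[OF M_dagger[OF X(1)]] by simp
    qed
    show "(\<lambda>x. cscale c (Y x)) \<in> M0" for c
    proof -
      have "(\<lambda>x. cscale c (X x)) \<in> M" using M_ovs X by (simp add: O_star_vs_def)
      moreover have "restr D0 (\<lambda>x. cscale c (X x)) = (\<lambda>x. cscale c (Y x))"
        by (auto simp: restr_def X(2))
      ultimately show ?thesis using r_in by fastforce
    qed
    fix Y' assume "Y' \<in> M0"
    then obtain X' where X': "X' \<in> M" "Y' = restr D0 X'" by (auto simp: reduce_def)
    have "(\<lambda>x. X x + X' x) \<in> M" using M_ovs X X' by (simp add: O_star_vs_def)
    moreover have "restr D0 (\<lambda>x. X x + X' x) = (\<lambda>x. Y x + Y' x)"
      by (auto simp: restr_def X(2) X'(2))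
    ultimately show "(\<lambda>x. Y x + Y' x) \<in> M0" using r_in by fastforce
  qed
  have closed: "fully_closed D0 K0 M0"
    unfolding fully_closed_def
  proof (intro equalityI subsetI)
    fix x assume x: "x \<in> (\<Inter>X\<in>M0. cl_dom K0 D0 X)"
    have "x \<in> cl_dom UNIV D X" if "X \<in> M" for X
    proof -
      have "x \<in> cl_dom K0 D0 (restr D0 X)" using x r_in[OF that] by blast
      then obtain u \<eta> where u: "\<forall>n. u n \<in> D0" "cconv u x" "cconv (\<lambda>n. restr D0 X (u n)) \<eta>"
        unfolding cl_dom_def by blast
      then have "cconv (\<lambda>n. X (u n)) \<eta>" by (simp add: restr_def)
      then show ?thesis
        using cl_domI[OF UNIV_I _ u(2)] u(1) D0_iff by blast
    qed
    \<comment> \<open>An empty intersection would be everything, so a member of \<open>M\<close> is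
      exhibited.\<close>
    moreover have "x \<in> K0"
    proof -
      have "restr D0 X \<in> M0" if "X \<in> M" for X using r_in that .
      moreover obtain X where "X \<in> M" using M_ovs by (auto simp: O_star_vs_def)
      ultimately show ?thesis using x unfolding cl_dom_def by blast
    qed
    moreover have "(\<Inter>X\<in>M. cl_dom UNIV D X) = D"
      using GW by (simp add: partial_GW_def fully_closed_def)
    ultimately show "x \<in> D0" by (auto simp: D0_iff K0_iff)
  next
    fix x assume x: "x \<in> D0"
    have "x \<in> cl_dom K0 D0 X" for X
      by (rule cl_domI[OF R.D_le_K[OF x] x cconv_const cconv_const])
    then show "x \<in> (\<Inter>X\<in>M0. cl_dom K0 D0 X)" by blast
  qed
  have inv: "C ` D0 \<subseteq> D0" if C: "C \<in> weak_comm D0 K0 M0" for C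
  proof -
    have CB: "C \<in> BK K0" using C by (simp add: weak_comm_def)
    have "C x \<in> D0" if x: "x \<in> D0" for x
    proof -
      have "C (E x) \<in> D" using N_invariant[OF commutant_lift[OF C], of x] x by (simp only: D0_iff)
      moreover have "C x \<in> K0" using CB R.D_le_K[OF x] unfolding BK_def by blast
      ultimately show ?thesis using x by (metis D0_iff K0_iff)
    qed
    then show ?thesis by blast
  qed
  have "partial_O_star_alg D0 K0 M0"
    unfolding partial_O_star_alg_def
    using ovs reduced_bicomm_wmult M_bic by blast
  then show ?thesis
    unfolding partial_GW_def using closed inv M_bic by blast
qed

end

subsection \<open>Consequences of the metrizability of the graph topology\<close>

locale metrizable_reduction = reduction D M E for D :: "'a::chilbert set" and M E +
  fixes T :: "nat \<Rightarrow> 'a \<Rightarrow> 'a"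
  assumes T_in_M: "T n \<in> M" and T_ess_sa: "ess_self_adjoint D UNIV (T n)"
    and T_mono: "\<xi> \<in> D \<Longrightarrow> cnorm (T n \<xi>) \<le> cnorm (T (Suc n) \<xi>)"
    and T_top: "graph_top_defined_by D M T"
begin

lemma T_LDag: "T n \<in> LDag D UNIV"
  by (rule M_LDag[OF T_in_M])

lemma T_mono': "\<xi> \<in> D \<Longrightarrow> m \<le> n \<Longrightarrow> cnorm (T m \<xi>) \<le> cnorm (T n \<xi>)"
  by (rule lift_Suc_mono_le[of "\<lambda>n. cnorm (T n \<xi>)"]) (auto simp: T_mono)

text \<open>Equality of the topologies is given through open sets only; openness of the unit ball of
  \<open>s\<close> at the origin becomes an inequality by rescaling.\<close>

lemma graph_seminorm_dominated:
  assumes s: "s \<in> graph_seminorms M"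
    and s_add: "\<And>x y. x \<in> D \<Longrightarrow> y \<in> D \<Longrightarrow> s (x + y) \<le> s x + s y"
    and s_scale: "\<And>c x. x \<in> D \<Longrightarrow> s (cscale c x) = cmod c * s x"
  shows "\<exists>n c. 0 \<le> c \<and> (\<forall>\<xi>\<in>D. s \<xi> \<le> c * cnorm (T n \<xi>))"
proof -
  define U where "U = {\<xi>\<in>D. s \<xi> < 1}"
  have s0: "s 0 = 0" using s_scale[OF csubspace_zero[OF D_subspace], of 0] by simp
  have "seminorm_open D (graph_seminorms M) U"
    unfolding seminorm_open_def
  proof (intro conjI ballI)
    show "U \<subseteq> D" by (auto simp: U_def)
    fix x assume x: "x \<in> U"
    have "{y\<in>D. \<forall>p\<in>{s}. p (y - x) < 1 - s x} \<subseteq> U"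
    proof
      fix y assume "y \<in> {y\<in>D. \<forall>p\<in>{s}. p (y - x) < 1 - s x}"
      then have y: "y \<in> D" "s (y - x) < 1 - s x" by auto
      then have "s y \<le> s (y - x) + s x"
        using s_add[of "y - x" x] csubspace_diff[OF D_subspace] x by (simp add: U_def)
      then show "y \<in> U" using y by (simp add: U_def)
    qed
    moreover have "1 - s x > 0" using x by (simp add: U_def)
    ultimately show "\<exists>F e. finite F \<and> F \<subseteq> graph_seminorms M \<and> 0 < e \<and> {y\<in>D. \<forall>p\<in>F. p (y - x) < e} \<subseteq> U"
      using s by (intro exI[of _ "{s}"] exI[of _ "1 - s x"]) simp
  qed
  then have "seminorm_open D (range (\<lambda>n \<xi>. cnorm (T n \<xi>))) U"
    using T_top unfolding graph_top_defined_by_def by blast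
  moreover have "0 \<in> U" using s0 csubspace_zero[OF D_subspace] by (simp add: U_def)
  ultimately obtain F e where F: "finite F" "F \<subseteq> range (\<lambda>n \<xi>. cnorm (T n \<xi>))" and e: "e > 0"
    and sub: "{y\<in>D. \<forall>p\<in>F. p (y - 0) < e} \<subseteq> U"
    unfolding seminorm_open_def by blast
  obtain J where J: "finite J" "F = (\<lambda>n \<xi>. cnorm (T n \<xi>)) ` J"
    using finite_subset_image[OF F] by blast
  \<comment> \<open>Monotonicity replaces finitely many seminorms by the one of largest index;
    \<open>0\<close> is the default for empty \<open>J\<close>.\<close>
  define n where "n = Max (insert 0 J)"
  have small: "s y < 1" if y: "y \<in> D" "cnorm (T n y) < e" for y
  proof -
    have "cnorm (T j y) < e" if "j \<in> J" for j
      using T_mono'[OF y(1), of j n] J(1) that y(2) by (simp add: n_def)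
    then have "y \<in> {y\<in>D. \<forall>p\<in>F. p (y - 0) < e}" using y(1) J(2) by auto
    then show ?thesis using sub by (auto simp: U_def)
  qed
  have "s \<xi> \<le> (2 / e) * cnorm (T n \<xi>)" if \<xi>: "\<xi> \<in> D" for \<xi>
  proof (rule ccontr)
    assume neg: "\<not> s \<xi> \<le> (2 / e) * cnorm (T n \<xi>)"
    then have "s \<xi> > (2 / e) * cnorm (T n \<xi>)" by simp
    moreover have "(2 / e) * cnorm (T n \<xi>) \<ge> 0" using e by simp
    ultimately have pos: "s \<xi> > 0" by linarith
    define y where "y = cscale (complex_of_real (1 / s \<xi>)) \<xi>"
    have y: "y \<in> D" using \<xi> csubspace_cscale[OF D_subspace] by (simp add: y_def)
    have "cnorm (T n y) = cnorm (T n \<xi>) / s \<xi>"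
      using pos \<xi> by (simp add: y_def LDag_cscale[OF T_LDag] cnorm_cscale norm_divide)
    also have "\<dots> < e"
    proof -
      have "2 * cnorm (T n \<xi>) < e * s \<xi>" using neg e by (simp add: field_simps)
      then have "cnorm (T n \<xi>) < e * s \<xi>" using cnorm_ge_0[of "T n \<xi>"] by linarith
      then show ?thesis using pos by (simp add: pos_divide_less_eq)
    qed
    finally have "s y < 1" by (rule small[OF y])
    moreover have "s y = 1" using s_scale[OF \<xi>] pos by (simp add: y_def norm_divide)
    ultimately show False by simp
  qed
  then show ?thesis using e by (intro exI[of _ n] exI[of _ "2 / e"]) auto
qed

lemma operator_dominated:
  assumes "Z \<in> M"
  shows "\<exists>n c. 0 \<le> c \<and> (\<forall>\<xi>\<in>D. cnorm (Z \<xi>) \<le> c * cnorm (T n \<xi>))"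
proof (rule graph_seminorm_dominated)
  show "(\<lambda>\<xi>. cnorm (Z \<xi>)) \<in> graph_seminorms M" using assms by (auto simp: graph_seminorms_def)
qed (simp_all add: LDag_add[OF M_LDag[OF assms]] LDag_cscale[OF M_LDag[OF assms]] cnorm_triangle cnorm_cscale)

lemma norm_dominated: "\<exists>n c. 0 \<le> c \<and> (\<forall>\<xi>\<in>D. cnorm \<xi> \<le> c * cnorm (T n \<xi>))"
proof (rule graph_seminorm_dominated)
  show "cnorm \<in> graph_seminorms M" by (simp add: graph_seminorms_def)
qed (simp_all add: cnorm_triangle cnorm_cscale)

text \<open>The limit of a graph-Cauchy sequence lies in the adjoint domain of every
  \<open>Z \<in> M\<close>, because the images under \<open>dag Z\<close> converge as well;
  self-adjointness then puts it in \<open>D\<close>.\<close>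

lemma graph_complete:
  assumes X: "\<And>k. X k \<in> D"
    and cauchy: "\<And>n e. e > 0 \<Longrightarrow> \<exists>N. \<forall>i\<ge>N. \<forall>j\<ge>N. cnorm (T n (X i - X j)) < e"
  obtains x where "x \<in> D" "cconv X x" "\<And>n. (\<lambda>k. cnorm (T n (X k - x))) \<longlonglongrightarrow> 0"
proof -
  have dominated_cauchy: "\<exists>N. \<forall>i\<ge>N. \<forall>j\<ge>N. s (X i - X j) < e"
    if dom: "\<exists>n c. 0 \<le> c \<and> (\<forall>\<xi>\<in>D. s \<xi> \<le> c * cnorm (T n \<xi>))" and e: "e > 0" for s :: "'a \<Rightarrow> real" and e
  proof -
    obtain n c where c: "0 \<le> c" "\<And>\<xi>. \<xi> \<in> D \<Longrightarrow> s \<xi> \<le> c * cnorm (T n \<xi>)" using dom by blast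
    obtain N where N: "\<And>i j. i \<ge> N \<Longrightarrow> j \<ge> N \<Longrightarrow> cnorm (T n (X i - X j)) < e / (c + 1)"
      using cauchy[of "e / (c + 1)" n] e c(1) by auto
    have "s (X i - X j) < e" if "i \<ge> N" "j \<ge> N" for i j
    proof -
      have "s (X i - X j) \<le> c * cnorm (T n (X i - X j))" by (intro c csubspace_diff D_subspace X)
      also have "\<dots> \<le> c * (e / (c + 1))" using N[OF that] c(1) by (intro mult_left_mono) auto
      also have "\<dots> < e" using c(1) e by (simp add: field_simps)
      finally show ?thesis .
    qed
    then show ?thesis by blast
  qed
  obtain x where x: "cconv X x"
    using cauchy_cconv[of X] dominated_cauchy[OF norm_dominated] by blast
  have conv: "\<exists>z. cconv (\<lambda>k. Z (X k)) z" if Z: "Z \<in> M" for Z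
    using cauchy_cconv[of "\<lambda>k. Z (X k)"] dominated_cauchy[OF operator_dominated[OF Z]]
    by (metis LDag_diff[OF M_LDag[OF Z]] X)
  have "x \<in> adj_dom UNIV D Z" if Z: "Z \<in> M" for Z
  proof -
    obtain z where z: "cconv (\<lambda>k. dag Z (X k)) z" using conv[OF M_dagger[OF Z]] by blast
    show ?thesis
    proof (rule adj_eq(1))
      fix \<theta> assume \<theta>: "\<theta> \<in> D"
      have "(\<lambda>k. cinner (Z \<theta>) (X k)) \<longlonglongrightarrow> cinner (Z \<theta>) x" by (rule cconv_cinner_right[OF x])
      moreover have "(\<lambda>k. cinner \<theta> (dag Z (X k))) \<longlonglongrightarrow> cinner \<theta> z" by (rule cconv_cinner_right[OF z])
      moreover have "cinner (Z \<theta>) (X k) = cinner \<theta> (dag Z (X k))" for k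
        by (rule cinner_dagger[OF M_LDag[OF Z] \<theta> X])
      ultimately show "cinner (Z \<theta>) x = cinner \<theta> z" using LIMSEQ_unique by simp
    qed auto
  qed
  then have xD: "x \<in> D" using M_sa unfolding self_adjoint_ovs_def by blast
  have "(\<lambda>k. cnorm (T n (X k - x))) \<longlonglongrightarrow> 0" for n
  proof -
    obtain z where z: "cconv (\<lambda>k. T n (X k)) z" using conv[OF T_in_M] by blast
    have "z = T n x"
      by (rule cl_unique[OF T_LDag X x z xD cconv_const cconv_const]) auto
    with z show ?thesis by (simp add: cconv_def LDag_diff[OF T_LDag X xD])
  qed
  then show ?thesis using that x xD by blast
qed

text \<open>\<open>\<parallel>Y \<xi>\<parallel>\<close> is the supremum of
  \<open>|<\<xi>, dagger D0 K0 Y \<eta>>|\<close> over unit vectors \<open>\<eta>\<close> of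
  \<open>E D\<close>, hence lower semicontinuous although no continuity of \<open>Y\<close> is known
  beforehand.\<close>

lemma reduced_operator_bounded:
  assumes Y: "Y \<in> LDag D0 K0"
  shows "\<exists>n c. \<forall>\<xi>\<in>D0. cnorm (Y \<xi>) \<le> c * cnorm (T n \<xi>)"
proof (rule lsc_seminorm_bounded[where V = D0 and p = "\<lambda>n \<xi>. cnorm (T n \<xi>)" and q = "\<lambda>\<xi>. cnorm (Y \<xi>)"])
  have D: "x \<in> D" if "x \<in> D0" for x using that D0_iff by blast
  show "csubspace D0" by (rule R.D_sub)
  show "cnorm (T n (x + y)) \<le> cnorm (T n x) + cnorm (T n y)" if "x \<in> D0" "y \<in> D0" for n x y
    using that D by (simp add: LDag_add[OF T_LDag] cnorm_triangle)
  show "cnorm (T n (cscale c x)) = cmod c * cnorm (T n x)" if "x \<in> D0" for n c x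
    using that D by (simp add: LDag_cscale[OF T_LDag] cnorm_cscale)
  show "cnorm (T n x) \<le> cnorm (T (Suc n) x)" if "x \<in> D0" for n x using T_mono[OF D[OF that]] .
  show "cnorm (Y (x + y)) \<le> cnorm (Y x) + cnorm (Y y)" if "x \<in> D0" "y \<in> D0" for x y
    using that by (simp add: R.LDag_add[OF Y] cnorm_triangle)
  show "cnorm (Y (cscale c x)) = cmod c * cnorm (Y x)" if "x \<in> D0" for c x
    using that by (simp add: R.LDag_cscale[OF Y] cnorm_cscale)
  show "\<exists>n \<delta>. \<delta> > 0 \<and> (\<forall>y\<in>D0. cnorm (T n (y - x)) \<le> \<delta> \<longrightarrow> a < cnorm (Y y))"
    if x: "x \<in> D0" and a: "a < cnorm (Y x)" for x a
  proof (cases "a < 0")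
    case True
    then show ?thesis using cnorm_ge_0 by (intro exI[of _ 0] exI[of _ 1]) (auto intro: less_le_trans)
  next
    case False
    \<comment> \<open>A vector \<open>\<eta>\<close> of \<open>E D\<close> close to
      \<open>Y x\<close> nearly attains the norm, so that
      \<open>|<Y x, \<eta>>| > a \<parallel>\<eta>\<parallel>\<close>.\<close>
    obtain u where u: "\<And>n. u n \<in> D0" "cconv u (Y x)"
      using R.dense R.LDag_in_K[OF Y x] unfolding dense_in_def by blast
    have "(\<lambda>n. cmod (cinner (Y x) (u n)) - a * cnorm (u n)) \<longlonglongrightarrow> cmod (cinner (Y x) (Y x)) - a * cnorm (Y x)"
      by (intro tendsto_diff tendsto_norm tendsto_mult_left cconv_cinner_right cconv_cnorm u)
    moreover have "cmod (cinner (Y x) (Y x)) - a * cnorm (Y x) > 0"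
      using a False by (simp add: cmod_cinner_self power2_eq_square)
    ultimately have "\<forall>\<^sub>F n in sequentially. cmod (cinner (Y x) (u n)) - a * cnorm (u n) > 0"
      by (rule order_tendstoD(1))
    then obtain k where k: "cmod (cinner (Y x) (u k)) - a * cnorm (u k) > 0"
      using eventually_happens' trivial_limit_sequentially by blast
    define \<eta> where "\<eta> = u k"
    define W where "W = dagger D0 K0 Y \<eta>"
    define d where "d = cmod (cinner x W) - a * cnorm \<eta>"
    have \<eta>: "\<eta> \<in> D0" using u by (simp add: \<eta>_def)
    have YW: "cinner (Y y) \<eta> = cinner y W" if "y \<in> D0" for y
      unfolding W_def by (rule R.cinner_dagger[OF Y that \<eta>])
    have d: "d > 0" using k YW[OF x] by (simp add: d_def \<eta>_def)
    obtain n c where c: "0 \<le> c" "\<And>\<xi>. \<xi> \<in> D \<Longrightarrow> cnorm \<xi> \<le> c * cnorm (T n \<xi>)"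
      using norm_dominated by blast
    \<comment> \<open>Small enough that \<open><x, W>\<close> changes by less than the slack
      \<open>d\<close>; the added \<open>1\<close> keeps the denominator positive.\<close>
    define \<delta> where "\<delta> = d / (c * cnorm W + 1)"
    have cW: "c * cnorm W \<ge> 0" using c by simp
    have \<delta>: "\<delta> > 0" using d cW by (simp add: \<delta>_def)
    have "a < cnorm (Y y)" if y: "y \<in> D0" and yx: "cnorm (T n (y - x)) \<le> \<delta>" for y
    proof -
      have "cmod (cinner (y - x) W) \<le> cnorm (y - x) * cnorm W" by (rule cauchy_schwarz)
      also have "\<dots> \<le> (c * cnorm (T n (y - x))) * cnorm W"
        using c(2)[of "y - x"] csubspace_diff[OF D_subspace D[OF y] D[OF x]] by (intro mult_right_mono) auto
      also have "\<dots> \<le> (c * \<delta>) * cnorm W" using yx c(1) by (intro mult_right_mono mult_left_mono) auto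
      also have "\<dots> = d * (c * cnorm W / (c * cnorm W + 1))" by (simp add: \<delta>_def)
      also have "\<dots> < d * 1" using d cW by (intro mult_strict_left_mono) (simp_all add: divide_less_eq)
      finally have "cmod (cinner (y - x) W) < d" by simp
      moreover have "cmod (cinner x W) \<le> cmod (cinner y W) + cmod (cinner (y - x) W)"
        using norm_triangle_ineq4[of "cinner y W" "cinner (y - x) W"] by (simp add: cinner_diff_left)
      moreover have "cmod (cinner y W) \<le> cnorm (Y y) * cnorm \<eta>"
        using cauchy_schwarz[of "Y y" \<eta>] YW[OF y] by simp
      ultimately have "a * cnorm \<eta> < cnorm (Y y) * cnorm \<eta>" by (simp add: d_def)
      then show ?thesis using cnorm_ge_0[of \<eta>] mult_right_less_imp_less by blast
    qed
    then show ?thesis using \<delta> by blast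
  qed
  show "\<exists>x\<in>D0. \<forall>n. (\<lambda>k. cnorm (T n (X k - x))) \<longlonglongrightarrow> 0"
    if X: "\<And>k. X k \<in> D0" and cauchy: "\<And>n e. e > 0 \<Longrightarrow> \<exists>N. \<forall>i\<ge>N. \<forall>j\<ge>N. cnorm (T n (X i - X j)) < e" for X
  proof -
    obtain x where x: "x \<in> D" "cconv X x" "\<And>n. (\<lambda>k. cnorm (T n (X k - x))) \<longlonglongrightarrow> 0"
      using graph_complete[OF D[OF X] cauchy] by blast
    \<comment> \<open>The graph limit is also a norm limit, so continuity of \<open>E\<close> keeps
      it in \<open>E H\<close>.\<close>
    have "E (X k) = X k" for k using X D0_iff by blast
    then have "cconv X (E x)" using E_cconv[OF x(2)] by simp
    then have "E x = x" using cconv_unique x(2) by blast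
    then show ?thesis using x D0_iff by blast
  qed
qed auto

end

subsection \<open>Extension of reduced operators\<close>

locale esa_reduction = reduction D M E + ess_sa D T for D :: "'a::chilbert set" and M E T +
  assumes T_M: "T \<in> M"
begin

lemma A_N: "C \<in> N \<Longrightarrow> \<xi> \<in> D \<Longrightarrow> C (A \<xi>) = A (C \<xi>)"
  using N_BK[of C] N_commute[OF _ T_M] by (simp add: A_def BK_UNIV_iff)

lemma A_K0: "\<xi> \<in> D0 \<Longrightarrow> E (A \<xi>) = A \<xi>"
  using A_N[OF E_comm] D0_iff by metis

lemma A_reduced_total:
  assumes "E \<eta> = \<eta>" "\<And>\<xi>. \<xi> \<in> D0 \<Longrightarrow> cinner (A \<xi>) \<eta> = 0"
  shows "\<eta> = 0"
proof (rule A_range_total)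
  fix \<xi> assume \<xi>: "\<xi> \<in> D"
  have "cinner (A \<xi>) \<eta> = cinner (E (A \<xi>)) \<eta>" using assms(1) E_cinner[of "A \<xi>" \<eta>] by simp
  also have "\<dots> = 0" using A_N[OF E_comm \<xi>] assms(2)[of "E \<xi>"] \<xi> by simp
  finally show "cinner (A \<xi>) \<eta> = 0" .
qed

lemma A_zero_closed: "csubspace V \<Longrightarrow> V \<subseteq> D \<Longrightarrow> Y 0 = 0 \<Longrightarrow> (0, 0) \<in> {(A \<xi>, Y \<xi>) | \<xi>. \<xi> \<in> V}"
  using csubspace_zero[of V] A_zero by force

text \<open>Serves two maps: an operator \<open>Y\<close> on \<open>V = D0\<close>, and the identity
  on \<open>V = D\<close>, which produces a bounded inverse of \<open>A\<close>.\<close>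

lemma A_graph_extension:
  assumes V: "csubspace V" "V \<subseteq> D"
    and add: "\<And>x y. x \<in> V \<Longrightarrow> y \<in> V \<Longrightarrow> Y (x + y) = Y x + Y y"
    and scale: "\<And>c x. x \<in> V \<Longrightarrow> Y (cscale c x) = cscale c (Y x)"
    and bound: "\<And>x. x \<in> V \<Longrightarrow> cnorm (Y x) \<le> b * cnorm (A x)" and b: "b \<ge> 0"
  obtains G where "canonical_ext {(A \<xi>, Y \<xi>) | \<xi>. \<xi> \<in> V} G" "\<And>x. cnorm (G x) \<le> b * cnorm x"
proof (rule bounded_relation_extension[of "{(A \<xi>, Y \<xi>) | \<xi>. \<xi> \<in> V}" b])
  have "Y 0 = 0" using scale[OF csubspace_zero[OF V(1)], of 0] by simp
  then show "(0, 0) \<in> {(A \<xi>, Y \<xi>) | \<xi>. \<xi> \<in> V}" by (rule A_zero_closed[OF V])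
  show "(x + x', y + y') \<in> {(A \<xi>, Y \<xi>) | \<xi>. \<xi> \<in> V}"
    if xy: "(x, y) \<in> {(A \<xi>, Y \<xi>) | \<xi>. \<xi> \<in> V}" "(x', y') \<in> {(A \<xi>, Y \<xi>) | \<xi>. \<xi> \<in> V}" for x y x' y'
  proof -
    obtain \<xi> \<xi>' where "\<xi> \<in> V" "\<xi>' \<in> V" "x = A \<xi>" "y = Y \<xi>" "x' = A \<xi>'" "y' = Y \<xi>'" using xy by auto
    then show ?thesis
      using csubspace_add[OF V(1), of \<xi> \<xi>'] A_add[of \<xi> \<xi>'] add[of \<xi> \<xi>'] V(2) by force
  qed
  show "(cscale c x, cscale c y) \<in> {(A \<xi>, Y \<xi>) | \<xi>. \<xi> \<in> V}"
    if xy: "(x, y) \<in> {(A \<xi>, Y \<xi>) | \<xi>. \<xi> \<in> V}" for c x y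
  proof -
    obtain \<xi> where "\<xi> \<in> V" "x = A \<xi>" "y = Y \<xi>" using xy by auto
    then show ?thesis
      using csubspace_cscale[OF V(1), of \<xi> c] A_cscale[of \<xi> c] scale[of \<xi> c] V(2) by force
  qed
qed (use bound b that in auto)

text \<open>\<open>G\<close> is the bounded quotient of \<open>Y\<close> by \<open>A\<close> on
  \<open>E H\<close>, spread over the span of \<open>N E H\<close>; the extension problem thereby
  concerns bounded operators only.\<close>

lemma reduced_extension:
  assumes Y: "Y \<in> bicomm D0 K0 M0" and bound: "\<And>\<xi>. \<xi> \<in> D0 \<Longrightarrow> cnorm (Y \<xi>) \<le> b * cnorm (A \<xi>)"
    and b: "b \<ge> 0"
  obtains G where "\<exists>G'. adjoint_pair G G'"
    and "\<And>\<xi>. \<xi> \<in> D0 \<Longrightarrow> G (A \<xi>) = Y \<xi>"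
    and "\<And>C x. C \<in> N \<Longrightarrow> G (C x) = C (G x)"
    and "\<And>x. \<forall>C\<in>N. \<forall>h. cinner (C (E h)) x = 0 \<Longrightarrow> G x = 0"
    and "\<And>x z. \<forall>C\<in>N. \<forall>h. cinner (C (E h)) z = 0 \<Longrightarrow> cinner (G x) z = 0"
proof -
  have YL: "Y \<in> LDag D0 K0" and Yc: "\<And>C \<xi>. C \<in> N \<Longrightarrow> \<xi> \<in> D0 \<Longrightarrow> E (C (Y \<xi>)) = Y (E (C \<xi>))"
    using Y by (auto simp: reduced_bicomm_iff)
  define \<Gamma> where "\<Gamma> = {(A \<xi>, Y \<xi>) | \<xi>. \<xi> \<in> D0}"
  have D0D: "D0 \<subseteq> D" using D0_iff by blast
  obtain B where B: "canonical_ext \<Gamma> B" and B_b: "\<And>x. cnorm (B x) \<le> b * cnorm x"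
    using A_graph_extension[OF R.D_sub D0D R.LDag_add[OF YL] R.LDag_cscale[OF YL] bound b] unfolding \<Gamma>_def by blast
  \<comment> \<open>\<open>A\<close> and \<open>Y\<close> both intertwine with \<open>E C E\<close>,
    which therefore maps the graph into itself.\<close>
  have red: "(E (C (E x)), E (C (E y))) \<in> \<Gamma>" if C: "C \<in> N" and xy: "(x, y) \<in> \<Gamma>" for C x y
  proof -
    obtain \<xi> where \<xi>: "\<xi> \<in> D0" "x = A \<xi>" "y = Y \<xi>" using xy by (auto simp: \<Gamma>_def)
    have \<xi>D: "\<xi> \<in> D" using \<xi> D0D by blast
    have "E (C (E x)) = A (E (C \<xi>))"
      using A_K0[OF \<xi>(1)] A_N[OF C \<xi>D] A_N[OF E_comm N_invariant[OF C \<xi>D]] \<xi>(2) by simp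
    moreover have "E (C (E y)) = Y (E (C \<xi>))"
      using LDag_range[OF YL \<xi>(1)] Yc[OF C \<xi>(1)] \<xi>(3) by simp
    ultimately show ?thesis using E_N_D0[OF C \<xi>(1)] unfolding \<Gamma>_def by blast
  qed
  have comm: "SA.reduced_comm B"
    unfolding SA.reduced_comm_def
  proof (intro ballI allI)
    fix C x assume C: "C \<in> N"
    obtain C' where C': "C' \<in> N" "adjoint_pair C C'" using N_adjoint[OF C] by blast
    have "adjoint_pair (\<lambda>x. E (C (E x))) (\<lambda>x. E (C' (E x)))"
      using C'(2) E_adjoint by (simp add: adjoint_pair_def)
    from canonical_ext_commute[OF B this red[OF C]]
    show "B (E (C (E x))) = E (C (E (B x)))" using red[OF C'(1)] by blast
  qed
  have BE: "B (E x) = E (B x)" for x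
    using comm E_comm unfolding SA.reduced_comm_def by (metis E_idempotent)
  obtain B' where ap: "adjoint_pair B B'" using B unfolding canonical_ext_def by blast
  \<comment> \<open>The domain of \<open>\<Gamma>\<close> lies in \<open>E H\<close>, so
    \<open>B\<close> is zero on the complement of \<open>E H\<close>; hence
    \<open>B = B E = E B\<close>.\<close>
  have EB: "E (B x) = B x" for x
  proof -
    have "cinner s (x - E x) = 0" if "s \<in> Domain \<Gamma>" for s
    proof -
      have "E s = s" using that A_K0 by (auto simp: \<Gamma>_def)
      then show ?thesis using E_cinner[of s x] by (simp add: cinner_diff_right)
    qed
    then have "B (x - E x) = 0" using B unfolding canonical_ext_def by blast
    then show ?thesis using BE by (simp add: adjoint_pair_diff[OF ap])
  qed
  obtain G where G: "\<exists>G'. adjoint_pair G G'" "\<And>x. G (E x) = B x"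
    "\<And>C x. C \<in> N \<Longrightarrow> G (C x) = C (G x)"
    "\<And>x. \<forall>C\<in>N. \<forall>h. cinner (C (E h)) x = 0 \<Longrightarrow> G x = 0"
    "\<And>x z. \<forall>C\<in>N. \<forall>h. cinner (C (E h)) z = 0 \<Longrightarrow> cinner (G x) z = 0"
    using SA.reduced_commutant_extension[OF comm ap B_b b EB] by blast
  have GA: "G (A \<xi>) = Y \<xi>" if "\<xi> \<in> D0" for \<xi>
  proof -
    have "G (A \<xi>) = B (A \<xi>)" using G(2)[of "A \<xi>"] A_K0[OF that] by simp
    also have "\<dots> = Y \<xi>" using B that unfolding canonical_ext_def \<Gamma>_def by blast
    finally show ?thesis .
  qed
  show ?thesis
    by (rule that[of G]) (fact G GA)+
qed

lemma commute_adjoint: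
  assumes ap: "adjoint_pair G G'" and comm: "\<And>C x. C \<in> N \<Longrightarrow> G (C x) = C (G x)" and C: "C \<in> N"
  shows "G' (C x) = C (G' x)"
proof (rule cinner_eqI_left)
  fix w
  obtain C' where C': "C' \<in> N" "adjoint_pair C C'" using N_adjoint[OF C] by blast
  have "cinner (G' (C x)) w = cinner x (C' (G w))"
    using adjoint_pairD'[OF ap] adjoint_pairD[OF C'(2)] by simp
  also have "\<dots> = cinner x (G (C' w))" by (simp only: comm[OF C'(1)])
  also have "\<dots> = cinner (C (G' x)) w"
    using adjoint_pairD'[OF ap] adjoint_pairD[OF C'(2)] by simp
  finally show "cinner (G' (C x)) w = cinner (C (G' x)) w" .
qed

lemma bicomm_extension:
  assumes Y: "Y \<in> bicomm D0 K0 M0"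
    and bound: "\<And>\<xi>. \<xi> \<in> D0 \<Longrightarrow> cnorm (Y \<xi>) \<le> b * cnorm (T \<xi>)"
    and bound': "\<And>\<xi>. \<xi> \<in> D0 \<Longrightarrow> cnorm (dagger D0 K0 Y \<xi>) \<le> b * cnorm (T \<xi>)"
    and b: "b \<ge> 0"
  shows "Y \<in> reduce D0 (bicomm D UNIV M)"
proof -
  let ?Y = "dagger D0 K0 Y"
  have YL: "Y \<in> LDag D0 K0" using Y by (simp add: reduced_bicomm_iff)
  have D: "x \<in> D" if "x \<in> D0" for x using that D0_iff by blast
  have TA: "b * cnorm (T \<xi>) \<le> b * cnorm (A \<xi>)" if "\<xi> \<in> D0" for \<xi>
    using A_norm(1)[OF D[OF that]] b by (intro mult_left_mono)
  have bA: "cnorm (Y \<xi>) \<le> b * cnorm (A \<xi>)" and bA': "cnorm (?Y \<xi>) \<le> b * cnorm (A \<xi>)"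
    if "\<xi> \<in> D0" for \<xi>
    using TA[OF that] bound[OF that] bound'[OF that] by linarith+
  obtain G where G: "\<exists>G'. adjoint_pair G G'" "\<And>\<xi>. \<xi> \<in> D0 \<Longrightarrow> G (A \<xi>) = Y \<xi>"
    "\<And>C x. C \<in> N \<Longrightarrow> G (C x) = C (G x)"
    "\<And>x. \<forall>C\<in>N. \<forall>h. cinner (C (E h)) x = 0 \<Longrightarrow> G x = 0"
    "\<And>x z. \<forall>C\<in>N. \<forall>h. cinner (C (E h)) z = 0 \<Longrightarrow> cinner (G x) z = 0"
    using reduced_extension[OF Y bA b] by blast
  obtain H where H: "\<exists>G'. adjoint_pair H G'" "\<And>\<xi>. \<xi> \<in> D0 \<Longrightarrow> H (A \<xi>) = ?Y \<xi>"
    "\<And>C x. C \<in> N \<Longrightarrow> H (C x) = C (H x)"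
    "\<And>x. \<forall>C\<in>N. \<forall>h. cinner (C (E h)) x = 0 \<Longrightarrow> H x = 0"
    "\<And>x z. \<forall>C\<in>N. \<forall>h. cinner (C (E h)) z = 0 \<Longrightarrow> cinner (H x) z = 0"
    using reduced_extension[OF reduced_bicomm_dagger[OF Y] bA' b] by blast
  define \<Gamma> where "\<Gamma> = {(A \<xi>, \<xi>) | \<xi>. \<xi> \<in> D}"
  obtain R where R: "canonical_ext \<Gamma> R"
    unfolding \<Gamma>_def by (rule A_graph_extension[of D "\<lambda>x. x" 1]) (use D_subspace A_norm(2) in auto)
  have RA: "R (A \<xi>) = \<xi>" if "\<xi> \<in> D" for \<xi>
    using R that unfolding canonical_ext_def \<Gamma>_def by blast
  have \<Gamma>_N: "(C x, C y) \<in> \<Gamma>" if C: "C \<in> N" and xy: "(x, y) \<in> \<Gamma>" for C x y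
    using xy A_N[OF C] N_invariant[OF C] unfolding \<Gamma>_def by auto
  have RN: "R (C x) = C (R x)" if C: "C \<in> N" for C x
  proof -
    obtain C' where C': "C' \<in> N" "adjoint_pair C C'" using N_adjoint[OF C] by blast
    show ?thesis
      using canonical_ext_commute[OF R C'(2) \<Gamma>_N[OF C]] \<Gamma>_N[OF C'(1)] by blast
  qed
  obtain G' H' R' where ap: "adjoint_pair G G'" "adjoint_pair H H'" "adjoint_pair R R'"
    using G(1) H(1) R unfolding canonical_ext_def by blast
  \<comment> \<open>For \<open>x = A \<xi>\<close> and \<open>y = A \<eta>\<close> with
    \<open>\<xi>\<close>, \<open>\<eta>\<close> in \<open>D\<close>, \<open>cinner (Q x) y\<close>
    is \<open><G A \<xi>, \<eta>> - <\<xi>, H A \<eta>>\<close>, so \<open>Q = 0\<close> gives the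
    adjointness wanted.\<close>
  define Q where "Q x = R' (G x) - H' (R x)" for x
  define Q' where "Q' x = G' (R x) - R' (H x)" for x
  have cQ: "cinner (Q x) y = cinner (G x) (R y) - cinner (R x) (H y)" for x y
    by (simp add: Q_def cinner_diff_left adjoint_pairD'[OF ap(3)] adjoint_pairD'[OF ap(2)])
  have apQ: "adjoint_pair Q Q'"
    unfolding adjoint_pair_def cQ
    by (simp add: Q'_def cinner_diff_right adjoint_pairD[OF ap(1)] adjoint_pairD[OF ap(3)])
  have N_lin: "C (x - y) = C x - C y" "C 0 = 0" if "C \<in> N" for C x y
    using N_adjoint[OF that] adjoint_pair_diff adjoint_pair_zero by blast+
  have R'N: "R' (C x) = C (R' x)" and H'N: "H' (C x) = C (H' x)" and G'N: "G' (C x) = C (G' x)"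
    if "C \<in> N" for C x
    using commute_adjoint[OF ap(3) RN that] commute_adjoint[OF ap(2) H(3) that]
      commute_adjoint[OF ap(1) G(3) that] by blast+
  have QN: "Q (C x) = C (Q x)" and Q'N: "Q' (C x) = C (Q' x)" if "C \<in> N" for C x
    using that by (simp_all add: Q_def Q'_def N_lin R'N H'N G'N RN G(3) H(3))
  \<comment> \<open>For vectors of \<open>D0\<close> the form of \<open>Q\<close> vanishes by the
    dagger relation of \<open>Y\<close>. Totality of \<open>A D0\<close> in \<open>E H\<close> is
    then used once in each argument of the form, here and in \<open>QE\<close>.\<close>
  have Q'A: "Q' (A \<eta>) = 0" if \<eta>: "\<eta> \<in> D0" for \<eta>
  proof (rule A_reduced_total)
    show "E (Q' (A \<eta>)) = Q' (A \<eta>)" using Q'N[OF E_comm, of "A \<eta>"] A_K0[OF \<eta>] by simp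
    fix \<xi> assume \<xi>: "\<xi> \<in> D0"
    have "cinner (A \<xi>) (Q' (A \<eta>)) = cinner (Q (A \<xi>)) (A \<eta>)" by (rule adjoint_pairD[OF apQ, symmetric])
    also have "\<dots> = cinner (Y \<xi>) \<eta> - cinner \<xi> (?Y \<eta>)"
      unfolding cQ using \<xi> \<eta> D by (simp only: G(2) H(2) RA)
    also have "\<dots> = 0" using R.cinner_dagger[OF YL \<xi> \<eta>] by simp
    finally show "cinner (A \<xi>) (Q' (A \<eta>)) = 0" .
  qed
  have QE: "Q (E h) = 0" for h
  proof (rule A_reduced_total)
    show "E (Q (E h)) = Q (E h)" using QN[OF E_comm, of "E h"] E_idempotent by simp
    show "cinner (A \<eta>) (Q (E h)) = 0" if "\<eta> \<in> D0" for \<eta>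
      using adjoint_pairD'[OF apQ, of "A \<eta>" "E h"] Q'A[OF that] by simp
  qed
  have Q0: "Q x = 0" for x
  proof (rule zero_on_set_and_complement[OF apQ, where S = "{C (E h) | C h. C \<in> N}"])
    show "Q x = 0" if x: "x \<in> {C (E h) | C h. C \<in> N}" for x
    proof -
      obtain C h where "C \<in> N" "x = C (E h)" using x by blast
      then show ?thesis using QN QE N_lin by simp
    qed
    \<comment> \<open>Off the span of \<open>N E H\<close>: \<open>G x = 0\<close>, and
      \<open>R x\<close> remains orthogonal to the span because \<open>R'\<close> commutes with
      \<open>N\<close>, whereas \<open>H w\<close> lies in its closure.\<close>
    show "Q x = 0" if x: "\<And>s. s \<in> {C (E h) | C h. C \<in> N} \<Longrightarrow> cinner s x = 0" for x
    proof (rule cinner_eqI_left)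
      fix w
      have perp: "cinner (C (E h)) x = 0" if "C \<in> N" for C h using x that by blast
      have "cinner (C (E h)) (R x) = 0" if C: "C \<in> N" for C h
        using perp[OF C, of "R' h"] adjoint_pairD'[OF ap(3), of "C (E h)" x]
        by (simp add: R'N[OF C] R'N[OF E_comm])
      then have "cinner (H w) (R x) = 0" using H(5) by blast
      then have "cinner (R x) (H w) = 0" by (simp add: cinner_eq_0_commute)
      moreover have "G x = 0" using perp G(4) by blast
      ultimately show "cinner (Q x) w = cinner 0 w" unfolding cQ by simp
    qed
  qed
  define X where "X = restr D (\<lambda>\<xi>. G (A \<xi>))"
  have adj: "cinner (X \<xi>) \<eta> = cinner \<xi> (H (A \<eta>))" if "\<xi> \<in> D" "\<eta> \<in> D" for \<xi> \<eta>
    using cQ[of "A \<xi>" "A \<eta>"] Q0 that by (simp add: X_def restr_def RA)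
  have "X \<in> LDag D UNIV"
    by (rule LDagI(1)[where W = "\<lambda>\<eta>. H (A \<eta>)"]) (auto simp: adj, simp add: X_def restr_def)
  moreover have "C (X \<xi>) = X (C \<xi>)" if "C \<in> N" "\<xi> \<in> D" for C \<xi>
    using that N_invariant[OF that] by (simp add: X_def restr_def G(3)[symmetric] A_N)
  ultimately have "X \<in> bicomm D UNIV M" by (simp add: bicomm_iff)
  moreover have "restr D0 X = Y"
  proof
    show "restr D0 X x = Y x" for x
    proof (cases "x \<in> D0")
      case True
      then show ?thesis using D G(2) by (simp add: X_def restr_def[of D0] restr_def[of D])
    next
      case False
      then show ?thesis using R.LDag_outside[OF YL False] by (simp add: restr_def)
    qed
  qed
  ultimately show ?thesis unfolding reduce_def by blast
qed

end

section \<open>A common dominating operator, and the equality of the bicommutants\<close>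

context metrizable_reduction
begin

lemma bicomm_subset_reduce: "bicomm D0 K0 M0 \<subseteq> reduce D0 (bicomm D UNIV M)"
proof
  fix Y assume Y: "Y \<in> bicomm D0 K0 M0"
  let ?Y = "dagger D0 K0 Y"
  have "Y \<in> LDag D0 K0" "?Y \<in> LDag D0 K0"
    using Y reduced_bicomm_dagger[OF Y] by (simp_all only: reduced_bicomm_iff)
  note bounds = this[THEN reduced_operator_bounded]
  obtain n c where c: "\<And>\<xi>. \<xi> \<in> D0 \<Longrightarrow> cnorm (Y \<xi>) \<le> c * cnorm (T n \<xi>)"
    using bounds(1) by blast
  obtain n' c' where c': "\<And>\<xi>. \<xi> \<in> D0 \<Longrightarrow> cnorm (?Y \<xi>) \<le> c' * cnorm (T n' \<xi>)"
    using bounds(2) by blast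
  \<comment> \<open>One \<open>T m\<close> has to dominate both \<open>Y\<close> and its adjoint, so
    that a single \<open>A\<close> serves both extensions; the norm-increasing property permits the
    larger index.\<close>
  define m where "m = max n n'"
  define b where "b = max \<bar>c\<bar> \<bar>c'\<bar>"
  interpret esa_reduction D M E "T m"
    by unfold_locales (rule T_LDag T_ess_sa T_in_M)+
  have le: "a * cnorm (T k \<xi>) \<le> b * cnorm (T m \<xi>)" if "a \<le> b" "k \<le> m" "\<xi> \<in> D0" for a k \<xi>
  proof -
    have "a * cnorm (T k \<xi>) \<le> b * cnorm (T k \<xi>)" using that by (intro mult_right_mono) auto
    also have "\<dots> \<le> b * cnorm (T m \<xi>)"
      using that T_mono'[of \<xi> k m] D0_iff[of \<xi>] by (intro mult_left_mono) (auto simp: b_def)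
    finally show ?thesis .
  qed
  show "Y \<in> reduce D0 (bicomm D UNIV M)"
  proof (rule bicomm_extension[OF Y])
    show "cnorm (Y \<xi>) \<le> b * cnorm (T m \<xi>)" if "\<xi> \<in> D0" for \<xi>
      by (rule order_trans[OF c[OF that] le]) (use that in \<open>auto simp: b_def m_def\<close>)
    show "cnorm (?Y \<xi>) \<le> b * cnorm (T m \<xi>)" if "\<xi> \<in> D0" for \<xi>
      by (rule order_trans[OF c'[OF that] le]) (use that in \<open>auto simp: b_def m_def\<close>)
  qed (simp add: b_def)
qed

lemma reduce_bicomm_eq: "reduce D0 (bicomm D UNIV M) = bicomm D0 K0 M0"
  using reduce_bicomm_subset bicomm_subset_reduce by (rule equalityI)

end

theorem theorem3p3:
  fixes D :: "'a::chilbert set"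
    and M :: "('a \<Rightarrow> 'a) set"
    and T :: "nat \<Rightarrow> 'a \<Rightarrow> 'a"
    and E :: "'a \<Rightarrow> 'a"
  assumes "csubspace D"
    and "dense_in D UNIV"
    and "O_star_vs D UNIV M"
    and "self_adjoint_ovs D UNIV M"
    and "\<forall>n. T n \<in> M"
    and "\<forall>n. ess_self_adjoint D UNIV (T n)"
    and "\<forall>n. \<forall>\<xi>\<in>D. cnorm (T n \<xi>) \<le> cnorm (T (Suc n) \<xi>)"
    and "graph_top_defined_by D M T"
    and "\<forall>n. spec_proj_invariant D UNIV (T n)"
    and "is_proj UNIV E"
    and "E \<in> weak_comm D UNIV M"
  shows "reduce (E ` D) (bicomm D UNIV M) = bicomm (E ` D) (E ` UNIV) (reduce (E ` D) M)
         \<and> (partial_GW D UNIV M \<longrightarrow> partial_GW (E ` D) (E ` UNIV) (reduce (E ` D) M))"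
proof -
  interpret metrizable_reduction D M E T
    by unfold_locales (use assms in auto)
  show ?thesis
    using reduce_bicomm_eq reduced_partial_GW by blast
qed

end
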